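(* Let $\mu$ and $\nu$ be two complex numbers such that $\Re\nu<0$. Then, for every nonzero complex number $z$ with $|\arg(z)|<\frac{\pi}{4}$, $$D_\nu(z)D_{\nu+\mu-1}(z)=\frac{2^{1-\frac{\mu}{2}}}{\Gamma(-\nu)}\int_0^{+\infty}e^{(2\nu+\mu)t-\frac{z^2}{4}\coth t}\,D_{\mu-1}\left(z\sqrt{\coth t}\right)\frac{dt}{(\sinh 2t)^{\frac{\mu}{2}}}.$$
   Context: $D_\nu$ is the parabolic cylinder function, the entire function of $z\in\mathbb{C}$ (and of $\nu\in\mathbb{C}$) defined by $$D_\nu(z)=2^{\nu/2}e^{-z^2/4}\left(\frac{\sqrt{\pi}}{\Gamma(\frac12-\frac{\nu}{2})}\Phi\left(-\tfrac{\nu}{2},\tfrac12;\tfrac{z^2}{2}\right)-\frac{\sqrt{2\pi}\,z}{\Gamma(-\frac{\nu}{2})}\Phi\left(\tfrac12-\tfrac{\nu}{2},\tfrac32;\tfrac{z^2}{2}\right)\right),$$ with $1/\Gamma$ taken to be $0$ at the poles of $\Gamma$, where $\Phi(\nu,\mu;z)=\sum_{n=0}^{\infty}\frac{(\nu)_n}{(\mu)_n}\frac{z^n}{n!}$ is Kummer's confluent hypergeometric function and $(\nu)_n=\nu(\nu+1)\cdots(\nu+n-1)$. The argument $\arg$ is the principal argument. *)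

theory Defs
  imports "HOL-Analysis.Analysis"
begin

definition coth :: "real \<Rightarrow> real" where
  "coth t = cosh t / sinh t"

definition kummer_Phi :: "complex \<Rightarrow> complex \<Rightarrow> complex \<Rightarrow> complex" where
  "kummer_Phi a b z = (\<Sum>n. pochhammer a n / pochhammer b n * z ^ n / fact n)"

text \<open>
  The reciprocal Gamma function \<^const>\<open>rGamma\<close> is entire and vanishes at the poles of
  \<^const>\<open>Gamma\<close>, so the definition makes sense for all complex \<open>\<nu>\<close>.
\<close>

definition parabolic_cylinder_D :: "complex \<Rightarrow> complex \<Rightarrow> complex" where
  "parabolic_cylinder_D \<nu> z =
     2 powr (\<nu> / 2) * exp (- (z\<^sup>2) / 4) *
     (of_real (sqrt pi) * rGamma (1 / 2 - \<nu> / 2) * kummer_Phi (- \<nu> / 2) (1 / 2) (z\<^sup>2 / 2)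
      - of_real (sqrt (2 * pi)) * z * rGamma (- \<nu> / 2) *
        kummer_Phi (1 / 2 - \<nu> / 2) (3 / 2) (z\<^sup>2 / 2))"

end

theory Submission
  imports Defs "HOL-Complex_Analysis.Complex_Analysis"
begin

text \<open>
  Write \<open>h \<kappa> w = exp (w\<^sup>2/4) D \<kappa> w\<close>, \<open>G \<kappa> w = exp (-w\<^sup>2/4) D \<kappa> w\<close> and \<open>\<alpha> = -\<nu>\<close>, so that
  \<open>H \<alpha> a = \<Gamma>(\<alpha>) h (-\<alpha>) a\<close> is the integral of \<open>s powr (\<alpha>-1) * exp (-a s - s\<^sup>2/2)\<close> over \<open>s > 0\<close>.
  The substitution \<open>x = exp (-2t)\<close> turns the claim into the case \<open>a = b = z\<close>, \<open>\<kappa> = \<mu>-1\<close>, of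
  \<open>R \<alpha> \<kappa> b a = H \<alpha> a * G (\<kappa>-\<alpha>) b\<close>, where \<open>R\<close> is the integral over \<open>0 < x < 1\<close> of
  \<open>x powr (\<alpha>-1) * (1-x\<^sup>2) powr (-(\<kappa>+1)/2) * G \<kappa> ((a x + b) / sqrt (1-x\<^sup>2))\<close>.
  For fixed \<open>b\<close>, \<open>R\<close> and \<open>H\<close> solve the same linear second-order differential equation in \<open>a\<close> (for
  \<open>R\<close> this uses that the integrand solves a heat equation in \<open>1-x\<^sup>2\<close>). Their Wronskian is a multiple of
  \<open>exp (a\<^sup>2/2)\<close>, but both functions have power growth as \<open>a \<rightarrow> \<infinity>\<close>; hence it vanishes and \<open>R = c H\<close>.
  As \<open>a \<rightarrow> \<infinity>\<close>, \<open>a powr \<alpha> * H\<close> tends to \<open>\<Gamma>(\<alpha>)\<close> and \<open>a powr \<alpha> * R\<close> to the Weyl fractional integral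
  \<open>\<integral> y powr (\<alpha>-1) * G \<kappa> (y+b) dy = \<Gamma>(\<alpha>) G (\<kappa>-\<alpha>) b\<close> over \<open>y > 0\<close>, which identifies \<open>c\<close>.
\<close>

section \<open>Kummer series and parabolic cylinder functions\<close>

text \<open>Splitting \<open>z\<close> into two variables \<open>a\<close> and \<open>b\<close>
  decouples the product: with \<open>b\<close> fixed, only the equation of the factor
  \<open>H\<close> is needed. The differential equation is never written out. It is encoded in two
  index shifts that \<open>R\<close> and \<open>H\<close> share: d/da raises the indices by one and
  changes the sign, and \<open>f (\<alpha>+2) + a * f (\<alpha>+1) = \<alpha> * f \<alpha>\<close>,
  that is \<open>f'' - a f' = \<alpha> f\<close>. For \<open>R\<close> the first is differentiation
  under the integral, the second an integration by parts in \<open>x\<close>. The condition |arg| <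
  pi/4 describes the part of the right half-plane where Re (w^2) > 0. There
  \<open>G \<kappa> (c / sqrt u)\<close> has Gaussian decay as u tends to 0, which beats every
  negative power of \<open>u\<close>; so \<open>R\<close> converges for every \<kappa> and no
  boundary term survives at x = 1. The integral for \<open>h \<kappa>\<close> diverges at s = 0 once
  Re \<kappa> >= 0, while the theorem allows every \<mu>. Growth bounds and the Weyl formula are
  therefore proved for Re \<kappa> < 0 and carried to all \<kappa> by the three-term
  recurrence.\<close>

lemma kummer_Phi_sums:
  assumes "Re b > 0"
  shows "(\<lambda>n. pochhammer a n / pochhammer b n / fact n * z ^ n) sums kummer_Phi a b z"
proof -
  define t where "t n = pochhammer a n / pochhammer b n * z ^ n / fact n" for n
  \<comment> \<open>For n >= N the estimates \<open>norm (a + n) <= n * (1 + norm a)\<close> and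
    \<open>norm (b + n) >= n\<close> bound the ratio of consecutive terms by
    \<open>norm z * (1 + norm a) / (n + 1)\<close>, hence by 1/2. The outer \<open>Suc\<close> also
    secures n >= 1.\<close>
  define N where "N = Suc (nat \<lceil>2 * norm z * (1 + norm a)\<rceil>)"
  have "norm (t (Suc n)) \<le> 1 / 2 * norm (t n)" if n: "n \<ge> N" for n
  proof -
    have n1: "real n \<ge> 1" "real n \<ge> 2 * norm z * (1 + norm a)"
      using n unfolding N_def by linarith+
    have "real n \<le> Re (b + of_nat n)" using assms by simp
    also have "\<dots> \<le> norm (b + of_nat n)" by (rule complex_Re_le_cmod)
    finally have bn: "real n \<le> norm (b + of_nat n)" .
    have "norm (a + of_nat n) \<le> norm a + real n"
      by (metis norm_of_nat norm_triangle_ineq)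
    also have "\<dots> \<le> real n * (1 + norm a)"
      using n1 mult_right_mono[of 1 "real n" "norm a"] by (simp add: algebra_simps)
    finally have an: "norm (a + of_nat n) \<le> real n * (1 + norm a)" .
    have "norm (a + of_nat n) * norm z \<le> real n * (1 + norm a) * norm z"
      by (intro mult_right_mono an) auto
    also have "\<dots> \<le> real n * (real n / 2)"
      using n1 by (intro order.trans[OF _ mult_left_mono[of "norm z * (1 + norm a)" "real n / 2" "real n"]]) auto
    also have "\<dots> \<le> norm (b + of_nat n) * ((real n + 1) / 2)"
      using n1 bn by (intro mult_mono) auto
    finally have "norm (a + of_nat n) * norm z / (norm (b + of_nat n) * (real n + 1)) \<le> 1 / 2"
      using bn n1 by (subst pos_divide_le_eq, intro mult_pos_pos) (auto simp: mult_ac)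
    moreover have "t (Suc n) = t n * ((a + of_nat n) * z / ((b + of_nat n) * (of_nat n + 1)))"
      by (simp add: t_def pochhammer_Suc field_simps)
    hence "norm (t (Suc n)) = norm (t n) * (norm (a + of_nat n) * norm z / (norm (b + of_nat n) * (real n + 1)))"
      by (simp add: norm_mult norm_divide) (metis norm_of_nat of_nat_Suc add.commute)
    ultimately show ?thesis
      using mult_left_mono[of "norm (a + of_nat n) * norm z / (norm (b + of_nat n) * (real n + 1))" "1/2" "norm (t n)"]
      by simp
  qed
  hence "summable t" by (intro summable_ratio_test[of "1/2" N]) auto
  hence "t sums kummer_Phi a b z"
    unfolding kummer_Phi_def t_def by (rule summable_sums)
  thus ?thesis by (simp add: t_def[abs_def] mult_ac)
qed

lemma has_field_derivative_kummer_Phi: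
  assumes "Re b > 0"
  shows "(kummer_Phi a b has_field_derivative a / b * kummer_Phi (a + 1) (b + 1) z) (at z)"
proof -
  define c where "c n = pochhammer a n / pochhammer b n / fact n" for n
  have S: "(\<lambda>n. c n * y ^ n) sums kummer_Phi a b y" for y
    using kummer_Phi_sums[OF assms] by (simp add: c_def)
  have "diffs c n = a / b * (pochhammer (a+1) n / pochhammer (b+1) n / fact n)" for n
    by (simp add: diffs_def c_def pochhammer_rec field_simps del: of_nat_Suc)
  hence "(\<lambda>n. diffs c n * z ^ n) = (\<lambda>n. a / b * (pochhammer (a+1) n / pochhammer (b+1) n / fact n * z ^ n))"
    by (simp add: fun_eq_iff)
  hence "(\<lambda>n. diffs c n * z ^ n) sums (a / b * kummer_Phi (a + 1) (b + 1) z)"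
    using sums_mult[OF kummer_Phi_sums[of "b+1" "a+1" z], of "a / b"] assms by simp
  moreover have "((\<lambda>y. \<Sum>n. c n * y ^ n) has_field_derivative (\<Sum>n. diffs c n * z ^ n)) (at z)"
    by (rule termdiffs_strong_converges_everywhere) (use S in \<open>auto intro: sums_summable\<close>)
  moreover have "(\<lambda>y. \<Sum>n. c n * y ^ n) = kummer_Phi a b"
    using S by (auto simp: fun_eq_iff sums_iff)
  ultimately show ?thesis by (simp add: sums_iff)
qed

text \<open>Compare coefficients of \<open>z ^ n\<close>: over the common denominator
  \<open>pochhammer (b+1) n\<close> the two terms on the right carry the factors b + n and a + n,
  whose difference no longer depends on n.\<close>

lemma kummer_Phi_contiguous1:
  assumes "Re b > 0"
  shows "(b - a) * kummer_Phi a (b + 1) z = b * kummer_Phi a b z - a * kummer_Phi (a + 1) (b + 1) z"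
proof -
  have b1: "Re (b + 1) > 0" using assms by simp
  have bn: "b + of_nat n \<noteq> 0" for n
    using assms by (metis add_pos_nonneg complex_Re_of_nat of_nat_0_le_iff order_less_irrefl plus_complex.simps(1) zero_complex.simps(1))
  have pb: "pochhammer (b+1) n \<noteq> 0" "pochhammer b n \<noteq> 0" for n
  proof -
    show "pochhammer b n \<noteq> 0" for n
      using bn by (auto simp: pochhammer_eq_0_iff add_eq_0_iff2)
    from this[of "Suc n"] show "pochhammer (b+1) n \<noteq> 0" by (simp add: pochhammer_rec)
  qed
  have eq: "(b - a) * (pochhammer a n / pochhammer (b+1) n / fact n * z ^ n) =
      b * (pochhammer a n / pochhammer b n / fact n * z ^ n)
      - a * (pochhammer (a+1) n / pochhammer (b+1) n / fact n * z ^ n)" for n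
  proof -
    have 1: "b * pochhammer (b+1) n = pochhammer b n * (b + of_nat n)"
      by (metis pochhammer_rec pochhammer_Suc)
    have 2: "a * pochhammer (a+1) n = pochhammer a n * (a + of_nat n)"
      by (metis pochhammer_rec pochhammer_Suc)
    have 3: "b / pochhammer b n = (b + of_nat n) / pochhammer (b+1) n"
      using 1 pb[of n] by (simp add: field_simps)
    have "b * (pochhammer a n / pochhammer b n / fact n * z ^ n)
      - a * (pochhammer (a+1) n / pochhammer (b+1) n / fact n * z ^ n) =
      ((b / pochhammer b n) * pochhammer a n - (a * pochhammer (a+1) n) / pochhammer (b+1) n) * (z ^ n / fact n)"
      by (simp add: left_diff_distrib right_diff_distrib diff_divide_distrib mult_ac)
    also have "\<dots> = (((b + of_nat n) / pochhammer (b+1) n) * pochhammer a n - (pochhammer a n * (a + of_nat n)) / pochhammer (b+1) n) * (z ^ n / fact n)"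
      by (simp only: 2 3)
    also have "\<dots> = (b - a) * (pochhammer a n / pochhammer (b+1) n / fact n * z ^ n)"
      using pb[of n] by (simp add: divide_simps) (simp add: algebra_simps)
    finally show ?thesis by simp
  qed
  have "(\<lambda>n. (b - a) * (pochhammer a n / pochhammer (b+1) n / fact n * z ^ n)) sums ((b - a) * kummer_Phi a (b + 1) z)"
    by (intro sums_mult kummer_Phi_sums b1)
  moreover have "(\<lambda>n. (b - a) * (pochhammer a n / pochhammer (b+1) n / fact n * z ^ n)) sums
     (b * kummer_Phi a b z - a * kummer_Phi (a + 1) (b + 1) z)"
    unfolding eq by (intro sums_mult sums_diff kummer_Phi_sums b1 assms)
  ultimately show ?thesis by (rule sums_unique2)
qed

lemma kummer_Phi_contiguous2:
  assumes "Re b > 0"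
  shows "kummer_Phi (a + 1) b z - kummer_Phi a b z = z / b * kummer_Phi (a + 1) (b + 1) z"
proof -
  have b1: "Re (b + 1) > 0" using assms by simp
  \<comment> \<open>The terms at n = 0 cancel, so the series effectively starts at n = 1. There the
    two Pochhammer symbols differ by \<open>(n+1) * pochhammer (a+1) n\<close>, and n + 1 cancels
    against the factorial.\<close>
  let ?f = "\<lambda>n. pochhammer (a+1) n / pochhammer b n / fact n * z ^ n - pochhammer a n / pochhammer b n / fact n * z ^ n"
  have "?f (Suc n) = z / b * (pochhammer (a+1) n / pochhammer (b+1) n / fact n * z ^ n)" for n
  proof -
    have 1: "pochhammer (a+1) (Suc n) - pochhammer a (Suc n) = of_nat (Suc n) * pochhammer (a+1) n"
      by (subst pochhammer_Suc, subst pochhammer_rec) (simp add: algebra_simps)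
    have "?f (Suc n) = (pochhammer (a+1) (Suc n) - pochhammer a (Suc n)) / pochhammer b (Suc n) / fact (Suc n) * z ^ Suc n"
      by (simp only: diff_divide_distrib left_diff_distrib)
    also have "\<dots> = z / b * (pochhammer (a+1) n / pochhammer (b+1) n / fact n * z ^ n)"
      unfolding 1 by (simp add: pochhammer_rec[of b] field_simps del: of_nat_Suc)
    finally show ?thesis .
  qed
  hence "(\<lambda>n. ?f (Suc n)) sums (z / b * kummer_Phi (a + 1) (b + 1) z)"
    by (simp only:) (intro sums_mult kummer_Phi_sums b1)
  hence "?f sums (z / b * kummer_Phi (a + 1) (b + 1) z)"
    by (subst (asm) sums_Suc_iff) simp
  moreover have "?f sums (kummer_Phi (a + 1) b z - kummer_Phi a b z)"
    by (intro sums_diff kummer_Phi_sums assms)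
  ultimately show ?thesis by (rule sums_unique2[symmetric])
qed

text \<open>For a natural number n, \<open>pc_h n\<close> is the Hermite polynomial He_n, and
  \<open>pc_G n\<close> is (-1)^n times the n-th derivative of \<open>exp (- w^2 / 2)\<close>. With
  these two exponential factors differentiation becomes a pure index shift: downwards for
  \<open>pc_h\<close>, upwards for \<open>pc_G\<close>.\<close>

definition pc_h :: "complex \<Rightarrow> complex \<Rightarrow> complex" where
  "pc_h \<kappa> w = exp (w\<^sup>2 / 4) * parabolic_cylinder_D \<kappa> w"

definition pc_G :: "complex \<Rightarrow> complex \<Rightarrow> complex" where
  "pc_G \<kappa> w = exp (- w\<^sup>2 / 4) * parabolic_cylinder_D \<kappa> w"

lemma pc_G_eq_pc_h: "pc_G \<kappa> w = exp (- w\<^sup>2 / 2) * pc_h \<kappa> w"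
proof -
  have "exp (- w\<^sup>2 / 4) = exp (- w\<^sup>2 / 2) * exp (w\<^sup>2 / 4)" unfolding exp_add[symmetric] by simp
  thus ?thesis by (simp add: pc_G_def pc_h_def)
qed

text \<open>\<open>pc_E\<close> and \<open>pc_O\<close> are the even and the odd solution of the
  differential equation of \<open>pc_h\<close>, normalised to value 1 and to slope 1 at the
  origin.\<close>

definition pc_E :: "complex \<Rightarrow> complex \<Rightarrow> complex" where
  "pc_E \<kappa> w = kummer_Phi (- \<kappa> / 2) (1 / 2) (w\<^sup>2 / 2)"

definition pc_O :: "complex \<Rightarrow> complex \<Rightarrow> complex" where
  "pc_O \<kappa> w = w * kummer_Phi (1 / 2 - \<kappa> / 2) (3 / 2) (w\<^sup>2 / 2)"

text \<open>This is the value of \<open>pc_h \<kappa>\<close> at 0. The slope there is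
  \<open>- pc_A (\<kappa> + 1)\<close>, so one function of \<kappa> yields both connection
  coefficients.\<close>

definition pc_A :: "complex \<Rightarrow> complex" where
  "pc_A \<kappa> = 2 powr (\<kappa> / 2) * of_real (sqrt pi) * rGamma (1 / 2 - \<kappa> / 2)"

lemma pc_h_eq: "pc_h \<kappa> w = pc_A \<kappa> * pc_E \<kappa> w - pc_A (\<kappa> + 1) * pc_O \<kappa> w"
proof -
  have "2 powr ((\<kappa> + 1) / 2) = 2 powr (\<kappa> / 2) * of_real (sqrt 2)"
  proof -
    have "complex_of_real (sqrt 2) = 2 powr (1 / 2)"
      using powr_of_real[of 2 "1 / 2"] powr_half_sqrt[of 2] by simp
    thus ?thesis by (simp add: add_divide_distrib powr_add)
  qed
  moreover have "1 / 2 - (\<kappa> + 1) / 2 = - \<kappa> / 2" by (simp add: field_simps)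
  ultimately have A: "pc_A (\<kappa> + 1) = 2 powr (\<kappa> / 2) * of_real (sqrt (2 * pi)) * rGamma (- \<kappa> / 2)"
    unfolding pc_A_def by (simp add: real_sqrt_mult)
  have e: "exp (w\<^sup>2 / 4) * (p * exp (- (w\<^sup>2) / 4) * (x - y * w * g * r)) = p * x - p * y * g * (w * r)" for p x y g r
  proof -
    have "exp (w\<^sup>2 / 4) * exp (- (w\<^sup>2) / 4) = 1" by (simp add: exp_add[symmetric])
    hence "exp (w\<^sup>2 / 4) * (p * exp (- (w\<^sup>2) / 4) * q) = p * q" for q by (metis mult.assoc mult.commute mult_1)
    hence "exp (w\<^sup>2 / 4) * (p * exp (- (w\<^sup>2) / 4) * (x - y * w * g * r)) = p * (x - y * w * g * r)" .
    thus ?thesis by (simp only: right_diff_distrib mult_ac)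
  qed
  show ?thesis
    unfolding pc_h_def parabolic_cylinder_D_def e A unfolding pc_A_def pc_E_def pc_O_def
    by (simp only: mult.assoc)
qed

text \<open>The functional equation of the reciprocal Gamma function, which holds at the poles of
  Gamma as well, so no index has to be excluded.\<close>

lemma pc_A_step: "pc_A (\<kappa> + 2) = - (\<kappa> + 1) * pc_A \<kappa>"
proof -
  have 1: "1 / 2 - (\<kappa> + 2) / 2 = (- 1 / 2 - \<kappa> / 2 :: complex)" by (simp add: field_simps)
  have 2: "2 powr ((\<kappa> + 2) / 2) = 2 powr (\<kappa> / 2) * (2::complex)"
    by (simp add: add_divide_distrib powr_add)
  have "(- 1 / 2 - \<kappa> / 2) * rGamma (- 1 / 2 - \<kappa> / 2 + 1) = rGamma (- 1 / 2 - \<kappa> / 2)"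
    by (rule rGamma_plus1)
  hence 3: "rGamma (- 1 / 2 - \<kappa> / 2) = (- 1 / 2 - \<kappa> / 2) * rGamma (1 / 2 - \<kappa> / 2)"
    by (simp add: algebra_simps)
  show ?thesis unfolding pc_A_def 1 2 3 by (simp add: algebra_simps)
qed

lemma has_field_derivative_pc_E:
  "(pc_E \<kappa> has_field_derivative - \<kappa> * pc_O (\<kappa> - 1) w) (at w)"
proof -
  have 1: "- \<kappa> / 2 + 1 = 1 / 2 - (\<kappa> - 1) / 2" by (simp add: field_simps)
  have "((\<lambda>w. kummer_Phi (- \<kappa> / 2) (1 / 2) (w\<^sup>2 / 2)) has_field_derivative
     (- \<kappa> / 2) / (1 / 2) * kummer_Phi (- \<kappa> / 2 + 1) (1 / 2 + 1) (w\<^sup>2 / 2) * w) (at w)"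
    by (rule DERIV_chain2[OF has_field_derivative_kummer_Phi])
      (auto intro!: derivative_eq_intros simp: field_simps)
  thus ?thesis unfolding pc_E_def[abs_def] pc_O_def 1 by (simp add: algebra_simps)
qed

lemma has_field_derivative_pc_O:
  "(pc_O \<kappa> has_field_derivative pc_E (\<kappa> - 1) w) (at w)"
proof -
  define a x where "a = 1 / 2 - \<kappa> / 2" and "x = w\<^sup>2 / 2"
  have 1: "- (\<kappa> - 1) / 2 = a" by (simp add: field_simps a_def)
  have "((\<lambda>w. w * kummer_Phi a (3 / 2) (w\<^sup>2 / 2)) has_field_derivative
     1 * kummer_Phi a (3 / 2) (w\<^sup>2 / 2) +
     (a / (3 / 2) * kummer_Phi (a + 1) (3 / 2 + 1) (w\<^sup>2 / 2) * w) * w) (at w)"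
    by (intro DERIV_mult DERIV_ident DERIV_chain2[OF has_field_derivative_kummer_Phi])
      (auto intro!: derivative_eq_intros simp: field_simps)
  \<comment> \<open>The product rule leaves two Kummer functions. The contiguous relations at b =
    1/2 and b = 3/2, with \<open>kummer_Phi (a+1) (3/2)\<close> eliminated between them, merge these
    into one; the factor w * w is 2 x.\<close>
  moreover have "kummer_Phi a (1 / 2) x = kummer_Phi a (3 / 2) x + a / (3/2) * kummer_Phi (a+1) (5/2) x * w * w"
  proof -
    have "(1/2 - a) * kummer_Phi a (1/2 + 1) x = 1/2 * kummer_Phi a (1/2) x - a * kummer_Phi (a + 1) (1/2 + 1) x"
      by (rule kummer_Phi_contiguous1) simp
    moreover have "kummer_Phi (a + 1) (3/2) x - kummer_Phi a (3/2) x = x / (3/2) * kummer_Phi (a + 1) (3/2 + 1) x"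
      by (rule kummer_Phi_contiguous2) simp
    moreover have "f = (1 - 2 * a) * k + 2 * a * l" if "(1/2 - a) * k = 1/2 * f - a * l" for f k l :: complex
    proof -
      have "f = 2 * (1/2 * f - a * l) + 2 * a * l" by simp
      thus ?thesis unfolding that[symmetric] by (simp add: algebra_simps)
    qed
    ultimately have "kummer_Phi a (1/2) x = (1 - 2 * a) * kummer_Phi a (3/2) x + 2 * a * kummer_Phi (a + 1) (3/2) x"
        "kummer_Phi (a + 1) (3/2) x = kummer_Phi a (3/2) x + x / (3/2) * kummer_Phi (a + 1) (5/2) x"
      by (simp, simp only: diff_eq_eq add.commute, simp)
    moreover have "2 * x = w * w" by (simp add: x_def power2_eq_square)
    ultimately show ?thesis by (simp add: algebra_simps)
  qed
  ultimately show ?thesis unfolding pc_E_def pc_O_def[abs_def] 1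
    by (simp add: x_def a_def[symmetric])
qed

lemma pc_E_rec: "pc_E (\<kappa> + 1) w = pc_E (\<kappa> - 1) w - w * pc_O \<kappa> w"
proof -
  define a where "a = - (\<kappa> + 1) / 2"
  have 1: "- (\<kappa> - 1) / 2 = a + 1" "1 / 2 - \<kappa> / 2 = a + 1" by (simp_all add: field_simps a_def)
  have "kummer_Phi (a + 1) (1/2) (w\<^sup>2 / 2) - kummer_Phi a (1/2) (w\<^sup>2 / 2) =
     (w\<^sup>2 / 2) / (1/2) * kummer_Phi (a + 1) (1/2 + 1) (w\<^sup>2 / 2)"
    by (rule kummer_Phi_contiguous2) simp
  thus ?thesis unfolding pc_E_def pc_O_def a_def[symmetric] 1
    by (simp add: power2_eq_square algebra_simps)
qed

lemma pc_O_rec: "(\<kappa> + 1) * pc_O (\<kappa> + 1) w = w * pc_E \<kappa> w + \<kappa> * pc_O (\<kappa> - 1) w"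
proof -
  define a x where "a = - \<kappa> / 2" and "x = w\<^sup>2 / 2"
  have 1: "1 / 2 - (\<kappa> + 1) / 2 = a" "1 / 2 - (\<kappa> - 1) / 2 = a + 1"
    by (simp_all add: field_simps a_def)
  have "(1/2 - a) * kummer_Phi a (1/2 + 1) x = 1/2 * kummer_Phi a (1/2) x - a * kummer_Phi (a + 1) (1/2 + 1) x"
    by (rule kummer_Phi_contiguous1) simp
  hence "2 * ((1/2 - a) * kummer_Phi a (3/2) x) = 2 * (1/2 * kummer_Phi a (1/2) x - a * kummer_Phi (a + 1) (3/2) x)"
    by simp
  hence "(1 + \<kappa>) * kummer_Phi a (3/2) x = kummer_Phi a (1/2) x + \<kappa> * kummer_Phi (a + 1) (3/2) x"
    by (simp add: a_def algebra_simps)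
  hence "w * ((1 + \<kappa>) * kummer_Phi a (3/2) x) = w * (kummer_Phi a (1/2) x + \<kappa> * kummer_Phi (a + 1) (3/2) x)"
    by simp
  thus ?thesis unfolding pc_E_def pc_O_def 1 a_def[symmetric] x_def[symmetric]
    by (simp add: algebra_simps)
qed

lemma has_field_derivative_pc_h:
  "(pc_h \<kappa> has_field_derivative \<kappa> * pc_h (\<kappa> - 1) w) (at w)"
proof -
  have "((\<lambda>w. pc_A \<kappa> * pc_E \<kappa> w - pc_A (\<kappa> + 1) * pc_O \<kappa> w) has_field_derivative
     pc_A \<kappa> * (- \<kappa> * pc_O (\<kappa> - 1) w) - pc_A (\<kappa> + 1) * pc_E (\<kappa> - 1) w) (at w)"
    by (intro DERIV_diff DERIV_cmult has_field_derivative_pc_E has_field_derivative_pc_O)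
  moreover have "pc_A (\<kappa> + 1) = - \<kappa> * pc_A (\<kappa> - 1)"
    using pc_A_step[of "\<kappa> - 1"] by (simp add: add.commute)
  hence "pc_A (\<kappa> + 1) * pc_E (\<kappa> - 1) w = - \<kappa> * pc_A (\<kappa> - 1) * pc_E (\<kappa> - 1) w" by simp
  ultimately show ?thesis unfolding pc_h_eq[abs_def]
    by (simp add: algebra_simps)
qed

lemma pc_h_rec: "pc_h (\<kappa> + 1) w = w * pc_h \<kappa> w - \<kappa> * pc_h (\<kappa> - 1) w"
proof -
  have 1: "pc_A (\<kappa> + 1) = - \<kappa> * pc_A (\<kappa> - 1)"
    using pc_A_step[of "\<kappa> - 1"] by (simp add: add.commute)
  have 2: "pc_A (\<kappa> + 1 + 1) = - (\<kappa> + 1) * pc_A \<kappa>"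
    using pc_A_step[of \<kappa>] by (simp add: add.assoc)
  have "pc_h (\<kappa> + 1) w = pc_A (\<kappa> + 1) * pc_E (\<kappa> + 1) w + pc_A \<kappa> * ((\<kappa> + 1) * pc_O (\<kappa> + 1) w)"
    unfolding pc_h_eq 2 by (simp add: algebra_simps)
  also have "\<dots> = w * pc_h \<kappa> w - \<kappa> * pc_h (\<kappa> - 1) w"
    unfolding pc_O_rec pc_E_rec pc_h_eq 1 by (simp add: algebra_simps)
  finally show ?thesis .
qed

lemma pc_G_rec: "pc_G (\<kappa> + 1) w = w * pc_G \<kappa> w - \<kappa> * pc_G (\<kappa> - 1) w"
  unfolding pc_G_eq_pc_h pc_h_rec by (simp add: algebra_simps)

lemma has_field_derivative_pc_G:
  "(pc_G \<kappa> has_field_derivative - pc_G (\<kappa> + 1) w) (at w)"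
proof -
  have "((\<lambda>w. exp (- w\<^sup>2 / 2) * pc_h \<kappa> w) has_field_derivative
     (exp (- w\<^sup>2 / 2) * (- w)) * pc_h \<kappa> w + (\<kappa> * pc_h (\<kappa> - 1) w) * exp (- w\<^sup>2 / 2)) (at w)"
    by (intro DERIV_mult has_field_derivative_pc_h)
      (auto intro!: derivative_eq_intros simp: field_simps)
  thus ?thesis unfolding pc_G_eq_pc_h[abs_def] pc_h_rec by (simp add: algebra_simps)
qed

lemmas has_field_derivative_pc_G' [derivative_intros] = DERIV_chain2[OF has_field_derivative_pc_G]

lemma continuous_on_pc_G [continuous_intros]:
  "continuous_on A f \<Longrightarrow> continuous_on A (\<lambda>x. pc_G \<kappa> (f x))"
  by (rule continuous_on_compose2[of UNIV "pc_G \<kappa>"])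
     (auto intro!: DERIV_continuous_on[OF has_field_derivative_at_within[OF has_field_derivative_pc_G]])

section \<open>Integral representation for negative real part of the index\<close>

lemma set_borel_measurable_lborel_continuous:
  fixes f :: "real \<Rightarrow> 'b::real_normed_vector"
  assumes "A \<in> sets borel" "continuous_on A f"
  shows "set_borel_measurable lborel A f"
  using borel_measurable_continuous_on_indicator[OF assms]
  by (simp add: set_borel_measurable_def)

lemma set_integrable_continuous_bound:
  fixes f :: "real \<Rightarrow> complex"
  assumes "set_integrable lborel A w" "A \<in> sets borel" "continuous_on A f"
    and "\<And>x. x \<in> A \<Longrightarrow> norm (f x) \<le> (w x :: real)"
  shows "set_integrable lborel A f"
  by (rule set_integrable_bound[OF assms(1)])
     (use assms in \<open>auto intro!: set_borel_measurable_lborel_continuous AE_I2 intro: order.trans[OF _ abs_ge_self]\<close>)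

lemma norm_set_integral_le:
  fixes f :: "real \<Rightarrow> complex"
  assumes "set_integrable lborel A w" "A \<in> sets borel" "continuous_on A f"
    and "\<And>x. x \<in> A \<Longrightarrow> norm (f x) \<le> (w x :: real)"
  shows "norm (LINT x:A|lborel. f x) \<le> (LINT x:A|lborel. w x)"
proof -
  have I: "set_integrable lborel A f"
    using assms by (rule set_integrable_continuous_bound)
  show ?thesis unfolding set_lebesgue_integral_def
    by (rule Bochner_Integration.integral_norm_bound_integral)
       (use assms I in \<open>auto simp: set_integrable_def indicator_def\<close>)
qed

lemma set_integral_dominated_convergence:
  fixes f :: "real \<Rightarrow> complex"
  assumes "set_integrable lborel A w" "A \<in> sets borel" "continuous_on A f" "\<And>n::nat. continuous_on A (s n)"
    and "\<And>x n. x \<in> A \<Longrightarrow> norm (s n x) \<le> (w x :: real)"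
    and "\<And>x. x \<in> A \<Longrightarrow> (\<lambda>n. s n x) \<longlonglongrightarrow> f x"
  shows "(\<lambda>n. LINT x:A|lborel. s n x) \<longlonglongrightarrow> (LINT x:A|lborel. f x)"
  unfolding set_lebesgue_integral_def
proof (rule integral_dominated_convergence)
  show "integrable lborel (\<lambda>x. indicator A x *\<^sub>R w x)"
    using assms(1) by (simp add: set_integrable_def)
  show "AE x in lborel. (\<lambda>n. indicator A x *\<^sub>R s n x) \<longlonglongrightarrow> indicator A x *\<^sub>R f x"
    using assms(6) by (auto simp: indicator_def)
  show "AE x in lborel. norm (indicator A x *\<^sub>R s n x) \<le> indicator A x *\<^sub>R w x" for n
    using assms(5) by (auto simp: indicator_def)
qed (use assms in \<open>auto intro!: borel_measurable_continuous_on_indicator\<close>)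

lemma set_integrable_lborel_iff_absolutely_integrable:
  fixes f :: "real \<Rightarrow> complex"
  assumes "A \<in> sets borel" "continuous_on A f"
  shows "set_integrable lborel A f \<longleftrightarrow> f absolutely_integrable_on A"
  unfolding set_integrable_def
  using borel_measurable_continuous_on_indicator[OF assms]
  by (subst integrable_completion) auto

text \<open>The general substitution theorem speaks of \<open>absolutely_integrable_on\<close>, a
  notion for the completed measure. Continuity of \<open>f\<close> and \<open>h\<close> makes both
  integrands Borel measurable on their domains, which transfers integrability and value to
  \<open>lborel\<close>.\<close>

lemma set_integral_change_of_variables:
  fixes f :: "real \<Rightarrow> complex" and g h :: "real \<Rightarrow> real"
  assumes S: "S \<in> sets borel" "g ` S \<in> sets borel"
    and g: "\<And>x. x \<in> S \<Longrightarrow> (g has_field_derivative h x) (at x)" "inj_on g S"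
    and h: "continuous_on S h"
    and f: "continuous_on (g ` S) f" "set_integrable lborel (g ` S) f"
  shows "set_integrable lborel S (\<lambda>x. of_real \<bar>h x\<bar> * f (g x))"
    and "(LINT x:S|lborel. of_real \<bar>h x\<bar> * f (g x)) = (LINT x:g ` S|lborel. f x)"
proof -
  let ?F = "\<lambda>x. \<bar>h x\<bar> *\<^sub>R f (g x)"
  have g': "(g has_field_derivative h x) (at x within S)" if "x \<in> S" for x
    using g(1)[OF that] by (rule has_field_derivative_at_within)
  have cg: "continuous_on S g" using DERIV_continuous_on g' by blast
  have cF: "continuous_on S ?F"
    by (intro continuous_intros h continuous_on_compose2[OF f(1)] cg) auto
  have SL: "S \<in> sets lebesgue" using S by auto
  have fa: "f absolutely_integrable_on g ` S"
    using set_integrable_lborel_iff_absolutely_integrable[OF S(2) f(1)] f(2) by simp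
  have *: "?F absolutely_integrable_on S \<and> integral S ?F = integral (g ` S) f"
    using has_absolute_integral_change_of_variables_real[OF SL g' g(2), of f "integral (g ` S) f"] fa by blast
  hence F: "set_integrable lborel S ?F"
    using set_integrable_lborel_iff_absolutely_integrable[OF S(1) cF] by simp
  thus "set_integrable lborel S (\<lambda>x. of_real \<bar>h x\<bar> * f (g x))" by (simp add: scaleR_conv_of_real)
  have "(LINT x:S|lborel. ?F x) = (LINT x:g ` S|lborel. f x)"
    using * set_borel_integral_eq_integral(2)[OF F] set_borel_integral_eq_integral(2)[OF f(2)] by simp
  thus "(LINT x:S|lborel. of_real \<bar>h x\<bar> * f (g x)) = (LINT x:g ` S|lborel. f x)"
    by (simp add: scaleR_conv_of_real)
qed

section \<open>Gamma integrals, Gaussian majorants and Gaussian moments\<close>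

lemma Gamma_set_integral:
  assumes "Re \<alpha> > 0"
  shows "set_integrable lborel {0<..} (\<lambda>s. of_real s powr (\<alpha> - 1) * exp (- of_real s))"
    and "(LINT s:{0<..}|lborel. of_real s powr (\<alpha> - 1) * exp (- of_real s)) = Gamma \<alpha>"
proof -
  have eq: "(\<lambda>s. of_real s powr (\<alpha> - 1) * exp (- of_real s)) = (\<lambda>t. complex_of_real t powr (\<alpha> - 1) / of_real (exp t))"
    by (simp add: exp_minus field_simps exp_of_real)
  have c: "continuous_on {0<..} (\<lambda>s. of_real s powr (\<alpha> - 1) * exp (- complex_of_real s))"
    by (intro continuous_intros) (auto simp: complex_nonpos_Reals_iff)
  show I: "set_integrable lborel {0<..} (\<lambda>s. of_real s powr (\<alpha> - 1) * exp (- of_real s))"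
    by (subst set_integrable_lborel_iff_absolutely_integrable[OF _ c])
       (use absolutely_integrable_Gamma_integral'[OF assms] in \<open>auto simp: eq\<close>)
  show "(LINT s:{0<..}|lborel. of_real s powr (\<alpha> - 1) * exp (- of_real s)) = Gamma \<alpha>"
    using set_borel_integral_eq_integral[OF I] Gamma_integral_complex'[OF assms]
    by (simp add: eq has_integral_iff)
qed

lemma Gamma_set_integrable_real:
  assumes "\<sigma> > 0"
  shows "set_integrable lborel {0<..} (\<lambda>s::real. s powr (\<sigma> - 1) * exp (- s))"
proof -
  have "set_integrable lborel {0<..} (\<lambda>s::real. norm (of_real s powr (of_real \<sigma> - 1) * exp (- complex_of_real s)))"
    using assms by (intro set_integrable_norm Gamma_set_integral) auto
  thus ?thesis
    by (rule set_integrable_cong[THEN iffD1, rotated -1])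
       (auto simp: norm_mult norm_powr_real_powr)
qed

lemma power_gauss_bound:
  fixes M c :: real
  assumes "c > 0"
  obtains C where "C > 0" "\<And>s. s \<ge> 0 \<Longrightarrow> (1 + s) ^ N * exp (M * s - c * s\<^sup>2) \<le> C * exp (- s)"
proof -
  \<comment> \<open>\<open>K\<close> collects the linear exponents: \<open>real N\<close> from
    \<open>(1 + s) ^ N <= exp (N * s)\<close>, \<open>M\<close> itself, and 1 to pay for
    \<open>exp (- s)\<close>. Completing the square bounds \<open>K * s - c * s^2\<close> by its
    maximum \<open>K^2 / (4 * c)\<close>.\<close>
  define K where "K = M + 1 + real N"
  have "(1 + s) ^ N * exp (M * s - c * s\<^sup>2) \<le> exp (K\<^sup>2 / (4 * c)) * exp (- s)" if "s \<ge> 0" for s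
  proof -
    have "(1 + s) ^ N \<le> exp s ^ N"
      using that exp_ge_add_one_self[of s] by (intro power_mono) auto
    also have "\<dots> = exp (real N * s)" by (simp add: exp_of_nat_mult)
    finally have "(1 + s) ^ N * exp (M * s - c * s\<^sup>2) \<le> exp (real N * s) * exp (M * s - c * s\<^sup>2)"
      by (intro mult_right_mono) auto
    also have "\<dots> = exp (K * s - c * s\<^sup>2) * exp (- s)"
      by (simp add: K_def exp_add[symmetric] algebra_simps)
    also have "K * s - c * s\<^sup>2 \<le> K\<^sup>2 / (4 * c)"
    proof -
      have "0 \<le> (2 * c * s - K)\<^sup>2" by simp
      hence "4 * c * (K * s - c * s\<^sup>2) \<le> K\<^sup>2" by (simp add: power2_eq_square algebra_simps)
      thus ?thesis using assms by (simp add: field_simps)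
    qed
    finally show ?thesis by simp
  qed
  thus ?thesis using that[of "exp (K\<^sup>2 / (4 * c))"] by simp
qed

lemma set_integrable_power_gauss:
  assumes "\<sigma> > 0" "c > 0"
  shows "set_integrable lborel {0<..} (\<lambda>s::real. s powr (\<sigma> - 1) * ((1 + s) ^ N * exp (M * s - c * s\<^sup>2)))"
proof -
  obtain C where C: "C > 0" "\<And>s. s \<ge> 0 \<Longrightarrow> (1 + s) ^ N * exp (M * s - c * s\<^sup>2) \<le> C * exp (- s)"
    using power_gauss_bound[OF assms(2)] by metis
  have "set_integrable lborel {0<..} (\<lambda>s::real. C * (s powr (\<sigma> - 1) * exp (- s)))"
    using Gamma_set_integrable_real[OF assms(1)] by simp
  thus ?thesis
  proof (rule set_integrable_bound)
    show "set_borel_measurable lborel {0<..} (\<lambda>s::real. s powr (\<sigma> - 1) * ((1 + s) ^ N * exp (M * s - c * s\<^sup>2)))"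
      by (intro set_borel_measurable_lborel_continuous continuous_intros) auto
    show "AE s in lborel. s \<in> {0<..} \<longrightarrow> norm (s powr (\<sigma> - 1) * ((1 + s) ^ N * exp (M * s - c * s\<^sup>2))) \<le> 
       norm (C * (s powr (\<sigma> - 1) * exp (- s)))"
    proof (intro AE_I2 impI)
      fix s :: real assume "s \<in> {0<..}"
      hence "s powr (\<sigma> - 1) * ((1 + s) ^ N * exp (M * s - c * s\<^sup>2)) \<le> s powr (\<sigma> - 1) * (C * exp (- s))"
        by (intro mult_left_mono C) auto
      thus "norm (s powr (\<sigma> - 1) * ((1 + s) ^ N * exp (M * s - c * s\<^sup>2))) \<le> 
       norm (C * (s powr (\<sigma> - 1) * exp (- s)))"
        using \<open>s \<in> {0<..}\<close> C(1) by (simp add: abs_mult mult_ac)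
    qed
  qed
qed

lemma of_real_powr_conv_exp: "s > 0 \<Longrightarrow> of_real s powr p = exp (p * complex_of_real (ln s))"
  by (simp add: powr_def Ln_of_real)

text \<open>The substitution y = s^2/2 turns the Gaussian moment into a Gamma integral with
  parameter \<alpha>/2.\<close>

lemma gauss_moment:
  assumes "Re \<alpha> > 0"
  shows "set_integrable lborel {0<..} (\<lambda>s. of_real s powr (\<alpha> - 1) * exp (- (of_real s)\<^sup>2 / 2))"
    and "(LINT s:{0<..}|lborel. of_real s powr (\<alpha> - 1) * exp (- (of_real s)\<^sup>2 / 2)) =
           2 powr (\<alpha> / 2 - 1) * Gamma (\<alpha> / 2)"
proof -
  define g h :: "real \<Rightarrow> real" where "g s = s\<^sup>2 / 2" and "h s = s" for s
  define f where "f s = of_real s powr (\<alpha> / 2 - 1) * exp (- complex_of_real s)" for s :: real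
  have im: "g ` {0<..} = {0<..}"
  proof (intro equalityI subsetI)
    fix y :: real assume "y \<in> {0<..}"
    thus "y \<in> g ` {0<..}" by (intro image_eqI[of _ _ "sqrt (2 * y)"]) (auto simp: g_def)
  qed (auto simp: g_def)
  have inj: "inj_on g {0<..}" by (auto simp: inj_on_def g_def)
  have cf: "continuous_on {0<..} f"
    unfolding f_def by (intro continuous_intros) (auto simp: complex_nonpos_Reals_iff)
  have fi: "set_integrable lborel {0<..} f" "(LINT s:{0<..}|lborel. f s) = Gamma (\<alpha> / 2)"
    unfolding f_def using Gamma_set_integral[of "\<alpha> / 2"] assms by auto
  have der: "(g has_field_derivative h x) (at x)" for x
    unfolding g_def h_def by (auto intro!: derivative_eq_intros)
  have ch: "continuous_on {0<..} h" unfolding h_def by (intro continuous_intros)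
  note cov = set_integral_change_of_variables[of "{0<..}" g h f, unfolded im, OF _ _ der inj ch cf fi(1), simplified]
  have eq: "of_real s powr (\<alpha> - 1) * exp (- (of_real s)\<^sup>2 / 2) =
       2 powr (\<alpha> / 2 - 1) * (of_real \<bar>h s\<bar> * f (g s))" if "s \<in> {0<..}" for s
  proof -
    have s: "s > 0" using that by simp
    have g: "ln (g s) = 2 * ln s - ln 2" "g s > 0" using s by (simp_all add: g_def ln_div ln_realpow)
    have "2 powr (\<alpha> / 2 - 1) * (of_real s * complex_of_real (g s) powr (\<alpha> / 2 - 1)) =
      exp ((\<alpha> / 2 - 1) * of_real (ln 2) + (of_real (ln s) + (\<alpha> / 2 - 1) * of_real (ln (g s))))"
      using of_real_powr_conv_exp[of 2 "\<alpha> / 2 - 1"] of_real_powr_conv_exp[OF g(2), of "\<alpha> / 2 - 1"] s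
      by (simp add: exp_add exp_of_real)
    also have "\<dots> = exp ((\<alpha> - 1) * of_real (ln s))"
      unfolding g by (simp add: algebra_simps)
    also have "\<dots> = of_real s powr (\<alpha> - 1)"
      using of_real_powr_conv_exp[OF s, of "\<alpha> - 1"] by simp
    finally have *: "of_real s powr (\<alpha> - 1) = 2 powr (\<alpha> / 2 - 1) * (of_real s * complex_of_real (g s) powr (\<alpha> / 2 - 1))" ..
    show ?thesis unfolding * using s by (simp add: h_def f_def g_def mult.assoc)
  qed
  have "set_integrable lborel {0<..} (\<lambda>s. 2 powr (\<alpha> / 2 - 1) * (of_real \<bar>h s\<bar> * f (g s)))"
    using cov(1) by (intro set_integrable_mult_right) auto
  thus "set_integrable lborel {0<..} (\<lambda>s. of_real s powr (\<alpha> - 1) * exp (- (of_real s)\<^sup>2 / 2))"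
    by (rule set_integrable_cong[THEN iffD1, rotated -1]) (use eq in simp_all)
  have "(LINT s:{0<..}|lborel. of_real s powr (\<alpha> - 1) * exp (- (of_real s)\<^sup>2 / 2)) =
     (LINT s:{0<..}|lborel. 2 powr (\<alpha> / 2 - 1) * (of_real \<bar>h s\<bar> * f (g s)))"
    by (rule set_lebesgue_integral_cong) (use eq in simp_all)
  also have "\<dots> = 2 powr (\<alpha> / 2 - 1) * (LINT s:{0<..}|lborel. of_real \<bar>h s\<bar> * f (g s))"
    by simp
  also have "(LINT s:{0<..}|lborel. of_real \<bar>h s\<bar> * f (g s)) = Gamma (\<alpha> / 2)"
    using cov(2) fi(2) by auto
  finally show "(LINT s:{0<..}|lborel. of_real s powr (\<alpha> - 1) * exp (- (of_real s)\<^sup>2 / 2)) =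
           2 powr (\<alpha> / 2 - 1) * Gamma (\<alpha> / 2)" .
qed

lemma Gamma_neq_0_pos: "Re \<alpha> > 0 \<Longrightarrow> Gamma \<alpha> \<noteq> (0::complex)"
  by (auto simp: Gamma_eq_zero_iff elim!: nonpos_Ints_cases dest: arg_cong[of _ _ Re])

lemma Gamma_duplication_pos:
  assumes "Re \<alpha> > 0"
  shows "Gamma (\<alpha> / 2) * Gamma (\<alpha> / 2 + 1 / 2) = 2 powr (1 - \<alpha>) * of_real (sqrt pi) * Gamma \<alpha>"
proof -
  have "\<alpha> / 2 \<notin> \<int>\<^sub>\<le>\<^sub>0" "\<alpha> / 2 + 1 / 2 \<notin> \<int>\<^sub>\<le>\<^sub>0"
    using assms by (auto elim!: nonpos_Ints_cases simp: complex_eq_iff)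
  from Gamma_legendre_duplication[OF this] show ?thesis
    using of_real_powr_conv_exp[of 2 "1 - \<alpha>"] by simp
qed

text \<open>Legendre duplication trades Gamma(\<alpha>) times the reciprocal Gamma value at one of
  \<alpha>/2, \<alpha>/2 + 1/2 for the Gamma value at the other. The right-hand sides are the
  moments of \<open>gauss_moment\<close> for \<alpha> and \<alpha> + 1.\<close>

lemma pc_A_uminus:
  assumes "Re \<alpha> > 0"
  shows "Gamma \<alpha> * pc_A (- \<alpha>) = 2 powr (\<alpha> / 2 - 1) * Gamma (\<alpha> / 2)"
    and "Gamma \<alpha> * pc_A (1 - \<alpha>) = 2 powr ((\<alpha> + 1) / 2 - 1) * Gamma ((\<alpha> + 1) / 2)"
proof -
  have nz: "Gamma (\<alpha> / 2) \<noteq> 0" "Gamma (\<alpha> / 2 + 1 / 2) \<noteq> 0"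
    using Gamma_neq_0_pos[of "\<alpha> / 2"] Gamma_neq_0_pos[of "\<alpha> / 2 + 1 / 2"] assms by simp_all
  have p: "2 powr (\<alpha> / 2 - 1) * (2 powr (1 - \<alpha>)) = (2::complex) powr (- \<alpha> / 2)"
     "2 powr ((\<alpha> + 1) / 2 - 1) * (2 powr (1 - \<alpha>)) = (2::complex) powr ((1 - \<alpha>) / 2)"
    by (simp_all add: powr_add[symmetric] field_simps)
  note d = Gamma_duplication_pos[OF assms]
  have "2 powr (\<alpha> / 2 - 1) * (Gamma (\<alpha> / 2) * Gamma (\<alpha> / 2 + 1 / 2)) = 
     (2 powr (\<alpha> / 2 - 1) * 2 powr (1 - \<alpha>)) * of_real (sqrt pi) * Gamma \<alpha>" unfolding d by simp
  thus "Gamma \<alpha> * pc_A (- \<alpha>) = 2 powr (\<alpha> / 2 - 1) * Gamma (\<alpha> / 2)"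
    unfolding p pc_A_def rGamma_inverse_Gamma using nz by (simp add: field_simps)
  have "2 powr ((\<alpha> + 1) / 2 - 1) * (Gamma (\<alpha> / 2) * Gamma (\<alpha> / 2 + 1 / 2)) = 
     (2 powr ((\<alpha> + 1) / 2 - 1) * 2 powr (1 - \<alpha>)) * of_real (sqrt pi) * Gamma \<alpha>" unfolding d by simp
  moreover have "(\<alpha> + 1) / 2 = \<alpha> / 2 + 1 / 2" "1 / 2 - (1 - \<alpha>) / 2 = \<alpha> / 2" by (simp_all add: field_simps)
  ultimately show "Gamma \<alpha> * pc_A (1 - \<alpha>) = 2 powr ((\<alpha> + 1) / 2 - 1) * Gamma ((\<alpha> + 1) / 2)"
    unfolding p pc_A_def rGamma_inverse_Gamma using nz by (simp add: field_simps)
qed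

text \<open>\<open>u n\<close> is \<open>(- w) ^ n / fact n\<close> times the Gaussian moment for
  \<alpha> + n, that is the n-th term after expanding \<open>exp (- w * s)\<close> in the integral
  of \<open>pc_h_integral\<close>. Even n reproduce the series of \<open>pc_E\<close> and odd n that
  of \<open>pc_O\<close>, hence the pairing.\<close>

lemma pc_h_integral_sums:
  fixes \<alpha> w :: complex
  assumes "Re \<alpha> > 0"
  defines "u \<equiv> \<lambda>n. (- w) ^ n / fact n * (2 powr ((\<alpha> + of_nat n) / 2 - 1) * Gamma ((\<alpha> + of_nat n) / 2))"
  shows "(\<lambda>n. u (2 * n) + u (2 * n + 1)) sums (Gamma \<alpha> * pc_h (- \<alpha>) w)"
proof -
  have np: "\<alpha> / 2 \<notin> \<int>\<^sub>\<le>\<^sub>0" "(\<alpha> + 1) / 2 \<notin> \<int>\<^sub>\<le>\<^sub>0"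
    using assms by (auto elim!: nonpos_Ints_cases simp: complex_eq_iff)
  have nz: "Gamma (\<alpha> / 2) \<noteq> 0" "Gamma ((\<alpha> + 1) / 2) \<noteq> 0"
    using np by (auto simp: Gamma_eq_zero_iff)
  let ?e = "\<lambda>n. pochhammer (\<alpha> / 2) n / pochhammer (1 / 2) n / fact n * (w\<^sup>2 / 2) ^ n"
  let ?o = "\<lambda>n. pochhammer ((\<alpha> + 1) / 2) n / pochhammer (3 / 2) n / fact n * (w\<^sup>2 / 2) ^ n"
  have ph: "pochhammer (1 / 2 :: complex) n \<noteq> 0" "pochhammer (3 / 2 :: complex) n \<noteq> 0" for n
  proof -
    have "pochhammer (1 / 2 :: complex) n \<noteq> 0" for n
      using fact_double[of n, where 'a = complex] by (metis fact_nonzero mult_eq_0_iff)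
    from this[of n] this[of "Suc n"] show "pochhammer (1 / 2 :: complex) n \<noteq> 0" "pochhammer (3 / 2 :: complex) n \<noteq> 0"
      by (simp_all add: pochhammer_rec)
  qed
  have ev: "u (2 * n) = Gamma \<alpha> * pc_A (- \<alpha>) * ?e n" for n
  proof -
    have "(\<alpha> + of_nat (2 * n)) / 2 = \<alpha> / 2 + of_nat n" by (simp add: field_simps)
    moreover have "Gamma (\<alpha> / 2 + of_nat n) = pochhammer (\<alpha> / 2) n * Gamma (\<alpha> / 2)"
      using pochhammer_Gamma[OF np(1), of n] nz by simp
    moreover have "2 powr (\<alpha> / 2 + of_nat n - 1) = 2 powr (\<alpha> / 2 - 1) * (2::complex) ^ n"
    proof -
      have "\<alpha> / 2 + of_nat n - 1 = (\<alpha> / 2 - 1) + of_nat n" by simp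
      thus ?thesis by (simp only: powr_add powr_nat') (simp add: powr_nat')
    qed
    ultimately show ?thesis unfolding u_def pc_A_uminus[OF assms(1)] fact_double
      using ph[of n] by (simp add: field_simps power_mult power2_eq_square power_mult_distrib flip: power_add)
  qed
  have od: "u (2 * n + 1) = - (Gamma \<alpha> * pc_A (1 - \<alpha>) * w) * ?o n" for n
  proof -
    have "(\<alpha> + of_nat (2 * n + 1)) / 2 = (\<alpha> + 1) / 2 + of_nat n" by (simp add: field_simps)
    moreover have "Gamma ((\<alpha> + 1) / 2 + of_nat n) = pochhammer ((\<alpha> + 1) / 2) n * Gamma ((\<alpha> + 1) / 2)"
      using pochhammer_Gamma[OF np(2), of n] nz by simp
    moreover have "2 powr ((\<alpha> + 1) / 2 + of_nat n - 1) = 2 powr ((\<alpha> + 1) / 2 - 1) * (2::complex) ^ n"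
    proof -
      have "(\<alpha> + 1) / 2 + of_nat n - 1 = ((\<alpha> + 1) / 2 - 1) + of_nat n" by simp
      thus ?thesis by (simp only: powr_add powr_nat') (simp add: powr_nat')
    qed
    moreover have "fact (2 * n + 1) = (2 ^ (2 * n) * pochhammer (3 / 2) n * fact n :: complex)"
    proof -
      have "(1 / 2) * pochhammer (3 / 2 :: complex) n = pochhammer (1 / 2) n * (1 / 2 + of_nat n)"
        using pochhammer_rec[of "1 / 2 :: complex" n] pochhammer_Suc[of "1 / 2 :: complex" n] by simp
      hence "pochhammer (3 / 2 :: complex) n = pochhammer (1 / 2) n * (2 * of_nat n + 1)"
        by (simp add: field_simps)
      moreover have "fact (2 * n + 1) = (2 * of_nat n + 1) * (fact (2 * n) :: complex)" by (simp add: algebra_simps)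
      ultimately show ?thesis unfolding fact_double by simp
    qed
    ultimately show ?thesis unfolding u_def pc_A_uminus[OF assms(1)]
      using ph[of n] by (simp add: field_simps power_mult power2_eq_square power_mult_distrib flip: power_add)
  qed
  have "(\<lambda>n. u (2 * n) + u (2 * n + 1)) sums (Gamma \<alpha> * pc_A (- \<alpha>) * kummer_Phi (\<alpha> / 2) (1 / 2) (w\<^sup>2 / 2) +
     - (Gamma \<alpha> * pc_A (1 - \<alpha>) * w) * kummer_Phi ((\<alpha> + 1) / 2) (3 / 2) (w\<^sup>2 / 2))"
    unfolding ev od by (intro sums_add sums_mult kummer_Phi_sums) auto
  also have "\<dots> = Gamma \<alpha> * pc_h (- \<alpha>) w"
    unfolding pc_h_eq pc_E_def pc_O_def by (simp add: algebra_simps add_divide_distrib)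
  finally show ?thesis .
qed

lemma pc_h_integral:
  assumes "Re \<alpha> > 0"
  shows "set_integrable lborel {0<..} (\<lambda>s. of_real s powr (\<alpha> - 1) * exp (- w * of_real s - (of_real s)\<^sup>2 / 2))"
    and "(LINT s:{0<..}|lborel. of_real s powr (\<alpha> - 1) * exp (- w * of_real s - (of_real s)\<^sup>2 / 2)) =
           Gamma \<alpha> * pc_h (- \<alpha>) w"
proof -
  let ?f = "\<lambda>s. complex_of_real s powr (\<alpha> - 1) * exp (- w * of_real s - (of_real s)\<^sup>2 / 2)"
  let ?b = "\<lambda>s. complex_of_real s powr (\<alpha> - 1) * exp (- (of_real s)\<^sup>2 / 2)"
  define u where "u n = (- w) ^ n / fact n * (2 powr ((\<alpha> + of_nat n) / 2 - 1) * Gamma ((\<alpha> + of_nat n) / 2))" for n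
  let ?s = "\<lambda>N s. \<Sum>n<N. (- w) ^ n / fact n * (complex_of_real s powr (\<alpha> + of_nat n - 1) * exp (- (of_real s)\<^sup>2 / 2))"
  have seq: "?s N s = ?b s * (\<Sum>n<N. (- w * of_real s) ^ n / fact n)" if "s > 0" for N s
  proof -
    have "complex_of_real s powr (\<alpha> + of_nat n - 1) = complex_of_real s powr (\<alpha> - 1) * of_real s ^ n" for n
    proof -
      have "\<alpha> + of_nat n - 1 = (\<alpha> - 1) + of_nat n" by simp
      thus ?thesis using that by (simp only: powr_add) (simp add: powr_nat')
    qed
    hence "(- w) ^ n / fact n * (complex_of_real s powr (\<alpha> + of_nat n - 1) * exp (- (of_real s)\<^sup>2 / 2)) =
        ?b s * ((- w * of_real s) ^ n / fact n)" for n
      unfolding power_mult_distrib by simp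
    thus ?thesis by (simp only: sum_distrib_left)
  qed
  \<comment> \<open>Every partial sum of the series of \<open>exp (- w * s)\<close> is at most
    \<open>exp (norm w * s)\<close> in norm, so this single majorant serves all the partial sums and
    the limit.\<close>
  let ?w = "\<lambda>s::real. s powr (Re \<alpha> - 1) * ((1 + s) ^ 0 * exp (norm w * s - (1/2) * s\<^sup>2))"
  have w: "set_integrable lborel {0<..} ?w"
    by (rule set_integrable_power_gauss) (use assms in auto)
  have nb: "norm (?b s) = s powr (Re \<alpha> - 1) * exp (- s\<^sup>2 / 2)" if "s > 0" for s
    using that by (simp add: norm_mult norm_powr_real_powr flip: of_real_power)
  have cf: "continuous_on {0<..} ?f"
    by (intro continuous_intros) (auto simp: complex_nonpos_Reals_iff)
  have bound: "norm (?s N s) \<le> ?w s" if "s \<in> {0<..}" for s N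
  proof -
    have s: "s > 0" using that by simp
    have "norm (\<Sum>n<N. (- w * of_real s) ^ n / fact n) \<le> (\<Sum>n<N. norm ((- w * of_real s) ^ n / fact n))"
      by (rule norm_sum)
    also have "\<dots> = (\<Sum>n<N. (norm w * s) ^ n / fact n)"
      using s by (simp add: norm_divide norm_power norm_mult)
    also have "\<dots> \<le> exp (norm w * s)"
    proof -
      have S: "(\<lambda>n. (norm w * s) ^ n / fact n) sums exp (norm w * s)"
        using exp_converges[of "norm w * s"] by (simp add: divide_inverse mult.commute)
      show ?thesis
        using sum_le_suminf[OF sums_summable[OF S], of "{..<N}"] sums_unique[OF S] s by simp
    qed
    finally have "norm (?s N s) \<le> (s powr (Re \<alpha> - 1) * exp (- s\<^sup>2 / 2)) * exp (norm w * s)"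
      unfolding seq[OF s] norm_mult[of "?b s"] nb[OF s] by (intro mult_left_mono) auto
    thus ?thesis by (simp add: mult.assoc exp_add[symmetric])
  qed
  have "(\<lambda>N. LINT s:{0<..}|lborel. ?s N s) \<longlonglongrightarrow> (LINT s:{0<..}|lborel. ?f s)"
  proof (rule set_integral_dominated_convergence[OF w _ cf _ bound])
    show "continuous_on {0<..} (?s n)" for n
      by (intro continuous_intros) (auto simp: complex_nonpos_Reals_iff)
    fix s :: real assume s: "s \<in> {0<..}"
    have "(\<lambda>N. \<Sum>n<N. (- w * of_real s) ^ n / fact n) \<longlonglongrightarrow> exp (- w * of_real s)"
      using exp_converges[of "- w * of_real s"] unfolding sums_def by (simp add: scaleR_conv_of_real field_simps)
    hence "(\<lambda>N. ?b s * (\<Sum>n<N. (- w * of_real s) ^ n / fact n)) \<longlonglongrightarrow> ?b s * exp (- w * of_real s)"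
      by (rule tendsto_mult_left)
    moreover have "?f s = ?b s * exp (- w * of_real s)"
    proof -
      have "- w * of_real s - (of_real s)\<^sup>2 / 2 = - (of_real s)\<^sup>2 / 2 + - w * of_real s" by simp
      thus ?thesis by (simp only: exp_add mult.assoc)
    qed
    moreover have "(\<lambda>N. ?s N s) = (\<lambda>N. ?b s * (\<Sum>n<N. (- w * of_real s) ^ n / fact n))"
      using s by (intro ext seq) auto
    ultimately show "(\<lambda>N. ?s N s) \<longlonglongrightarrow> ?f s" by (simp only:)
  qed auto
  moreover have "set_integrable lborel {0<..} (?s N) \<and> (LINT s:{0<..}|lborel. ?s N s) = (\<Sum>n<N. u n)" for N
  proof (induction N)
    case 0
    show ?case by (simp add: set_integrable_def)
  next
    case (Suc N)
    have "Re (\<alpha> + of_nat N) > 0" using assms by simp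
    note m = gauss_moment[OF this]
    let ?t = "\<lambda>s. (- w) ^ N / fact N * (complex_of_real s powr (\<alpha> + of_nat N - 1) * exp (- (of_real s)\<^sup>2 / 2))"
    have t: "set_integrable lborel {0<..} ?t"
      by (intro set_integrable_mult_right m(1))
    have "(LINT s:{0<..}|lborel. ?t s) = u N" unfolding u_def m(2)[symmetric] by (rule set_integral_mult_right)
    thus ?case using set_integral_add[OF conjunct1[OF Suc.IH] t] Suc.IH by (simp only: sum.lessThan_Suc)
  qed
  ultimately have "u sums (LINT s:{0<..}|lborel. ?f s)" by (simp add: sums_def)
  \<comment> \<open>Since the whole series converges, consecutive terms may be grouped in pairs to
    match \<open>pc_h_integral_sums\<close>.\<close>
  hence "(\<lambda>n. sum u {n * 2..<n * 2 + 2}) sums (LINT s:{0<..}|lborel. ?f s)"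
    by (rule sums_group) simp
  moreover have "sum u {n * 2..<n * 2 + 2} = u (2 * n) + u (2 * n + 1)" for n
  proof -
    have "{n * 2..<n * 2 + 2} = {2 * n, 2 * n + 1}" by auto
    thus ?thesis by simp
  qed
  ultimately have "(\<lambda>n. u (2 * n) + u (2 * n + 1)) sums (LINT s:{0<..}|lborel. ?f s)"
    by (simp only:)
  with pc_h_integral_sums[OF assms, of w] show "(LINT s:{0<..}|lborel. ?f s) = Gamma \<alpha> * pc_h (- \<alpha>) w"
    unfolding u_def by (rule sums_unique2[symmetric])
  show "set_integrable lborel {0<..} ?f"
  proof (rule set_integrable_continuous_bound[OF w _ cf])
    fix s :: real assume "s \<in> {0<..}"
    hence s: "s > 0" by simp
    have "norm (?f s) = s powr (Re \<alpha> - 1) * exp (- Re w * s - s\<^sup>2 / 2)"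
      using s by (simp add: norm_mult norm_powr_real_powr flip: of_real_power)
    also have "\<dots> \<le> ?w s"
      using s abs_Re_le_cmod[of w] mult_right_mono[of "- Re w" "norm w" s] by (auto intro!: mult_left_mono)
    finally show "norm (?f s) \<le> ?w s" .
  qed auto
qed

section \<open>Weyl fractional integrals\<close>

text \<open>If Re \<kappa> < 0, the integral representation is bounded on Re w >= 0 because
  \<open>exp (- w * s)\<close> has norm at most 1 there. Each use of \<open>pc_h_rec\<close> then
  raises the reachable index by one, at the price of one factor norm w.\<close>

lemma pc_h_bound:
  obtains C N where "C > 0" "\<And>w. Re w \<ge> 0 \<Longrightarrow> norm (pc_h \<kappa> w) \<le> C * (1 + norm w) ^ N"
proof -
  have "\<exists>C>0. \<exists>N. \<forall>w. Re w \<ge> 0 \<longrightarrow> norm (pc_h \<kappa> w) \<le> C * (1 + norm w) ^ N" if "Re \<kappa> < real n" for n \<kappa>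
    using that
  proof (induction n arbitrary: \<kappa>)
    case 0
    define \<alpha> where "\<alpha> = - \<kappa>"
    have \<alpha>: "Re \<alpha> > 0" and \<kappa>: "\<kappa> = - \<alpha>" using 0 by (auto simp: \<alpha>_def)
    have G: "Gamma \<alpha> \<noteq> 0" using Gamma_neq_0_pos[OF \<alpha>] .
    let ?w = "\<lambda>s::real. s powr (Re \<alpha> - 1) * ((1 + s) ^ 0 * exp (0 * s - (1/2) * s\<^sup>2))"
    define I where "I = (LINT s:{0<..}|lborel. ?w s)"
    have w: "set_integrable lborel {0<..} ?w"
      by (rule set_integrable_power_gauss) (use \<alpha> in auto)
    \<comment> \<open>With \<open>I + 1\<close> in place of \<open>I\<close>, strict positivity of
      the constant follows from I >= 0 alone.\<close>
    have "norm (pc_h \<kappa> w) \<le> ((I + 1) / norm (Gamma \<alpha>)) * (1 + norm w) ^ 0" if "Re w \<ge> 0" for w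
    proof -
      have "norm (Gamma \<alpha> * pc_h \<kappa> w) \<le> I"
        unfolding \<kappa> pc_h_integral(2)[OF \<alpha>, symmetric] I_def
      proof (rule norm_set_integral_le[OF w])
        fix s :: real assume "s \<in> {0<..}"
        hence s: "s > 0" by simp
        have "norm (of_real s powr (\<alpha> - 1) * exp (- w * of_real s - (of_real s)\<^sup>2 / 2)) =
           s powr (Re \<alpha> - 1) * exp (- Re w * s - s\<^sup>2 / 2)"
          using s by (simp add: norm_mult norm_powr_real_powr flip: of_real_power)
        also have "\<dots> \<le> ?w s"
          using s that by (auto intro!: mult_left_mono)
        finally show "norm (of_real s powr (\<alpha> - 1) * exp (- w * of_real s - (of_real s)\<^sup>2 / 2)) \<le> ?w s" .
      qed (auto intro!: continuous_intros simp: complex_nonpos_Reals_iff)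
      thus ?thesis using G by (simp add: norm_mult field_simps)
    qed
    moreover have "I \<ge> 0" unfolding I_def set_lebesgue_integral_def
      by (intro integral_nonneg_AE) (auto simp: indicator_def)
    hence "(I + 1) / norm (Gamma \<alpha>) > 0" using G by (intro divide_pos_pos) auto
    ultimately show ?case by blast
  next
    case (Suc n)
    have "Re (\<kappa> - 1) < real n" "Re (\<kappa> - 2) < real n" using Suc.prems by auto
    then obtain C1 N1 C2 N2 where C: "C1 > 0" "C2 > 0"
      "\<And>w. Re w \<ge> 0 \<Longrightarrow> norm (pc_h (\<kappa> - 1) w) \<le> C1 * (1 + norm w) ^ N1"
      "\<And>w. Re w \<ge> 0 \<Longrightarrow> norm (pc_h (\<kappa> - 2) w) \<le> C2 * (1 + norm w) ^ N2"
      using Suc.IH by metis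
    have "norm (pc_h \<kappa> w) \<le> (C1 + norm (\<kappa> - 1) * C2) * (1 + norm w) ^ (N1 + N2 + 1)" if "Re w \<ge> 0" for w
    proof -
      have "pc_h \<kappa> w = w * pc_h (\<kappa> - 1) w - (\<kappa> - 1) * pc_h (\<kappa> - 2) w"
        using pc_h_rec[of "\<kappa> - 1" w] by (simp add: diff_diff_eq)
      also have "norm \<dots> \<le> norm w * norm (pc_h (\<kappa> - 1) w) + norm (\<kappa> - 1) * norm (pc_h (\<kappa> - 2) w)"
        by (rule norm_triangle_le_diff) (simp add: norm_mult)
      also have "\<dots> \<le> (1 + norm w) * (C1 * (1 + norm w) ^ N1) + norm (\<kappa> - 1) * (C2 * (1 + norm w) ^ N2)"
        by (intro add_mono mult_mono C that) (use C(1) in auto)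
      also have "\<dots> = C1 * (1 + norm w) ^ (N1 + 1) + norm (\<kappa> - 1) * C2 * (1 + norm w) ^ N2"
        by simp
      also have "\<dots> \<le> C1 * (1 + norm w) ^ (N1 + N2 + 1) + norm (\<kappa> - 1) * C2 * (1 + norm w) ^ (N1 + N2 + 1)"
        using C by (intro add_mono mult_left_mono power_increasing) auto
      finally show ?thesis by (simp add: algebra_simps)
    qed
    moreover have "C1 + norm (\<kappa> - 1) * C2 > 0" using C by (intro add_pos_nonneg) auto
    ultimately show ?case by blast
  qed
  from this[of \<kappa> "nat \<lceil>Re \<kappa>\<rceil> + 1"] that show ?thesis by (metis real_nat_ceiling_ge of_nat_1 of_nat_add less_add_one order.strict_trans1)
qed

lemma pc_G_bound:
  obtains C N where "C > 0"
    "\<And>w. Re w \<ge> 0 \<Longrightarrow> norm (pc_G \<kappa> w) \<le> C * (1 + norm w) ^ N * exp (- Re (w\<^sup>2) / 2)"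
proof -
  obtain C N where C: "C > 0" "\<And>w. Re w \<ge> 0 \<Longrightarrow> norm (pc_h \<kappa> w) \<le> C * (1 + norm w) ^ N"
    using pc_h_bound by metis
  have "norm (pc_G \<kappa> w) \<le> C * (1 + norm w) ^ N * exp (- Re (w\<^sup>2) / 2)" if "Re w \<ge> 0" for w
    using C(2)[OF that] by (simp add: pc_G_eq_pc_h norm_mult mult.commute)
  thus ?thesis using that C(1) by blast
qed

section \<open>Composition of fractional integrals and the Beta function\<close>

definition beta_integral :: "complex \<Rightarrow> complex \<Rightarrow> complex" where
  "beta_integral \<alpha> \<beta> = (LINT x:{0<..<1}|lborel. of_real x powr (\<alpha> - 1) * of_real (1 - x) powr (\<beta> - 1))"

text \<open>The factor \<open>exp (- y)\<close> gained from the shift by \<open>y\<close> is what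
  makes the outer integral over \<open>y\<close> converge in the Fubini argument of
  \<open>powr_convolution\<close>.\<close>

lemma set_integrable_powr_exp_bound:
  assumes "Re \<beta> > 0" "continuous_on UNIV \<phi>" "\<And>q::real. q \<ge> 0 \<Longrightarrow> norm (\<phi> q :: complex) \<le> M * exp (- q)" "y \<ge> 0"
  shows "set_integrable lborel {0<..} (\<lambda>r. of_real r powr (\<beta> - 1) * \<phi> (y + r))"
    and "(LINT r:{0<..}|lborel. norm (of_real r powr (\<beta> - 1) * \<phi> (y + r))) \<le>
           exp (- y) * (M * (LINT r:{0<..}|lborel. r powr (Re \<beta> - 1) * exp (- r)))"
proof -
  have w: "set_integrable lborel {0<..} (\<lambda>r. (M * exp (- y)) * (r powr (Re \<beta> - 1) * exp (- r)))"
    using assms(1) by (intro set_integrable_mult_right Gamma_set_integrable_real)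
  have c: "continuous_on {0<..} (\<lambda>r. of_real r powr (\<beta> - 1) * \<phi> (y + r))"
    by (intro continuous_intros continuous_on_compose2[OF assms(2)]) (auto simp: complex_nonpos_Reals_iff)
  have b: "norm (of_real r powr (\<beta> - 1) * \<phi> (y + r)) \<le> (M * exp (- y)) * (r powr (Re \<beta> - 1) * exp (- r))" 
    if "r \<in> {0<..}" for r
  proof -
    have "r powr (Re \<beta> - 1) * norm (\<phi> (y + r)) \<le> r powr (Re \<beta> - 1) * (M * exp (- (y + r)))"
      using that assms(4) by (intro mult_left_mono assms(3)) auto
    thus ?thesis using that by (simp add: norm_mult norm_powr_real_powr exp_diff exp_minus field_simps)
  qed
  show "set_integrable lborel {0<..} (\<lambda>r. of_real r powr (\<beta> - 1) * \<phi> (y + r))"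
    by (rule set_integrable_continuous_bound[OF w _ c b]) auto
  hence "set_integrable lborel {0<..} (\<lambda>r. norm (of_real r powr (\<beta> - 1) * \<phi> (y + r)))"
    by (rule set_integrable_norm)
  hence "(LINT r:{0<..}|lborel. norm (of_real r powr (\<beta> - 1) * \<phi> (y + r))) \<le> 
      (LINT r:{0<..}|lborel. (M * exp (- y)) * (r powr (Re \<beta> - 1) * exp (- r)))"
    by (rule set_integral_mono[OF _ w b])
  thus "(LINT r:{0<..}|lborel. norm (of_real r powr (\<beta> - 1) * \<phi> (y + r))) \<le>
           exp (- y) * (M * (LINT r:{0<..}|lborel. r powr (Re \<beta> - 1) * exp (- r)))"
    unfolding set_integral_mult_right by (simp only: mult.assoc mult.left_commute)
qed

text \<open>This is the semigroup law of Weyl fractional integrals, evaluated at the origin: set q =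
  y + r, exchange the integrals, and the inner one is the convolution of two powers on 0 < y < q, a
  Beta integral times a power of q.\<close>

lemma powr_convolution:
  fixes \<phi> :: "real \<Rightarrow> complex"
  assumes \<alpha>: "Re \<alpha> > 0" and \<beta>: "Re \<beta> > 0" and \<phi>: "continuous_on UNIV \<phi>"
    and M: "\<And>q. q \<ge> 0 \<Longrightarrow> norm (\<phi> q) \<le> M * exp (- q)"
  shows "(LINT y:{0<..}|lborel. of_real y powr (\<alpha> - 1) * (LINT r:{0<..}|lborel. of_real r powr (\<beta> - 1) * \<phi> (y + r)))
     = beta_integral \<alpha> \<beta> * (LINT q:{0<..}|lborel. of_real q powr (\<alpha> + \<beta> - 1) * \<phi> q)"
proof -
  \<comment> \<open>The truncated power is written with \<open>exp\<close>, \<open>ln\<close> and an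
    indicator so that it is visibly Borel measurable on the whole line. The factor
    \<open>P \<beta> (q - y)\<close> then encodes the constraint y < q.\<close>
  define P :: "complex \<Rightarrow> real \<Rightarrow> complex" where "P c x = indicator {0<..} x *\<^sub>R exp ((c - 1) * of_real (ln x))" for c x
  have P: "P c x = (if x > 0 then of_real x powr (c - 1) else 0)" for c x
    by (auto simp: P_def of_real_powr_conv_exp)
  have Pm [measurable]: "P c \<in> borel_measurable borel" for c unfolding P_def by measurable
  have \<phi>m [measurable]: "\<phi> \<in> borel_measurable borel"
    using \<phi> by (rule borel_measurable_continuous_onI)
  define F where "F y q = P \<alpha> y * (P \<beta> (q - y) * \<phi> q)" for y q
  have Fm [measurable]: "case_prod F \<in> borel_measurable (lborel \<Otimes>\<^sub>M lborel)"
    unfolding F_def by measurable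
  have shift: "(LINT q|lborel. f (P \<beta> (q - y) * \<phi> q)) = (LINT r:{0<..}|lborel. f (of_real r powr (\<beta> - 1) * \<phi> (y + r)))"
    if "f 0 = 0" for y and f :: "complex \<Rightarrow> 'b :: euclidean_space"
  proof -
    have "(LINT q|lborel. f (P \<beta> (q - y) * \<phi> q)) = (LINT r|lborel. f (P \<beta> r * \<phi> (y + r)))"
      by (subst lborel_integral_real_affine[of 1 _ y]) auto
    also have "\<dots> = (LINT r:{0<..}|lborel. f (of_real r powr (\<beta> - 1) * \<phi> (y + r)))"
      unfolding set_lebesgue_integral_def using that
      by (intro Bochner_Integration.integral_cong) (auto simp: P indicator_def)
    finally show ?thesis .
  qed
  have shift_int: "integrable lborel (\<lambda>q. P \<beta> (q - y) * \<phi> q)" if "y \<ge> 0" for y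
  proof -
    have "integrable lborel (\<lambda>r. P \<beta> r * \<phi> (y + r))"
      using set_integrable_powr_exp_bound(1)[OF \<beta> \<phi> M that]
      unfolding set_integrable_def by (rule Bochner_Integration.integrable_cong[THEN iffD1, rotated -1]) (auto simp: P indicator_def)
    thus ?thesis
      using lborel_integrable_real_affine_iff[of 1 "\<lambda>q. P \<beta> (q - y) * \<phi> q" y] by simp
  qed
  have int: "integrable (lborel \<Otimes>\<^sub>M lborel) (case_prod F)"
  proof (rule lborel_pair.Fubini_integrable[OF Fm])
    show "AE y in lborel. integrable lborel (\<lambda>q. case_prod F (y, q))"
    proof (intro AE_I2)
      fix y :: real
      show "integrable lborel (\<lambda>q. case_prod F (y, q))"
        using shift_int[of y] by (cases "y > 0") (auto simp: F_def P)
    qed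
    define K where "K = M * (LINT r:{0<..}|lborel. r powr (Re \<beta> - 1) * exp (- r))"
    have "set_integrable lborel {0<..} (\<lambda>y. K * (y powr (Re \<alpha> - 1) * exp (- y)))"
      using \<alpha> by (intro set_integrable_mult_right Gamma_set_integrable_real)
    hence "integrable lborel (\<lambda>y. indicator {0<..} y *\<^sub>R (K * (y powr (Re \<alpha> - 1) * exp (- y))))"
      by (simp add: set_integrable_def)
    thus "integrable lborel (\<lambda>y. LINT q|lborel. norm (case_prod F (y, q)))"
    proof (rule Bochner_Integration.integrable_bound)
      show "(\<lambda>y. LINT q|lborel. norm (case_prod F (y, q))) \<in> borel_measurable lborel" by measurable
      show "AE y in lborel. norm (LINT q|lborel. norm (case_prod F (y, q))) \<le>
         norm (indicator {0<..} y *\<^sub>R (K * (y powr (Re \<alpha> - 1) * exp (- y))))"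
      proof (intro AE_I2)
        fix y :: real
        show "norm (LINT q|lborel. norm (case_prod F (y, q))) \<le>
         norm (indicator {0<..} y *\<^sub>R (K * (y powr (Re \<alpha> - 1) * exp (- y))))"
        proof (cases "y > 0")
          case True
          have "(LINT q|lborel. norm (case_prod F (y, q))) = norm (P \<alpha> y) * (LINT q|lborel. norm (P \<beta> (q - y) * \<phi> q))"
            by (simp add: F_def norm_mult)
          also have "\<dots> \<le> norm (P \<alpha> y) * (exp (- y) * K)"
            using set_integrable_powr_exp_bound(2)[OF \<beta> \<phi> M, of y] True
            unfolding K_def by (subst shift) (auto intro!: mult_left_mono)
          also have "\<dots> = K * (y powr (Re \<alpha> - 1) * exp (- y))"
            using True by (simp add: P norm_powr_real_powr)
          finally show ?thesis using True by (simp add: abs_of_nonneg integral_nonneg_AE)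
        qed (auto simp: F_def P)
      qed
    qed
  qed
  \<comment> \<open>For fixed q > 0 the scaling y = q x pulls out the powers of q and leaves the
    Beta integral over 0 < x < 1.\<close>
  have inner: "(LINT y|lborel. F y q) = indicator {0<..} q *\<^sub>R (beta_integral \<alpha> \<beta> * (of_real q powr (\<alpha> + \<beta> - 1) * \<phi> q))" for q
  proof (cases "q > 0")
    case True
    have "(LINT y|lborel. F y q) = of_real q * (LINT x|lborel. F (q * x) q)"
      using True by (subst lborel_integral_real_affine[of q _ 0]) (auto simp: scaleR_conv_of_real)
    also have "(LINT x|lborel. F (q * x) q) = (LINT x:{0<..<1}|lborel. (of_real q powr (\<alpha> - 1) * of_real q powr (\<beta> - 1) * \<phi> q)
        * (of_real x powr (\<alpha> - 1) * of_real (1 - x) powr (\<beta> - 1)))"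
      unfolding set_lebesgue_integral_def
    proof (rule Bochner_Integration.integral_cong[OF refl])
      fix x :: real
      show "F (q * x) q = indicator {0<..<1} x *\<^sub>R ((of_real q powr (\<alpha> - 1) * of_real q powr (\<beta> - 1) * \<phi> q)
        * (of_real x powr (\<alpha> - 1) * of_real (1 - x) powr (\<beta> - 1)))"
      proof (cases "x \<in> {0<..<1}")
        case x: True
        have "complex_of_real (q * x) powr (\<alpha> - 1) = of_real q powr (\<alpha> - 1) * of_real x powr (\<alpha> - 1)"
          using x True by (simp add: powr_times_real)
        moreover have "complex_of_real (q - q * x) powr (\<beta> - 1) = of_real q powr (\<beta> - 1) * of_real (1 - x) powr (\<beta> - 1)"
        proof -
          have "complex_of_real (q - q * x) = of_real q * of_real (1 - x)" by (simp add: algebra_simps)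
          thus ?thesis using x True by (simp only: powr_times_real[of "of_real q" "of_real (1 - x)"]) (simp add: powr_times_real)
        qed
        moreover have "q * x > 0" "q - q * x > 0" using x True by auto
        ultimately show ?thesis using x by (simp add: F_def P del: of_real_mult of_real_diff)
      next
        case False
        hence "q * x \<le> 0 \<or> q - q * x \<le> 0" using True by (auto simp: mult_le_0_iff)
        thus ?thesis using False by (auto simp: F_def P)
      qed
    qed
    also have "\<dots> = (of_real q powr (\<alpha> - 1) * of_real q powr (\<beta> - 1) * \<phi> q) * beta_integral \<alpha> \<beta>"
      unfolding beta_integral_def by (rule set_integral_mult_right)
    also have "of_real q * \<dots> = beta_integral \<alpha> \<beta> * ((of_real q * of_real q powr (\<alpha> - 1) * of_real q powr (\<beta> - 1)) * \<phi> q)"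
      by simp
    also have "of_real q * of_real q powr (\<alpha> - 1) * of_real q powr (\<beta> - 1) = complex_of_real q powr (\<alpha> + \<beta> - 1)"
    proof -
      have "\<alpha> + \<beta> - 1 = 1 + (\<alpha> - 1) + (\<beta> - 1)" by simp
      thus ?thesis using True by (simp only: powr_add) simp
    qed
    finally show ?thesis using True by simp
  next
    case False
    hence "F y q = 0" for y by (auto simp: F_def P)
    thus ?thesis using False by simp
  qed
  have "(LINT y:{0<..}|lborel. of_real y powr (\<alpha> - 1) * (LINT r:{0<..}|lborel. of_real r powr (\<beta> - 1) * \<phi> (y + r)))
     = (LINT y|lborel. LINT q|lborel. F y q)"
    unfolding set_lebesgue_integral_def[of lborel "{0<..}" "\<lambda>y. of_real y powr (\<alpha> - 1) * (LINT r:{0<..}|lborel. of_real r powr (\<beta> - 1) * \<phi> (y + r))"]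
  proof (rule Bochner_Integration.integral_cong[OF refl])
    fix y :: real
    show "indicator {0<..} y *\<^sub>R (of_real y powr (\<alpha> - 1) * (LINT r:{0<..}|lborel. of_real r powr (\<beta> - 1) * \<phi> (y + r))) = (LINT q|lborel. F y q)"
      using shift[of "\<lambda>x. x" y] by (auto simp: F_def P indicator_def)
  qed
  also have "\<dots> = (LINT q|lborel. LINT y|lborel. F y q)"
    by (rule lborel_pair.Fubini_integral[OF int, symmetric])
  also have "\<dots> = (LINT q:{0<..}|lborel. beta_integral \<alpha> \<beta> * (of_real q powr (\<alpha> + \<beta> - 1) * \<phi> q))"
    unfolding inner set_lebesgue_integral_def ..
  also have "\<dots> = beta_integral \<alpha> \<beta> * (LINT q:{0<..}|lborel. of_real q powr (\<alpha> + \<beta> - 1) * \<phi> q)"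
    by (rule set_integral_mult_right)
  finally show ?thesis .
qed

text \<open>For \<open>\<phi> q = exp (- q)\<close> all the integrals in
  \<open>powr_convolution\<close> are Gamma integrals, so the convolution identity itself evaluates
  the Beta integral.\<close>

lemma beta_integral_eq:
  assumes "Re \<alpha> > 0" "Re \<beta> > 0"
  shows "beta_integral \<alpha> \<beta> * Gamma (\<alpha> + \<beta>) = Gamma \<alpha> * Gamma \<beta>"
proof -
  have "(LINT y:{0<..}|lborel. of_real y powr (\<alpha> - 1) * (LINT r:{0<..}|lborel. of_real r powr (\<beta> - 1) * exp (- of_real (y + r))))
     = beta_integral \<alpha> \<beta> * (LINT q:{0<..}|lborel. of_real q powr (\<alpha> + \<beta> - 1) * exp (- of_real q))"
    by (rule powr_convolution[OF assms, where M = 1]) (auto intro!: continuous_intros)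
  also have "(LINT q:{0<..}|lborel. of_real q powr (\<alpha> + \<beta> - 1) * exp (- of_real q)) = Gamma (\<alpha> + \<beta>)"
    by (rule Gamma_set_integral) (use assms in auto)
  finally have eq: "(LINT y:{0<..}|lborel. of_real y powr (\<alpha> - 1) * (LINT r:{0<..}|lborel. of_real r powr (\<beta> - 1) * exp (- of_real (y + r))))
     = beta_integral \<alpha> \<beta> * Gamma (\<alpha> + \<beta>)" .
  have inner: "(LINT r:{0<..}|lborel. of_real r powr (\<beta> - 1) * exp (- complex_of_real (y + r))) = exp (- of_real y) * Gamma \<beta>" for y
  proof -
    have "(LINT r:{0<..}|lborel. of_real r powr (\<beta> - 1) * exp (- complex_of_real (y + r))) =
       (LINT r:{0<..}|lborel. exp (- of_real y) * (of_real r powr (\<beta> - 1) * exp (- complex_of_real r)))"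
      by (simp add: exp_diff exp_minus field_simps)
    thus ?thesis using Gamma_set_integral(2)[OF assms(2)] by simp
  qed
  have "(LINT y:{0<..}|lborel. of_real y powr (\<alpha> - 1) * (exp (- of_real y) * Gamma \<beta>)) = Gamma \<alpha> * Gamma \<beta>"
    using Gamma_set_integral(2)[OF assms(1)] by (simp only: mult.assoc[symmetric] set_integral_mult_left)
  thus ?thesis using eq unfolding inner by simp
qed

lemma pc_G_weyl_integrable:
  assumes "Re \<alpha> > 0" "Re b \<ge> 0"
  shows "set_integrable lborel {0<..} (\<lambda>y. of_real y powr (\<alpha> - 1) * pc_G \<kappa> (of_real y + b))"
proof -
  obtain C N where C: "C > 0"
    "\<And>w. Re w \<ge> 0 \<Longrightarrow> norm (pc_G \<kappa> w) \<le> C * (1 + norm w) ^ N * exp (- Re (w\<^sup>2) / 2)"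
    using pc_G_bound by metis
  define K where "K = C * (1 + norm b) ^ N * exp (- Re (b\<^sup>2) / 2)"
  let ?w = "\<lambda>y::real. K * (y powr (Re \<alpha> - 1) * ((1 + y) ^ N * exp (0 * y - (1/2) * y\<^sup>2)))"
  have w: "set_integrable lborel {0<..} ?w"
    by (intro set_integrable_mult_right set_integrable_power_gauss) (use assms in auto)
  show ?thesis
  proof (rule set_integrable_continuous_bound[OF w])
    fix y :: real assume "y \<in> {0<..}"
    hence y: "y > 0" by simp
    have "norm (of_real y + b) \<le> y + norm b" using norm_triangle_ineq[of "of_real y" b] y by simp
    also have "1 + (y + norm b) \<le> (1 + norm b) * (1 + y)" using y by (simp add: algebra_simps)
    finally have n: "(1 + norm (of_real y + b)) ^ N \<le> ((1 + norm b) * (1 + y)) ^ N"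
      by (intro power_mono) auto
    have "Re ((of_real y + b)\<^sup>2) = y\<^sup>2 + 2 * y * Re b + Re (b\<^sup>2)"
      by (simp add: power2_eq_square algebra_simps)
    hence e: "exp (- Re ((of_real y + b)\<^sup>2) / 2) \<le> exp (- Re (b\<^sup>2) / 2 + (0 * y - (1/2) * y\<^sup>2))"
      using assms(2) y by simp
    have "norm (pc_G \<kappa> (of_real y + b)) \<le> C * (1 + norm (of_real y + b)) ^ N * exp (- Re ((of_real y + b)\<^sup>2) / 2)"
      by (rule C) (use assms y in simp)
    also have "\<dots> \<le> C * ((1 + norm b) * (1 + y)) ^ N * exp (- Re (b\<^sup>2) / 2 + (0 * y - (1/2) * y\<^sup>2))"
      using C(1) y by (intro mult_mono n e order_refl) auto
    also have "\<dots> = K * ((1 + y) ^ N * exp (0 * y - (1/2) * y\<^sup>2))"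
      unfolding exp_add power_mult_distrib K_def by simp
    finally have "y powr (Re \<alpha> - 1) * norm (pc_G \<kappa> (of_real y + b)) \<le> y powr (Re \<alpha> - 1) * (K * ((1 + y) ^ N * exp (0 * y - (1/2) * y\<^sup>2)))"
      by (intro mult_left_mono) auto
    thus "norm (of_real y powr (\<alpha> - 1) * pc_G \<kappa> (of_real y + b)) \<le> ?w y"
      using y by (simp add: norm_mult norm_powr_real_powr mult_ac)
  qed (auto intro!: continuous_intros simp: complex_nonpos_Reals_iff)
qed

text \<open>Completing the square, \<open>pc_G (- \<beta>)\<close> at y + b is, up to
  Gamma(\<beta>), the Weyl integral of order \<beta> of the Gaussian
  \<open>exp (- (q + b)^2 / 2)\<close>. A further Weyl integral of order \<alpha> only adds the
  orders, by \<open>powr_convolution\<close>.\<close>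

lemma pc_G_weyl_neg:
  assumes "Re \<alpha> > 0" "Re \<beta> > 0" "Re b \<ge> 0"
  shows "(LINT y:{0<..}|lborel. of_real y powr (\<alpha> - 1) * pc_G (- \<beta>) (of_real y + b)) = Gamma \<alpha> * pc_G (- \<beta> - \<alpha>) b"
proof -
  define \<phi> where "\<phi> q = exp (- (of_real q + b)\<^sup>2 / 2)" for q :: real
  have \<phi>: "continuous_on UNIV \<phi>" unfolding \<phi>_def by (intro continuous_intros) auto
  obtain M0 where M0: "M0 > 0" "\<And>s. s \<ge> 0 \<Longrightarrow> (1 + s) ^ 0 * exp (0 * s - (1/2) * s\<^sup>2) \<le> M0 * exp (- s :: real)"
    by (rule power_gauss_bound[of "1/2" 0 0]) auto
  have M: "norm (\<phi> q) \<le> (exp (- Re (b\<^sup>2) / 2) * M0) * exp (- q)" if "q \<ge> 0" for q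
  proof -
    have "norm (\<phi> q) = exp (- (q\<^sup>2 + 2 * q * Re b + Re (b\<^sup>2)) / 2)"
      unfolding \<phi>_def norm_exp_eq_Re by (simp add: power2_eq_square algebra_simps)
    also have "\<dots> \<le> exp (- Re (b\<^sup>2) / 2 + (0 * q - (1/2) * q\<^sup>2))"
      using that assms by simp
    also have "\<dots> \<le> exp (- Re (b\<^sup>2) / 2) * (M0 * exp (- q))"
      unfolding exp_add using M0(2)[OF that] by (intro mult_left_mono) auto
    finally show ?thesis by simp
  qed
  have rep: "(LINT r:{0<..}|lborel. of_real r powr (\<gamma> - 1) * \<phi> (y + r)) = Gamma \<gamma> * pc_G (- \<gamma>) (of_real y + b)"
    if "Re \<gamma> > 0" for y \<gamma>
  proof -
    have "of_real r powr (\<gamma> - 1) * \<phi> (y + r) = exp (- (of_real y + b)\<^sup>2 / 2) *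
        (of_real r powr (\<gamma> - 1) * exp (- (of_real y + b) * of_real r - (of_real r)\<^sup>2 / 2))" for r
    proof -
      have "- (of_real (y + r) + b)\<^sup>2 / 2 = - (of_real y + b)\<^sup>2 / 2 + (- (of_real y + b) * of_real r - (of_real r)\<^sup>2 / 2)"
        by (simp add: power2_eq_square field_simps)
      thus ?thesis unfolding \<phi>_def by (simp only: exp_add mult_ac)
    qed
    hence "(LINT r:{0<..}|lborel. of_real r powr (\<gamma> - 1) * \<phi> (y + r)) = exp (- (of_real y + b)\<^sup>2 / 2) *
        (LINT r:{0<..}|lborel. of_real r powr (\<gamma> - 1) * exp (- (of_real y + b) * of_real r - (of_real r)\<^sup>2 / 2))"
      by (simp only: set_integral_mult_right)
    thus ?thesis unfolding pc_h_integral(2)[OF that] pc_G_eq_pc_h by (simp only: mult_ac)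
  qed
  have "(LINT y:{0<..}|lborel. of_real y powr (\<alpha> - 1) * (LINT r:{0<..}|lborel. of_real r powr (\<beta> - 1) * \<phi> (y + r)))
     = beta_integral \<alpha> \<beta> * (LINT q:{0<..}|lborel. of_real q powr (\<alpha> + \<beta> - 1) * \<phi> (0 + q))"
    using powr_convolution[OF assms(1,2) \<phi> M] by simp
  also have "(LINT q:{0<..}|lborel. of_real q powr (\<alpha> + \<beta> - 1) * \<phi> (0 + q)) = Gamma (\<alpha> + \<beta>) * pc_G (- (\<alpha> + \<beta>)) b"
    using rep[of "\<alpha> + \<beta>" 0] assms by simp
  also have "beta_integral \<alpha> \<beta> * \<dots> = Gamma \<alpha> * Gamma \<beta> * pc_G (- (\<alpha> + \<beta>)) b"
    using beta_integral_eq[OF assms(1,2)] by (simp flip: mult.assoc)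
  finally have "(LINT y:{0<..}|lborel. Gamma \<beta> * (of_real y powr (\<alpha> - 1) * pc_G (- \<beta>) (of_real y + b))) = 
     Gamma \<beta> * (Gamma \<alpha> * pc_G (- (\<alpha> + \<beta>)) b)"
    unfolding rep[OF assms(2)] by (simp add: mult_ac)
  hence "(LINT y:{0<..}|lborel. of_real y powr (\<alpha> - 1) * pc_G (- \<beta>) (of_real y + b)) = Gamma \<alpha> * pc_G (- (\<alpha> + \<beta>)) b"
    using Gamma_neq_0_pos[OF assms(2)] by simp
  moreover have "- (\<alpha> + \<beta>) = - \<beta> - \<alpha>" by simp
  ultimately show ?thesis by (simp only:)
qed

text \<open>The recurrence expresses \<open>pc_G \<kappa>\<close> at y + b by the indices \<kappa> -
  1 and \<kappa> - 2. The factor y it produces raises \<alpha> by one, so the induction has to treat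
  all \<alpha> at once.\<close>

lemma pc_G_weyl:
  assumes "Re \<alpha> > 0" "Re b \<ge> 0"
  shows "(LINT y:{0<..}|lborel. of_real y powr (\<alpha> - 1) * pc_G \<kappa> (of_real y + b)) = Gamma \<alpha> * pc_G (\<kappa> - \<alpha>) b"
proof -
  define V where "V \<alpha> \<kappa> = (LINT y:{0<..}|lborel. of_real y powr (\<alpha> - 1) * pc_G \<kappa> (of_real y + b))" for \<alpha> \<kappa>
  have "V \<alpha> \<kappa> = Gamma \<alpha> * pc_G (\<kappa> - \<alpha>) b" if "Re \<kappa> < real n" "Re \<alpha> > 0" for n \<kappa> \<alpha>
    using that
  proof (induction n arbitrary: \<kappa> \<alpha>)
    case 0
    thus ?case using pc_G_weyl_neg[of \<alpha> "- \<kappa>" b] assms(2) by (simp add: V_def)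
  next
    case (Suc n)
    let ?f = "\<lambda>\<alpha> \<kappa> y. of_real y powr (\<alpha> - 1) * pc_G \<kappa> (of_real y + b)"
    have I: "set_integrable lborel {0<..} (?f (\<alpha> + 1) (\<kappa> - 1))" "set_integrable lborel {0<..} (?f \<alpha> (\<kappa> - 1))"
      "set_integrable lborel {0<..} (?f \<alpha> (\<kappa> - 2))"
      by (rule pc_G_weyl_integrable; use assms Suc.prems in simp)+
    have eq: "?f \<alpha> \<kappa> y = ?f (\<alpha> + 1) (\<kappa> - 1) y + b * ?f \<alpha> (\<kappa> - 1) y - (\<kappa> - 1) * ?f \<alpha> (\<kappa> - 2) y" if "y \<in> {0<..}" for y
    proof -
      have "complex_of_real y powr (\<alpha> + 1 - 1) = of_real y * of_real y powr (\<alpha> - 1)"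
      proof -
        have "\<alpha> + 1 - 1 = (\<alpha> - 1) + 1" by simp
        thus ?thesis using that by (simp only: powr_add) simp
      qed
      moreover have "pc_G \<kappa> (of_real y + b) = (of_real y + b) * pc_G (\<kappa> - 1) (of_real y + b) - (\<kappa> - 1) * pc_G (\<kappa> - 2) (of_real y + b)"
        using pc_G_rec[of "\<kappa> - 1"] by (simp add: diff_diff_eq)
      ultimately show ?thesis by (simp only:) (simp add: algebra_simps)
    qed
    have "V \<alpha> \<kappa> = (LINT y:{0<..}|lborel. ?f (\<alpha> + 1) (\<kappa> - 1) y + b * ?f \<alpha> (\<kappa> - 1) y - (\<kappa> - 1) * ?f \<alpha> (\<kappa> - 2) y)"
      unfolding V_def by (rule set_lebesgue_integral_cong) (use eq in auto)
    also have "\<dots> = V (\<alpha> + 1) (\<kappa> - 1) + b * V \<alpha> (\<kappa> - 1) - (\<kappa> - 1) * V \<alpha> (\<kappa> - 2)"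
      unfolding V_def using I by (subst set_integral_diff set_integral_add set_integral_mult_right; (intro set_integral_add set_integrable_mult_right)?)+ auto
    also have "V (\<alpha> + 1) (\<kappa> - 1) = Gamma (\<alpha> + 1) * pc_G (\<kappa> - 1 - (\<alpha> + 1)) b"
      by (rule Suc.IH) (use Suc.prems in auto)
    also have "V \<alpha> (\<kappa> - 1) = Gamma \<alpha> * pc_G (\<kappa> - 1 - \<alpha>) b"
      by (rule Suc.IH) (use Suc.prems in auto)
    also have "V \<alpha> (\<kappa> - 2) = Gamma \<alpha> * pc_G (\<kappa> - 2 - \<alpha>) b"
      by (rule Suc.IH) (use Suc.prems in auto)
    also have "Gamma (\<alpha> + 1) = \<alpha> * Gamma \<alpha>"
      using Suc.prems by (intro Gamma_plus1) (auto elim!: nonpos_Ints_cases)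
    also have "\<alpha> * Gamma \<alpha> * pc_G (\<kappa> - 1 - (\<alpha> + 1)) b + b * (Gamma \<alpha> * pc_G (\<kappa> - 1 - \<alpha>) b) - (\<kappa> - 1) * (Gamma \<alpha> * pc_G (\<kappa> - 2 - \<alpha>) b)
      = Gamma \<alpha> * pc_G (\<kappa> - \<alpha>) b"
    proof -
      have k: "\<kappa> - 1 - (\<alpha> + 1) = \<kappa> - \<alpha> - 1 - 1" "\<kappa> - 2 - \<alpha> = \<kappa> - \<alpha> - 1 - 1" "\<kappa> - 1 - \<alpha> = \<kappa> - \<alpha> - 1" by simp_all
      have G: "pc_G (\<kappa> - \<alpha>) b = b * pc_G (\<kappa> - \<alpha> - 1) b - (\<kappa> - \<alpha> - 1) * pc_G (\<kappa> - \<alpha> - 1 - 1) b"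
        using pc_G_rec[of "\<kappa> - \<alpha> - 1" b] by simp
      show ?thesis unfolding k G by (simp add: algebra_simps)
    qed
    finally show ?case .
  qed
  moreover have "Re \<kappa> < real (nat \<lceil>Re \<kappa>\<rceil> + 1)" by linarith
  ultimately show ?thesis using assms(1) unfolding V_def by blast
qed

section \<open>The heat kernel form of the integrand\<close>

text \<open>The open cone |arg w| < pi/4 in Cartesian form. It is closed under sums and positive
  scaling, and products of two elements have positive real part; this keeps a x + b inside and
  controls the Gaussian factors.\<close>

definition sector :: "complex set" where
  "sector = {w. \<bar>Im w\<bar> < Re w}"

lemma open_sector: "open sector"
  unfolding sector_def by (intro open_Collect_less continuous_intros)

lemma sector_add: "a \<in> sector \<Longrightarrow> b \<in> sector \<Longrightarrow> a + b \<in> sector"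
  by (auto simp: sector_def)

lemma sector_scale: "b \<in> sector \<Longrightarrow> t > 0 \<Longrightarrow> of_real t * b \<in> sector"
  by (auto simp: sector_def abs_mult)

lemma sector_of_real: "t > 0 \<Longrightarrow> of_real t \<in> sector"
  by (auto simp: sector_def)

lemma convex_sector: "convex sector"
proof (rule convexI)
  fix x y u v assume *: "x \<in> sector" "y \<in> sector" "(0::real) \<le> u" "0 \<le> v" "u + v = 1"
  show "u *\<^sub>R x + v *\<^sub>R y \<in> sector"
    using * sector_add[OF sector_scale[of x u] sector_scale[of y v]]
    by (cases "u = 0"; cases "v = 0") (auto simp: scaleR_conv_of_real)
qed

lemma sector_Re_pos: "w \<in> sector \<Longrightarrow> Re w > 0"
  by (auto simp: sector_def)

lemma sector_Re_mult_pos: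
  assumes "a \<in> sector" "b \<in> sector"
  shows "Re (a * b) > 0"
proof -
  have "\<bar>Im a\<bar> * \<bar>Im b\<bar> < Re a * Re b"
    using assms by (intro mult_strict_mono) (auto simp: sector_def)
  hence "Im a * Im b < Re a * Re b" using abs_le_D1[of "Im a * Im b" "\<bar>Im a\<bar> * \<bar>Im b\<bar>"] by (simp add: abs_mult)
  thus ?thesis by simp
qed

lemma sector_Re_square_pos: "w \<in> sector \<Longrightarrow> Re (w\<^sup>2) > 0"
  unfolding power2_eq_square by (rule sector_Re_mult_pos)

text \<open>All mixed terms of the square have positive real part. The lower bound
  \<open>Re (b^2)\<close>, free of \<open>a\<close> and \<open>x\<close>, is the \<open>q\<close>
  with which \<open>pc_g_bound\<close> is applied along the whole path.\<close>

lemma sector_affine: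
  assumes "a \<in> sector" "b \<in> sector" "x > 0"
  shows "a * of_real x + b \<in> sector" and "Re ((a * of_real x + b)\<^sup>2) \<ge> Re (b\<^sup>2)"
proof -
  show "a * of_real x + b \<in> sector"
    using sector_add[OF sector_scale[OF assms(1,3)] assms(2)] by (simp add: mult.commute)
  have "(a * of_real x + b)\<^sup>2 = of_real (x\<^sup>2) * a\<^sup>2 + of_real (2 * x) * (a * b) + b\<^sup>2"
    by (simp add: power2_eq_square algebra_simps)
  hence "Re ((a * of_real x + b)\<^sup>2) = x\<^sup>2 * Re (a\<^sup>2) + (2 * x) * Re (a * b) + Re (b\<^sup>2)"
    by (simp del: of_real_power of_real_mult)
  thus "Re ((a * of_real x + b)\<^sup>2) \<ge> Re (b\<^sup>2)"
    using sector_Re_square_pos[OF assms(1)] sector_Re_mult_pos[OF assms(1,2)] assms(3) by simp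
qed

text \<open>A self-similar solution of the heat equation in time u and space c: d/dc sends
  \<open>pc_g \<kappa>\<close> to \<open>- pc_g (\<kappa> + 1)\<close>, and d/du sends it to half of
  \<open>pc_g (\<kappa> + 2)\<close>. For \<kappa> = 0 it is, up to a constant, the heat kernel
  \<open>u powr (- 1/2) * exp (- c^2 / (2 * u))\<close>.\<close>

definition pc_g :: "complex \<Rightarrow> complex \<Rightarrow> complex \<Rightarrow> complex" where
  "pc_g \<kappa> u c = u powr (- (\<kappa> + 1) / 2) * pc_G \<kappa> (c * u powr (- 1 / 2))"

lemma power_le_fact_exp: "x \<ge> 0 \<Longrightarrow> x ^ n \<le> fact n * exp (x :: real)"
proof -
  assume x: "x \<ge> 0"
  have S: "(\<lambda>n. x ^ n / fact n) sums exp x"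
    using exp_converges[of x] by (simp add: divide_inverse mult.commute)
  have "x ^ n / fact n \<le> exp x"
    using sum_le_suminf[OF sums_summable[OF S], of "{n}"] sums_unique[OF S] x by simp
  thus ?thesis by (simp add: field_simps)
qed

text \<open>The factor \<open>u\<close> makes the boundary term at \<open>x = 1\<close>, where \<open>u = 1 - x\<^sup>2\<close>, vanish in the partial integration below.\<close>

lemma pc_g_bound:
  assumes "q > 0"
  obtains C N where "C > 0"
    "\<And>u c. u \<in> {0<..1} \<Longrightarrow> c \<in> sector \<Longrightarrow> Re (c\<^sup>2) \<ge> q \<Longrightarrow>
       norm (pc_g \<kappa> (of_real u) c) \<le> C * u * (1 + norm c) ^ N * exp (- Re (c\<^sup>2) / 4)"
proof -
  obtain C N where C: "C > 0"
    "\<And>w. Re w \<ge> 0 \<Longrightarrow> norm (pc_G \<kappa> w) \<le> C * (1 + norm w) ^ N * exp (- Re (w\<^sup>2) / 2)"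
    using pc_G_bound by metis
  \<comment> \<open>\<open>K\<close> is large enough that all powers of u occurring are at most
    \<open>u * (1 / u) ^ K\<close>. The factor \<open>(1 / u) ^ K\<close> is absorbed by
    \<open>exp (q / (4 * u))\<close>; since q <= Q and u <= 1, the remaining exponent is at most - Q
    / 4.\<close>
  define K where "K = nat \<lceil>(Re \<kappa> + 1) / 2 + real N / 2 + 1\<rceil>"
  define D where "D = C * ((4 / q) ^ K * fact K)"
  have D: "D > 0" using C(1) assms by (simp add: D_def)
  have "norm (pc_g \<kappa> (of_real u) c) \<le> D * u * (1 + norm c) ^ N * exp (- Re (c\<^sup>2) / 4)"
    if u: "u \<in> {0<..1}" and c: "c \<in> sector" "Re (c\<^sup>2) \<ge> q" for u c
  proof -
    have u0: "u > 0" "u \<le> 1" using u by auto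
    have p: "complex_of_real u powr (- 1 / 2) = of_real (u powr (- 1 / 2))"
      using powr_of_real[of u "- 1 / 2"] u0 by simp
    define v where "v = u powr (- 1 / 2)"
    have v1: "v \<ge> 1" unfolding v_def using powr_mono2'[of "-1/2" u 1] u0 by simp
    have v2: "v\<^sup>2 = 1 / u" unfolding v_def using u0
      by (simp add: power2_eq_square powr_add[symmetric] powr_minus_divide)
    define Q where "Q = Re (c\<^sup>2)"
    have rc: "Re (c * of_real v) \<ge> 0" using sector_Re_pos[OF c(1)] v1 by simp
    have rc2: "Re ((c * of_real v)\<^sup>2) = Q / u"
      by (simp add: power_mult_distrib v2 Q_def flip: of_real_power)
    have nc: "1 + norm (c * of_real v) \<le> v * (1 + norm c)"
      using v1 by (simp add: norm_mult algebra_simps)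
    have vN: "v ^ N = u powr (- real N / 2)"
      unfolding v_def using u0 by (simp add: powr_powr flip: powr_realpow)
    have "norm (pc_g \<kappa> (of_real u) c) = u powr (- (Re \<kappa> + 1) / 2) * norm (pc_G \<kappa> (c * of_real v))"
      using u0 unfolding pc_g_def p by (simp add: norm_mult norm_powr_real_powr v_def)
    also have "\<dots> \<le> u powr (- (Re \<kappa> + 1) / 2) * (C * (1 + norm (c * of_real v)) ^ N * exp (- (Q / u) / 2))"
      using C(2)[OF rc] unfolding rc2 by (intro mult_left_mono) auto
    also have "\<dots> \<le> u powr (- (Re \<kappa> + 1) / 2) * (C * (v * (1 + norm c)) ^ N * exp (- (Q / u) / 2))"
      using C(1) by (intro mult_left_mono mult_right_mono power_mono nc) auto
    also have "\<dots> = C * (1 + norm c) ^ N * (u powr (- (Re \<kappa> + 1) / 2 + - real N / 2) * exp (- (Q / u) / 2))"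
      unfolding power_mult_distrib vN powr_add by simp
    also have "\<dots> \<le> C * (1 + norm c) ^ N * (((4 / q) ^ K * fact K * u) * exp (- Q / 4))"
    proof -
      have "u powr (- (Re \<kappa> + 1) / 2 + - real N / 2) \<le> u powr (1 - real K)"
      proof (rule powr_mono')
        show "1 - real K \<le> - (Re \<kappa> + 1) / 2 + - real N / 2"
          using real_nat_ceiling_ge[of "(Re \<kappa> + 1) / 2 + real N / 2 + 1"] unfolding K_def[symmetric] by (simp add: field_simps)
      qed (use u0 in auto)
      also have "\<dots> = u * (1 / u) ^ K"
        using u0 by (simp add: powr_diff powr_realpow power_one_over)
      finally have 1: "u powr (- (Re \<kappa> + 1) / 2 + - real N / 2) \<le> u * (1 / u) ^ K" .
      have "(1 / u) ^ K = (4 / q) ^ K * (q / (4 * u)) ^ K"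
        unfolding power_mult_distrib[symmetric] using assms u0 by simp
      also have "\<dots> \<le> (4 / q) ^ K * (fact K * exp (q / (4 * u)))"
        using power_le_fact_exp[of "q / (4 * u)" K] assms u0 by (intro mult_left_mono) auto
      finally have "(1 / u) ^ K \<le> (4 / q) ^ K * fact K * exp (q / (4 * u))" by (simp only: mult.assoc)
      hence "(1 / u) ^ K * exp (- (Q / u) / 2) \<le> ((4 / q) ^ K * fact K * exp (q / (4 * u))) * exp (- (Q / u) / 2)"
        by (rule mult_right_mono) auto
      also have "\<dots> = ((4 / q) ^ K * fact K) * exp (q / (4 * u) - (Q / u) / 2)"
      proof -
        have "q / (4 * u) - (Q / u) / 2 = q / (4 * u) + - (Q / u) / 2" by simp
        thus ?thesis by (simp only: exp_add mult.assoc)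
      qed
      also have "\<dots> \<le> ((4 / q) ^ K * fact K) * exp (- Q / 4)"
      proof -
        have "q / u \<le> Q / u" using c(2) u0 by (simp add: Q_def divide_right_mono)
        moreover have "Q * 1 \<le> Q * (1 / u)" using u0 c(2) assms by (intro mult_left_mono) (auto simp: Q_def)
        moreover have "A / 4 - B / 2 \<le> - Q / 4" if "A \<le> B" "Q \<le> B" for A B :: real
          using that by linarith
        ultimately have "(q / u) / 4 - (Q / u) / 2 \<le> - Q / 4" by simp
        hence "q / (4 * u) - (Q / u) / 2 \<le> - Q / 4" by (simp add: mult.commute)
        thus ?thesis using assms by (intro mult_left_mono) auto
      qed
      finally have 2: "u * ((1 / u) ^ K * exp (- (Q / u) / 2)) \<le> u * (((4 / q) ^ K * fact K) * exp (- Q / 4))"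
        using u0 by (intro mult_left_mono) auto
      have "u powr (- (Re \<kappa> + 1) / 2 + - real N / 2) * exp (- (Q / u) / 2) \<le> (u * (1 / u) ^ K) * exp (- (Q / u) / 2)"
        by (rule mult_right_mono[OF 1]) auto
      also have "\<dots> \<le> ((4 / q) ^ K * fact K * u) * exp (- Q / 4)" using 2 by (simp only: mult_ac)
      finally show ?thesis using C(1) by (intro mult_left_mono) auto
    qed
    also have "\<dots> = D * u * (1 + norm c) ^ N * exp (- Re (c\<^sup>2) / 4)"
      by (simp add: D_def Q_def)
    finally show ?thesis .
  qed
  thus ?thesis using that D by blast
qed

lemma has_field_derivative_pc_g:
  assumes "u \<noteq> 0"
  shows "(pc_g \<kappa> u has_field_derivative - pc_g (\<kappa> + 1) u c) (at c)"
proof -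
  have "((\<lambda>c. u powr (- (\<kappa> + 1) / 2) * pc_G \<kappa> (c * u powr (- 1 / 2))) has_field_derivative
     u powr (- (\<kappa> + 1) / 2) * (- pc_G (\<kappa> + 1) (c * u powr (- 1 / 2)) * u powr (- 1 / 2))) (at c)"
    by (intro DERIV_cmult has_field_derivative_pc_G') (auto intro!: derivative_eq_intros)
  moreover have "- (\<kappa> + 1 + 1) / 2 = - (\<kappa> + 1) / 2 + - 1 / 2"
    by (simp add: add_divide_distrib diff_divide_distrib)
  hence "u powr (- (\<kappa> + 1 + 1) / 2) = u powr (- (\<kappa> + 1) / 2) * u powr (- 1 / 2)"
    by (simp only: powr_add)
  ultimately show ?thesis unfolding pc_g_def[abs_def] by (simp add: mult_ac)
qed

text \<open>Chain rule along the path u = 1 - x^2, c = a x + b: du/dx = - 2 x meets the factor 1/2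
  of the heat equation, and dc/dx = a. This choice of time makes the x-derivative a combination of
  index shifts.\<close>

lemma has_vector_derivative_pc_g:
  assumes "x \<in> {0<..<1}"
  shows "((\<lambda>x. pc_g \<kappa> (of_real (1 - x\<^sup>2)) (a * of_real x + b)) has_vector_derivative
     - (of_real x * pc_g (\<kappa> + 2) (of_real (1 - x\<^sup>2)) (a * of_real x + b)
        + a * pc_g (\<kappa> + 1) (of_real (1 - x\<^sup>2)) (a * of_real x + b))) (at x)"
proof -
  define p where "p = - (\<kappa> + 1) / 2"
  define U where "U = complex_of_real (1 - x\<^sup>2)"
  define c where "c = a * of_real x + b"
  define w where "w = c * U powr (- 1 / 2)"
  have x: "x\<^sup>2 < 1" using assms by (simp add: power_less_one_iff)
  have U: "U \<notin> \<real>\<^sub>\<le>\<^sub>0" "U \<noteq> 0" using x unfolding U_def by (auto simp: complex_nonpos_Reals_iff simp flip: of_real_power)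
  have U': "1 - (complex_of_real x)\<^sup>2 = U" by (simp add: U_def)
  have pw: "((\<lambda>z. (1 - z\<^sup>2) powr s) has_field_derivative (s * U powr (s - 1) * (- 2 * of_real x))) (at (of_real x))" for s
    unfolding U'[symmetric]
    by (rule DERIV_chain2[OF has_field_derivative_powr]) (use U in \<open>auto intro!: derivative_eq_intros simp: U'\<close>)
  have d: "((\<lambda>z. (1 - z\<^sup>2) powr p * pc_G \<kappa> ((a * z + b) * (1 - z\<^sup>2) powr (- 1 / 2))) has_field_derivative
     (p * U powr (p - 1) * (- 2 * of_real x)) * pc_G \<kappa> w +
     (- pc_G (\<kappa> + 1) w * (a * U powr (- 1 / 2) + (- 1 / 2 * U powr (- 1 / 2 - 1) * (- 2 * of_real x)) * c)) * U powr p) (at (of_real x))"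
    unfolding w_def c_def U'[symmetric]
    by (rule DERIV_mult[OF pw[unfolded U'[symmetric]] has_field_derivative_pc_G'[OF DERIV_mult[OF _ pw[unfolded U'[symmetric]]]]])
       (auto intro!: derivative_eq_intros)
  have "p - 1 = p + (- 1 / 2 + - 1 / 2)" "- 1 / 2 - 1 = - 1 / 2 + (- 1 / 2 + - 1 / 2 :: complex)" by simp_all
  hence e1: "U powr (p - 1) = U powr p * (U powr (- 1 / 2))\<^sup>2"
      "U powr (- 1 / 2 - 1) = U powr (- 1 / 2) * (U powr (- 1 / 2))\<^sup>2"
    by (simp_all only: powr_add power2_eq_square)
  have "- (\<kappa> + 2 + 1) / 2 = p + (- 1 / 2 + - 1 / 2)" "- (\<kappa> + 1 + 1) / 2 = p + - 1 / 2"
    by (simp_all add: p_def add_divide_distrib diff_divide_distrib)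
  hence e2: "U powr (- (\<kappa> + 2 + 1) / 2) = U powr p * (U powr (- 1 / 2))\<^sup>2"
     "U powr (- (\<kappa> + 1 + 1) / 2) = U powr p * U powr (- 1 / 2)"
    by (simp_all only: powr_add power2_eq_square)
  have G2: "pc_G (\<kappa> + 2) w = w * pc_G (\<kappa> + 1) w - (\<kappa> + 1) * pc_G \<kappa> w"
    using pc_G_rec[of "\<kappa> + 1" w] by (simp add: add.assoc)
  have "(p * U powr (p - 1) * (- 2 * of_real x)) * pc_G \<kappa> w +
     (- pc_G (\<kappa> + 1) w * (a * U powr (- 1 / 2) + (- 1 / 2 * U powr (- 1 / 2 - 1) * (- 2 * of_real x)) * c)) * U powr p
     = - (of_real x * pc_g (\<kappa> + 2) U c + a * pc_g (\<kappa> + 1) U c)"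
    unfolding e1 pc_g_def e2 w_def[symmetric] G2
    by (simp add: p_def w_def power2_eq_square algebra_simps)
  with d have "((\<lambda>z. (1 - z\<^sup>2) powr p * pc_G \<kappa> ((a * z + b) * (1 - z\<^sup>2) powr (- 1 / 2))) has_field_derivative
     - (of_real x * pc_g (\<kappa> + 2) U c + a * pc_g (\<kappa> + 1) U c)) (at (of_real x))" by simp
  from has_vector_derivative_real_field[OF this] show ?thesis
    unfolding pc_g_def[of \<kappa>] p_def U_def[symmetric] c_def[symmetric] by (simp add: U_def)
qed

section \<open>The integral \<open>pc_R\<close>: convergence, derivative in a, integration by
  parts\<close>

definition pc_R :: "complex \<Rightarrow> complex \<Rightarrow> complex \<Rightarrow> complex \<Rightarrow> complex" where
  "pc_R \<alpha> \<kappa> b a =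
     (LINT x:{0<..<1}|lborel. of_real x powr (\<alpha> - 1) * pc_g \<kappa> (of_real (1 - x\<^sup>2)) (a * of_real x + b))"

lemma unit_interval_square: "x \<in> {0<..<1::real} \<Longrightarrow> 1 - x\<^sup>2 \<in> {0<..1}"
  by (auto simp: power_less_one_iff)

lemma unit_powr_integrable:
  assumes "\<sigma> > 0"
  shows "set_integrable lborel {0<..<1} (\<lambda>x::real. x powr (\<sigma> - 1))"
proof -
  have "set_integrable lborel {0<..<1} (\<lambda>x::real. exp 1 * (x powr (\<sigma> - 1) * exp (- x)))"
    by (intro set_integrable_mult_right set_integrable_subset[OF Gamma_set_integrable_real[OF assms]]) auto
  thus ?thesis
  proof (rule set_integrable_bound)
    show "set_borel_measurable lborel {0<..<1} (\<lambda>x::real. x powr (\<sigma> - 1))"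
      by (intro set_borel_measurable_lborel_continuous continuous_intros) auto
    show "AE x in lborel. x \<in> {0<..<1} \<longrightarrow> norm (x powr (\<sigma> - 1)) \<le> norm (exp 1 * (x powr (\<sigma> - 1) * exp (- x)))"
    proof (intro AE_I2 impI)
      fix x :: real assume "x \<in> {0<..<1}"
      hence "1 \<le> exp (1 + - x)" by simp
      hence "x powr (\<sigma> - 1) * 1 \<le> x powr (\<sigma> - 1) * (exp 1 * exp (- x))"
        unfolding exp_add by (rule mult_left_mono) auto
      thus "norm (x powr (\<sigma> - 1)) \<le> norm (exp 1 * (x powr (\<sigma> - 1) * exp (- x)))"
        by (simp add: mult_ac)
    qed
  qed
qed

text \<open>Uniformity over the bounded part of the sector serves the differentiation under the
  integral; the factor 1 - x^2 serves the boundary term at x = 1.\<close>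

lemma pc_g_path_bound:
  assumes "b \<in> sector"
  obtains M where "M > 0"
    "\<And>x a. x \<in> {0<..<1} \<Longrightarrow> a \<in> sector \<Longrightarrow> norm a \<le> A \<Longrightarrow>
       norm (pc_g \<kappa> (of_real (1 - x\<^sup>2)) (a * of_real x + b)) \<le> M * (1 - x\<^sup>2)"
proof -
  obtain C N where C: "C > 0"
    "\<And>u c. u \<in> {0<..1} \<Longrightarrow> c \<in> sector \<Longrightarrow> Re (c\<^sup>2) \<ge> Re (b\<^sup>2) \<Longrightarrow>
       norm (pc_g \<kappa> (of_real u) c) \<le> C * u * (1 + norm c) ^ N * exp (- Re (c\<^sup>2) / 4)"
    using pc_g_bound[OF sector_Re_square_pos[OF assms]] by metis
  have "norm (pc_g \<kappa> (of_real (1 - x\<^sup>2)) (a * of_real x + b)) \<le> (C * (1 + (\<bar>A\<bar> + norm b)) ^ N) * (1 - x\<^sup>2)"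
    if x: "x \<in> {0<..<1}" and a: "a \<in> sector" "norm a \<le> A" for x a
  proof -
    let ?c = "a * of_real x + b"
    have u: "1 - x\<^sup>2 \<in> {0<..1}" using x by (rule unit_interval_square)
    have c: "?c \<in> sector" "Re (?c\<^sup>2) \<ge> Re (b\<^sup>2)"
      using sector_affine[OF a(1) assms, of x] x by auto
    have e: "exp (- Re (?c\<^sup>2) / 4) \<le> 1"
      using c sector_Re_square_pos[OF assms] by simp
    have "norm ?c \<le> norm a * x + norm b" using norm_triangle_ineq[of "a * of_real x" b] x by (simp add: norm_mult)
    also have "norm a * x \<le> \<bar>A\<bar> * 1" using x a by (intro mult_mono) auto
    finally have nc: "1 + norm ?c \<le> 1 + (\<bar>A\<bar> + norm b)" by simp
    have "norm (pc_g \<kappa> (of_real (1 - x\<^sup>2)) ?c) \<le> C * (1 - x\<^sup>2) * (1 + norm ?c) ^ N * exp (- Re (?c\<^sup>2) / 4)"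
      by (rule C(2)[OF u c])
    also have "\<dots> \<le> C * (1 - x\<^sup>2) * (1 + (\<bar>A\<bar> + norm b)) ^ N * 1"
      using C(1) u by (intro mult_mono[OF mult_left_mono[OF power_mono[OF nc]] e]) auto
    finally show ?thesis by (simp add: mult_ac)
  qed
  moreover have "C * (1 + (\<bar>A\<bar> + norm b)) ^ N > 0" using C(1) by (intro mult_pos_pos zero_less_power) (auto intro: add_pos_nonneg)
  ultimately show ?thesis using that by blast
qed

lemma continuous_on_pc_g_path:
  "continuous_on {0<..<1} (\<lambda>x. pc_g \<kappa> (of_real (1 - x\<^sup>2)) (a * of_real x + b))"
  by (intro continuous_at_imp_continuous_on ballI has_vector_derivative_continuous[OF has_vector_derivative_pc_g])

lemma continuous_on_pc_R_integrand:
  "continuous_on {0<..<1} (\<lambda>x. of_real x powr (\<alpha> - 1) * pc_g \<kappa> (of_real (1 - x\<^sup>2)) (a * of_real x + b))"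
  by (intro continuous_intros continuous_on_pc_g_path) (auto simp: complex_nonpos_Reals_iff)

lemma pc_R_integrable:
  assumes "Re \<alpha> > 0" "a \<in> sector" "b \<in> sector"
  shows "set_integrable lborel {0<..<1}
    (\<lambda>x. of_real x powr (\<alpha> - 1) * pc_g \<kappa> (of_real (1 - x\<^sup>2)) (a * of_real x + b))"
proof -
  obtain M where M: "M > 0" "\<And>x a'. x \<in> {0<..<1} \<Longrightarrow> a' \<in> sector \<Longrightarrow> norm a' \<le> norm a \<Longrightarrow>
       norm (pc_g \<kappa> (of_real (1 - x\<^sup>2)) (a' * of_real x + b)) \<le> M * (1 - x\<^sup>2)"
    using pc_g_path_bound[OF assms(3)] by metis
  have w: "set_integrable lborel {0<..<1} (\<lambda>x. M * x powr (Re \<alpha> - 1))"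
    using assms(1) by (intro set_integrable_mult_right unit_powr_integrable)
  show ?thesis
  proof (rule set_integrable_continuous_bound[OF w _ continuous_on_pc_R_integrand])
    fix x :: real assume x: "x \<in> {0<..<1}"
    have "norm (pc_g \<kappa> (of_real (1 - x\<^sup>2)) (a * of_real x + b)) \<le> M * (1 - x\<^sup>2)"
      by (rule M(2)[OF x assms(2)]) simp
    also have "\<dots> \<le> M * 1" using M(1) by (intro mult_left_mono) auto
    finally show "norm (of_real x powr (\<alpha> - 1) * pc_g \<kappa> (of_real (1 - x\<^sup>2)) (a * of_real x + b)) \<le> M * x powr (Re \<alpha> - 1)"
      using x mult_left_mono[of _ M "x powr (Re \<alpha> - 1)"] by (simp add: norm_mult norm_powr_real_powr mult_ac)
  qed auto
qed

lemma of_real_powr_Suc: "x > 0 \<Longrightarrow> complex_of_real x powr \<alpha> = of_real x * of_real x powr (\<alpha> - 1)"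
proof -
  assume "x > 0"
  have "complex_of_real x powr (1 + (\<alpha> - 1)) = of_real x * of_real x powr (\<alpha> - 1)"
    using \<open>x > 0\<close> by (simp only: powr_add) simp
  thus ?thesis by simp
qed

text \<open>A quadratic remainder estimate can be integrated over a parameter, so it allows
  differentiation under the integral without a separate exchange of limits.\<close>

lemma has_field_derivative_quadratic_bound:
  fixes f :: "complex \<Rightarrow> complex"
  assumes "\<delta> > 0" "\<And>z. z \<in> ball w \<delta> \<Longrightarrow> norm (f z - f w - D * (z - w)) \<le> K * (norm (z - w))\<^sup>2"
  shows "(f has_field_derivative D) (at w)"
  unfolding has_field_derivative_iff
proof (rule LIM_zero_cancel, rule Lim_null_comparison)
  show "\<forall>\<^sub>F z in at w. norm ((f z - f w) / (z - w) - D) \<le> K * norm (z - w)"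
    unfolding eventually_at
  proof (intro exI[of _ \<delta>] conjI ballI impI assms(1))
    fix z assume "z \<noteq> w \<and> dist z w < \<delta>"
    hence z: "z \<noteq> w" "z \<in> ball w \<delta>" by (auto simp: dist_commute)
    have "(f z - f w) / (z - w) - D = (f z - f w - D * (z - w)) / (z - w)" using z by (simp add: field_simps)
    also have "norm \<dots> \<le> K * (norm (z - w))\<^sup>2 / norm (z - w)"
      unfolding norm_divide using assms(2)[OF z(2)] by (rule divide_right_mono) auto
    also have "\<dots> = K * norm (z - w)" using z by (simp add: power2_eq_square)
    finally show "norm ((f z - f w) / (z - w) - D) \<le> K * norm (z - w)" .
  qed
  show "((\<lambda>z. K * norm (z - w)) \<longlongrightarrow> 0) (at w)"
    by (auto intro!: tendsto_eq_intros)
qed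

text \<open>Two derivatives in the first argument bring out
  \<open>x^2 * pc_g (\<kappa> + 2)\<close>, and x^2 <= 1. No factor 1/2 appears because the complex
  remainder bound divides only by \<open>fact 1\<close>.\<close>

lemma pc_g_taylor:
  assumes x: "x \<in> {0<..<1}" and S: "convex S" "w \<in> S" "z \<in> S"
    and M: "\<And>a. a \<in> S \<Longrightarrow> norm (pc_g (\<kappa> + 2) (of_real (1 - x\<^sup>2)) (a * of_real x + b)) \<le> M"
  shows "norm (pc_g \<kappa> (of_real (1 - x\<^sup>2)) (z * of_real x + b) - pc_g \<kappa> (of_real (1 - x\<^sup>2)) (w * of_real x + b)
      + of_real x * pc_g (\<kappa> + 1) (of_real (1 - x\<^sup>2)) (w * of_real x + b) * (z - w)) \<le> M * (norm (z - w))\<^sup>2"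
proof -
  define u where "u = complex_of_real (1 - x\<^sup>2)"
  have u: "u \<noteq> 0" using unit_interval_square[OF x] unfolding u_def of_real_eq_0_iff by auto
  have M0: "M \<ge> 0" using M[OF S(2)] norm_ge_zero order.trans by blast
  define f where "f i a = (- of_real x) ^ i * pc_g (\<kappa> + of_nat i) u (a * of_real x + b)" for i a
  have "norm (f 0 z - (\<Sum>i\<le>1. f i w * (z - w) ^ i / fact i)) \<le> M * norm (z - w) ^ Suc 1 / fact 1"
  proof (rule complex_Taylor[OF S(1) _ _ S(2,3)])
    fix i :: nat and a
    have "((\<lambda>a. pc_g (\<kappa> + of_nat i) u (a * of_real x + b)) has_field_derivative
       - pc_g (\<kappa> + of_nat i + 1) u (a * of_real x + b) * of_real x) (at a within S)"
      by (rule DERIV_chain2[OF has_field_derivative_pc_g[OF u]]) (auto intro!: derivative_eq_intros)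
    from DERIV_cmult[OF this, of "(- of_real x) ^ i"]
    show "(f i has_field_derivative f (Suc i) a) (at a within S)"
      unfolding f_def by (simp add: add_ac mult_ac)
  next
    fix a assume "a \<in> S"
    have "norm (f (Suc 1) a) = x\<^sup>2 * norm (pc_g (\<kappa> + 2) u (a * of_real x + b))"
      using x by (simp add: f_def norm_mult norm_power power2_eq_square)
    also have "\<dots> \<le> 1 * M"
      using x M[OF \<open>a \<in> S\<close>] M0 unfolding u_def by (intro mult_mono) (auto simp: power_le_one)
    finally show "norm (f (Suc 1) a) \<le> M" by simp
  qed
  thus ?thesis by (simp add: f_def u_def power2_eq_square algebra_simps)
qed

text \<open>Differentiating a x + b in \<open>a\<close> yields a factor x, which raises \<alpha> by
  one, while \<open>pc_g\<close> raises \<kappa>. The remainder of \<open>pc_g_taylor\<close>,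
  uniform in x, is integrated against the weight \<open>x powr (Re \<alpha> - 1)\<close> of total
  mass \<open>J\<close>.\<close>

lemma has_field_derivative_pc_R:
  assumes \<alpha>: "Re \<alpha> > 0" and a: "a \<in> sector" and b: "b \<in> sector"
  shows "(pc_R \<alpha> \<kappa> b has_field_derivative - pc_R (\<alpha> + 1) (\<kappa> + 1) b a) (at a)"
proof -
  obtain \<delta> where \<delta>: "\<delta> > 0" "ball a \<delta> \<subseteq> sector"
    using open_sector a open_contains_ball by blast
  obtain M where M: "M > 0" "\<And>x a'. x \<in> {0<..<1} \<Longrightarrow> a' \<in> sector \<Longrightarrow> norm a' \<le> norm a + \<delta> \<Longrightarrow>
       norm (pc_g (\<kappa> + 2) (of_real (1 - x\<^sup>2)) (a' * of_real x + b)) \<le> M * (1 - x\<^sup>2)"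
    using pc_g_path_bound[OF b] by metis
  have M': "norm (pc_g (\<kappa> + 2) (of_real (1 - x\<^sup>2)) (z * of_real x + b)) \<le> M" if "x \<in> {0<..<1}" "z \<in> ball a \<delta>" for x z
  proof -
    have "norm z \<le> norm a + \<delta>" using that(2) norm_triangle_ineq2[of z a] by (simp add: dist_norm norm_minus_commute)
    hence "norm (pc_g (\<kappa> + 2) (of_real (1 - x\<^sup>2)) (z * of_real x + b)) \<le> M * (1 - x\<^sup>2)"
      using that \<delta>(2) by (intro M(2)) auto
    also have "\<dots> \<le> M * 1" using M(1) by (intro mult_left_mono) auto
    finally show ?thesis by simp
  qed
  define J where "J = (LINT x:{0<..<1}|lborel. x powr (Re \<alpha> - 1))"
  let ?f = "\<lambda>\<alpha> \<kappa> a x. of_real x powr (\<alpha> - 1) * pc_g \<kappa> (of_real (1 - x\<^sup>2)) (a * of_real x + b)"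
  show ?thesis
  proof (rule has_field_derivative_quadratic_bound[OF \<delta>(1), where K = "M * J"])
    fix z assume z: "z \<in> ball a \<delta>"
    hence zs: "z \<in> sector" using \<delta>(2) by auto
    note I = pc_R_integrable[OF \<alpha> zs b, of \<kappa>] pc_R_integrable[OF \<alpha> a b, of \<kappa>]
    have I1: "set_integrable lborel {0<..<1} (?f (\<alpha> + 1) (\<kappa> + 1) a)"
      by (rule pc_R_integrable) (use \<alpha> a b in auto)
    have "pc_R \<alpha> \<kappa> b z - pc_R \<alpha> \<kappa> b a - (- pc_R (\<alpha> + 1) (\<kappa> + 1) b a) * (z - a)
       = (LINT x:{0<..<1}|lborel. ?f \<alpha> \<kappa> z x - ?f \<alpha> \<kappa> a x) + (LINT x:{0<..<1}|lborel. ?f (\<alpha> + 1) (\<kappa> + 1) a x * (z - a))"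
      unfolding pc_R_def set_integral_diff(2)[OF I] set_integral_mult_left by simp
    also have "\<dots> = (LINT x:{0<..<1}|lborel. (?f \<alpha> \<kappa> z x - ?f \<alpha> \<kappa> a x) + ?f (\<alpha> + 1) (\<kappa> + 1) a x * (z - a))"
      by (rule set_integral_add(2)[symmetric]) (intro set_integral_diff(1) I set_integrable_mult_left I1)+
    finally have eq: "pc_R \<alpha> \<kappa> b z - pc_R \<alpha> \<kappa> b a - (- pc_R (\<alpha> + 1) (\<kappa> + 1) b a) * (z - a) =
      (LINT x:{0<..<1}|lborel. (?f \<alpha> \<kappa> z x - ?f \<alpha> \<kappa> a x) + ?f (\<alpha> + 1) (\<kappa> + 1) a x * (z - a))" .
    have "norm (LINT x:{0<..<1}|lborel. (?f \<alpha> \<kappa> z x - ?f \<alpha> \<kappa> a x) + ?f (\<alpha> + 1) (\<kappa> + 1) a x * (z - a)) \<le> (LINT x:{0<..<1}|lborel. (M * (norm (z - a))\<^sup>2) * x powr (Re \<alpha> - 1))"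
    proof (rule norm_set_integral_le)
      show "set_integrable lborel {0<..<1} (\<lambda>x. (M * (norm (z - a))\<^sup>2) * x powr (Re \<alpha> - 1))"
        using \<alpha> by (intro set_integrable_mult_right unit_powr_integrable)
      show "continuous_on {0<..<1} (\<lambda>x. (?f \<alpha> \<kappa> z x - ?f \<alpha> \<kappa> a x) + ?f (\<alpha> + 1) (\<kappa> + 1) a x * (z - a))"
        by (intro continuous_on_add continuous_on_diff continuous_on_mult continuous_on_const continuous_on_pc_R_integrand
             continuous_on_pc_g_path)
           (auto intro!: continuous_intros simp: complex_nonpos_Reals_iff)
      fix x :: real assume x: "x \<in> {0<..<1}"
      have p: "complex_of_real x powr (\<alpha> + 1 - 1) = of_real x * of_real x powr (\<alpha> - 1)"
        using of_real_powr_Suc[of x \<alpha>] x by simp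
      have eqx: "(?f \<alpha> \<kappa> z x - ?f \<alpha> \<kappa> a x) + ?f (\<alpha> + 1) (\<kappa> + 1) a x * (z - a) = of_real x powr (\<alpha> - 1) *
        (pc_g \<kappa> (of_real (1 - x\<^sup>2)) (z * of_real x + b) - pc_g \<kappa> (of_real (1 - x\<^sup>2)) (a * of_real x + b)
      + of_real x * pc_g (\<kappa> + 1) (of_real (1 - x\<^sup>2)) (a * of_real x + b) * (z - a))"
        unfolding p by (simp only: ring_distribs mult_ac)
      have "norm ((?f \<alpha> \<kappa> z x - ?f \<alpha> \<kappa> a x) + ?f (\<alpha> + 1) (\<kappa> + 1) a x * (z - a)) \<le> x powr (Re \<alpha> - 1) * (M * (norm (z - a))\<^sup>2)"
        unfolding eqx norm_mult[of "of_real x powr (\<alpha> - 1)"]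
      proof (rule mult_mono)
        show "norm (pc_g \<kappa> (of_real (1 - x\<^sup>2)) (z * of_real x + b) - pc_g \<kappa> (of_real (1 - x\<^sup>2)) (a * of_real x + b)
      + of_real x * pc_g (\<kappa> + 1) (of_real (1 - x\<^sup>2)) (a * of_real x + b) * (z - a)) \<le> M * (norm (z - a))\<^sup>2"
          by (rule pc_g_taylor[OF x, of "ball a \<delta>"]) (use M' x z \<delta>(1) in auto)
      qed (use x in \<open>auto simp: norm_powr_real_powr\<close>)
      thus "norm ((?f \<alpha> \<kappa> z x - ?f \<alpha> \<kappa> a x) + ?f (\<alpha> + 1) (\<kappa> + 1) a x * (z - a))
        \<le> (M * (norm (z - a))\<^sup>2) * x powr (Re \<alpha> - 1)" by (simp only: mult.commute)
    qed auto
    also have "\<dots> = M * J * (norm (z - a))\<^sup>2" unfolding J_def set_integral_mult_right by (simp only: mult_ac)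
    finally show "norm (pc_R \<alpha> \<kappa> b z - pc_R \<alpha> \<kappa> b a - (- pc_R (\<alpha> + 1) (\<kappa> + 1) b a) * (z - a)) \<le> M * J * (norm (z - a))\<^sup>2"
      unfolding eq .
  qed
qed

text \<open>Integrate the x-derivative of \<open>F x\<close>, the product of
  \<open>x powr \<alpha>\<close> and \<open>pc_g \<kappa>\<close>, over the unit interval.
  \<open>F\<close> tends to 0 at x = 0 because Re \<alpha> > 0 and at x = 1 because of the factor 1
  - x^2 in the bound. Together with the derivative in \<open>a\<close> this is the differential
  equation of \<open>pc_R\<close>.\<close>

lemma pc_R_rec:
  assumes \<alpha>: "Re \<alpha> > 0" and a: "a \<in> sector" and b: "b \<in> sector"
  shows "pc_R (\<alpha> + 2) (\<kappa> + 2) b a + a * pc_R (\<alpha> + 1) (\<kappa> + 1) b a = \<alpha> * pc_R \<alpha> \<kappa> b a"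
proof -
  let ?g = "\<lambda>\<kappa> x. pc_g \<kappa> (of_real (1 - x\<^sup>2)) (a * of_real x + b)"
  let ?f = "\<lambda>\<alpha> \<kappa> x. of_real x powr (\<alpha> - 1) * ?g \<kappa> x"
  define F where "F x = of_real x powr \<alpha> * ?g \<kappa> x" for x
  define f where "f x = \<alpha> * ?f \<alpha> \<kappa> x - (?f (\<alpha> + 2) (\<kappa> + 2) x + a * ?f (\<alpha> + 1) (\<kappa> + 1) x)" for x
  have I: "set_integrable lborel {0<..<1} (?f \<alpha> \<kappa>)" "set_integrable lborel {0<..<1} (?f (\<alpha> + 1) (\<kappa> + 1))"
     "set_integrable lborel {0<..<1} (?f (\<alpha> + 2) (\<kappa> + 2))"
    by (rule pc_R_integrable; use \<alpha> a b in simp)+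
  note I2 = set_integral_add[OF I(3) set_integrable_mult_right[OF I(2), of a]]
  note I3 = set_integral_diff[OF set_integrable_mult_right[OF I(1), of \<alpha>] I2(1)]
  have F': "(F has_vector_derivative f x) (at x)" if x: "x \<in> {0<..<1}" for x
  proof -
    have "((\<lambda>z. z powr \<alpha>) has_field_derivative \<alpha> * of_real x powr (\<alpha> - 1)) (at (of_real x))"
      using x by (intro has_field_derivative_powr) (auto simp: complex_nonpos_Reals_iff)
    from has_vector_derivative_mult[OF has_vector_derivative_real_field[OF this] has_vector_derivative_pc_g[OF x]]
    have "(F has_vector_derivative of_real x powr \<alpha> * (- (of_real x * ?g (\<kappa> + 2) x + a * ?g (\<kappa> + 1) x)) 
       + \<alpha> * of_real x powr (\<alpha> - 1) * ?g \<kappa> x) (at x)"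
      unfolding F_def .
    moreover have "complex_of_real x powr (\<alpha> + 2 - 1) = of_real x * of_real x powr \<alpha>" 
      using of_real_powr_Suc[of x "\<alpha> + 1"] x by (simp add: add.commute)
    ultimately show ?thesis unfolding f_def by (simp add: algebra_simps)
  qed
  obtain M where M: "M > 0" "\<And>x a'. x \<in> {0<..<1} \<Longrightarrow> a' \<in> sector \<Longrightarrow> norm a' \<le> norm a \<Longrightarrow>
       norm (pc_g \<kappa> (of_real (1 - x\<^sup>2)) (a' * of_real x + b)) \<le> M * (1 - x\<^sup>2)"
    using pc_g_path_bound[OF b] by metis
  have nF: "norm (F x) \<le> x powr Re \<alpha> * (M * (1 - x\<^sup>2))" if "x \<in> {0<..<1}" for x
    unfolding F_def norm_mult using that a M(2)[of x a] by (intro mult_mono) (auto simp: norm_powr_real_powr)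
  have lim: "(F \<longlongrightarrow> 0) (at_right 0)" "(F \<longlongrightarrow> 0) (at_left 1)"
  proof -
    have "((\<lambda>x::real. x powr Re \<alpha> * (M * (1 - x\<^sup>2))) \<longlongrightarrow> 0 powr Re \<alpha> * (M * (1 - 0\<^sup>2))) (at_right 0)"
      using \<alpha> by (intro tendsto_intros) (auto simp: eventually_at_filter)
    hence l: "((\<lambda>x::real. x powr Re \<alpha> * (M * (1 - x\<^sup>2))) \<longlongrightarrow> 0) (at_right 0)" by simp
    show "(F \<longlongrightarrow> 0) (at_right 0)"
      by (rule Lim_null_comparison[OF eventually_mono[OF eventually_at_right_real[of 0 1] nF] l]) auto
    have "((\<lambda>x::real. x powr Re \<alpha> * (M * (1 - x\<^sup>2))) \<longlongrightarrow> 1 powr Re \<alpha> * (M * (1 - 1\<^sup>2))) (at_left 1)"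
      by (intro tendsto_intros) auto
    hence l: "((\<lambda>x::real. x powr Re \<alpha> * (M * (1 - x\<^sup>2))) \<longlongrightarrow> 0) (at_left 1)" by simp
    show "(F \<longlongrightarrow> 0) (at_left 1)"
      by (rule Lim_null_comparison[OF eventually_mono[OF eventually_at_left_real[of 0 1] nF] l]) auto
  qed
  have "continuous_on {0<..<1} f" unfolding f_def
    by (intro continuous_on_add continuous_on_diff continuous_on_mult continuous_on_const continuous_on_pc_R_integrand
         continuous_on_pc_g_path) (auto intro!: continuous_intros simp: complex_nonpos_Reals_iff)
  hence cf: "isCont f x" if "x \<in> {0<..<1}" for x
    using that continuous_on_eq_continuous_at[of "{0<..<1}" f] by auto
  have "(LBINT x=ereal 0..ereal 1. f x) = 0 - 0"
  proof (rule interval_integral_FTC_integrable[where F = F])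
    show "set_integrable lborel (einterval (ereal 0) (ereal 1)) f"
      using I3(1) unfolding f_def by simp
    show "((F \<circ> real_of_ereal) \<longlongrightarrow> 0) (at_right (ereal 0))" "((F \<circ> real_of_ereal) \<longlongrightarrow> 0) (at_left (ereal 1))"
      unfolding ereal_tendsto_simps using lim by auto
  qed (use F' cf in auto)
  hence "(LINT x:{0<..<1}|lborel. f x) = 0"
    by (simp add: interval_lebesgue_integral_def)
  thus ?thesis unfolding f_def I3(2) I2(2) pc_R_def by (simp add: algebra_simps)
qed

section \<open>The Wronskian argument\<close>

text \<open>The factor Gamma(\<alpha>) removes all coefficients from the derivative and gives
  \<open>pc_H\<close> the same two index shifts as \<open>pc_R\<close>.\<close>

definition pc_H :: "complex \<Rightarrow> complex \<Rightarrow> complex" where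
  "pc_H \<alpha> a = Gamma \<alpha> * pc_h (- \<alpha>) a"

lemma Gamma_Suc_pos: "Re \<alpha> > 0 \<Longrightarrow> Gamma (\<alpha> + 1) = \<alpha> * Gamma (\<alpha> :: complex)"
  by (intro Gamma_plus1) (auto elim!: nonpos_Ints_cases)

lemma has_field_derivative_pc_H:
  assumes "Re \<alpha> > 0"
  shows "(pc_H \<alpha> has_field_derivative - pc_H (\<alpha> + 1) a) (at a)"
proof -
  have "- \<alpha> - 1 = - (\<alpha> + 1)" by simp
  thus ?thesis
    using DERIV_cmult[OF has_field_derivative_pc_h[of "- \<alpha>" a], of "Gamma \<alpha>"]
    unfolding pc_H_def[abs_def] Gamma_Suc_pos[OF assms] by (simp only: mult_ac minus_mult_left minus_mult_right)
qed

lemma pc_H_rec: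
  assumes "Re \<alpha> > 0"
  shows "pc_H (\<alpha> + 2) a + a * pc_H (\<alpha> + 1) a = \<alpha> * pc_H \<alpha> a"
proof -
  have "Gamma (\<alpha> + 2) = (\<alpha> + 1) * (\<alpha> * Gamma \<alpha>)"
    using Gamma_Suc_pos[of "\<alpha> + 1"] Gamma_Suc_pos[OF assms] assms by (simp add: add.assoc)
  moreover have "pc_h (- \<alpha>) a = a * pc_h (- (\<alpha> + 1)) a + (\<alpha> + 1) * pc_h (- (\<alpha> + 2)) a"
  proof -
    have "- \<alpha> = - (\<alpha> + 1) + 1" "- (\<alpha> + 2) = - (\<alpha> + 1) - 1" by simp_all
    thus ?thesis using pc_h_rec[of "- (\<alpha> + 1)" a] by (metis diff_minus_eq_add mult_minus_left)
  qed
  ultimately show ?thesis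
    unfolding pc_H_def Gamma_Suc_pos[OF assms] by (simp only:) (simp add: algebra_simps)
qed

section \<open>Asymptotics along the positive integers\<close>

lemma lborel_integral_scale:
  fixes f :: "real \<Rightarrow> complex"
  assumes "t > 0"
  shows "(LINT s|lborel. f s) = (LINT y|lborel. f (y / t)) / of_real t"
  using lborel_integral_real_affine[of "1 / t" f 0] assms
  by (simp add: scaleR_conv_of_real field_simps)

lemma powr_scale:
  assumes "t > 0" "y > 0"
  shows "of_real t powr \<alpha> * complex_of_real (y / t) powr (\<alpha> - 1) / of_real t = of_real y powr (\<alpha> - 1)"
proof -
  have "complex_of_real t powr (\<alpha> - 1) * of_real (y / t) powr (\<alpha> - 1) = of_real (t * (y / t)) powr (\<alpha> - 1)"
    unfolding of_real_mult by (rule powr_times_real[symmetric]) (use assms in auto)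
  moreover have "of_real t powr \<alpha> = of_real t * complex_of_real t powr (\<alpha> - 1)"
    using of_real_powr_Suc[OF assms(1)] .
  ultimately show ?thesis using assms by (simp add: field_simps del: of_real_divide)
qed

text \<open>Substituting s = y / t cancels the power of t and leaves the exponent - y - (y / t)^2 /
  2, so the Gamma integrand is both the limit and a majorant. The values t = n + 1 avoid t =
  0.\<close>

lemma pc_H_limit:
  assumes "Re \<alpha> > 0"
  shows "(\<lambda>n. of_real (real (Suc n)) powr \<alpha> * pc_H \<alpha> (of_real (real (Suc n)))) \<longlonglongrightarrow> Gamma \<alpha>"
proof -
  let ?f = "\<lambda>t s. complex_of_real s powr (\<alpha> - 1) * exp (- of_real t * of_real s - (of_real s)\<^sup>2 / 2)"
  let ?g = "\<lambda>n y. complex_of_real y powr (\<alpha> - 1) * exp (- of_real y - (of_real (y / real (Suc n)))\<^sup>2 / 2)"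
  have eq: "of_real t powr \<alpha> * pc_H \<alpha> (of_real t) = (LINT y:{0<..}|lborel. ?g n y)"
    if t: "t = real (Suc n)" for n t
  proof -
    have t0: "t > 0" using t by simp
    have "of_real t powr \<alpha> * pc_H \<alpha> (of_real t) = of_real t powr \<alpha> * (LINT s:{0<..}|lborel. ?f t s)"
      unfolding pc_H_def pc_h_integral(2)[OF assms] ..
    also have "\<dots> = of_real t powr \<alpha> / of_real t * (LINT y|lborel. indicator {0<..} (y / t) *\<^sub>R ?f t (y / t))"
      unfolding set_lebesgue_integral_def by (subst lborel_integral_scale[OF t0]) simp
    also have "\<dots> = (LINT y|lborel. of_real t powr \<alpha> / of_real t * (indicator {0<..} (y / t) *\<^sub>R ?f t (y / t)))"
      by (rule integral_mult_right_zero[symmetric])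
    also have "\<dots> = (LINT y:{0<..}|lborel. ?g n y)"
      unfolding set_lebesgue_integral_def
    proof (rule Bochner_Integration.integral_cong[OF refl])
      fix y :: real
      show "of_real t powr \<alpha> / of_real t * (indicator {0<..} (y / t) *\<^sub>R ?f t (y / t)) = indicator {0<..} y *\<^sub>R ?g n y"
      proof (cases "y > 0")
        case True
        have "of_real t powr \<alpha> / of_real t * ?f t (y / t) = 
            (of_real t powr \<alpha> * complex_of_real (y / t) powr (\<alpha> - 1) / of_real t) * exp (- of_real t * of_real (y / t) - (of_real (y / t))\<^sup>2 / 2)"
          by simp
        also have "\<dots> = ?g n y"
        proof -
          have "- of_real t * of_real (y / t) = - complex_of_real y" using t0 by simp
          thus ?thesis unfolding powr_scale[OF t0 True] t[symmetric] by (simp only:)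
        qed
        finally show ?thesis using True t0 by simp
      next
        case False
        thus ?thesis using t0 by (simp add: zero_less_divide_iff)
      qed
    qed
    finally show ?thesis .
  qed
  have "(\<lambda>n. LINT y:{0<..}|lborel. ?g n y) \<longlonglongrightarrow> (LINT y:{0<..}|lborel. complex_of_real y powr (\<alpha> - 1) * exp (- of_real y))"
  proof (rule set_integral_dominated_convergence)
    show "set_integrable lborel {0<..} (\<lambda>y. y powr (Re \<alpha> - 1) * exp (- y))"
      by (rule Gamma_set_integrable_real[OF assms])
    show "continuous_on {0<..} (?g n)" for n
      by (intro continuous_intros) (auto simp: complex_nonpos_Reals_iff)
    show "continuous_on {0<..} (\<lambda>y. complex_of_real y powr (\<alpha> - 1) * exp (- of_real y))"
      by (intro continuous_intros) (auto simp: complex_nonpos_Reals_iff)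
    fix y :: real assume y: "y \<in> {0<..}"
    show "norm (?g n y) \<le> y powr (Re \<alpha> - 1) * exp (- y)" for n
    proof -
      have "norm (exp (- of_real y - (complex_of_real (y / real (Suc n)))\<^sup>2 / 2)) \<le> exp (- y)"
        unfolding norm_exp_eq_Re by (simp flip: of_real_power)
      thus ?thesis using y unfolding norm_mult by (intro mult_mono) (auto simp: norm_powr_real_powr)
    qed
    have "(\<lambda>n. y / real (Suc n)) \<longlonglongrightarrow> 0"
      by (intro tendsto_divide_0[OF tendsto_const] filterlim_compose[OF filterlim_at_top_imp_at_infinity[OF filterlim_real_sequentially] filterlim_Suc])
    hence l: "(\<lambda>n. complex_of_real (y / real (Suc n))) \<longlonglongrightarrow> of_real 0"
      by (rule tendsto_of_real)
    have "(\<lambda>n. ?g n y) \<longlonglongrightarrow> complex_of_real y powr (\<alpha> - 1) * exp (- of_real y - (of_real 0)\<^sup>2 / 2)"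
      by (intro l tendsto_intros) auto
    thus "(\<lambda>n. ?g n y) \<longlonglongrightarrow> complex_of_real y powr (\<alpha> - 1) * exp (- of_real y)" by simp
  qed auto
  thus ?thesis unfolding eq[OF refl] Gamma_set_integral(2)[OF assms] .
qed

lemma pc_g_tendsto:
  assumes "(\<lambda>n. u n) \<longlonglongrightarrow> (1::real)"
  shows "(\<lambda>n. pc_g \<kappa> (of_real (u n)) c) \<longlonglongrightarrow> pc_G \<kappa> c"
proof -
  have "continuous_on {u. Re u > 0} (\<lambda>u. pc_g \<kappa> u c)"
    unfolding pc_g_def by (intro continuous_intros) (auto simp: complex_nonpos_Reals_iff)
  hence "isCont (\<lambda>u. pc_g \<kappa> u c) 1"
    using open_halfspace_Re_gt[of 0] by (simp add: continuous_on_eq_continuous_at)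
  moreover have "(\<lambda>n. complex_of_real (u n)) \<longlonglongrightarrow> 1"
    using tendsto_of_real[OF assms] by simp
  ultimately have "(\<lambda>n. pc_g \<kappa> (of_real (u n)) c) \<longlonglongrightarrow> pc_g \<kappa> 1 c"
    by (rule isCont_tendsto_compose)
  thus ?thesis by (simp add: pc_g_def)
qed

text \<open>With x = y / t the point a x + b becomes y + b, and u = 1 - (y / t)^2 tends to 1, where
  \<open>pc_g \<kappa>\<close> equals \<open>pc_G \<kappa>\<close>. The limit is thus the Weyl
  integral evaluated by \<open>pc_G_weyl\<close>.\<close>

lemma pc_R_limit:
  assumes \<alpha>: "Re \<alpha> > 0" and b: "b \<in> sector"
  shows "(\<lambda>n. of_real (real (Suc n)) powr \<alpha> * pc_R \<alpha> \<kappa> b (of_real (real (Suc n)))) \<longlonglongrightarrow> Gamma \<alpha> * pc_G (\<kappa> - \<alpha>) b"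
proof -
  let ?f = "\<lambda>t x. complex_of_real x powr (\<alpha> - 1) * pc_g \<kappa> (of_real (1 - x\<^sup>2)) (of_real t * of_real x + b)"
  let ?h = "\<lambda>t y. complex_of_real y powr (\<alpha> - 1) * pc_g \<kappa> (of_real (1 - (y / t)\<^sup>2)) (of_real y + b)"
  \<comment> \<open>The interval 0 < y < n + 1 grows with n, so its indicator is made part of the
    integrand; dominated convergence is applied on the whole line.\<close>
  let ?g = "\<lambda>n y. indicator {0<..<real (Suc n)} y *\<^sub>R ?h (real (Suc n)) y"
  have eq: "of_real t powr \<alpha> * pc_R \<alpha> \<kappa> b (of_real t) = (LINT y|lborel. ?g n y)"
    if t: "t = real (Suc n)" for n t
  proof -
    have t0: "t > 0" using t by simp
    have "of_real t powr \<alpha> * pc_R \<alpha> \<kappa> b (of_real t) = of_real t powr \<alpha> / of_real t * (LINT y|lborel. indicator {0<..<1} (y / t) *\<^sub>R ?f t (y / t))"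
      unfolding pc_R_def set_lebesgue_integral_def by (subst lborel_integral_scale[OF t0]) simp
    also have "\<dots> = (LINT y|lborel. of_real t powr \<alpha> / of_real t * (indicator {0<..<1} (y / t) *\<^sub>R ?f t (y / t)))"
      by (rule integral_mult_right_zero[symmetric])
    also have "\<dots> = (LINT y|lborel. ?g n y)"
    proof (rule Bochner_Integration.integral_cong[OF refl])
      fix y :: real
      show "of_real t powr \<alpha> / of_real t * (indicator {0<..<1} (y / t) *\<^sub>R ?f t (y / t)) = ?g n y"
      proof (cases "0 < y \<and> y < t")
        case True
        have "of_real t powr \<alpha> / of_real t * ?f t (y / t) = 
            (of_real t powr \<alpha> * complex_of_real (y / t) powr (\<alpha> - 1) / of_real t) * pc_g \<kappa> (of_real (1 - (y / t)\<^sup>2)) (of_real t * of_real (y / t) + b)"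
          by simp
        also have "\<dots> = ?h t y" using True t0 by (subst powr_scale) auto
        finally show ?thesis using True t0 unfolding t[symmetric] by simp
      next
        case False
        hence "y / t \<notin> {0<..<1}" using t0 by (auto simp: zero_less_divide_iff)
        thus ?thesis using False unfolding t[symmetric] by auto
      qed
    qed
    finally show ?thesis .
  qed
  obtain C N where C: "C > 0"
    "\<And>u c. u \<in> {0<..1} \<Longrightarrow> c \<in> sector \<Longrightarrow> Re (c\<^sup>2) \<ge> Re (b\<^sup>2) \<Longrightarrow>
       norm (pc_g \<kappa> (of_real u) c) \<le> C * u * (1 + norm c) ^ N * exp (- Re (c\<^sup>2) / 4)"
    using pc_g_bound[OF sector_Re_square_pos[OF b]] by metis
  define K where "K = C * (1 + norm b) ^ N"
  \<comment> \<open>The bound of \<open>pc_g_bound\<close> is uniform in u <= 1, hence in t. The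
    terms of Re ((y + b)^2) other than y^2 are positive and are dropped from the Gaussian.\<close>
  let ?w = "\<lambda>y::real. K * (y powr (Re \<alpha> - 1) * ((1 + y) ^ N * exp (0 * y - (1/4) * y\<^sup>2)))"
  have w: "set_integrable lborel {0<..} ?w"
    by (intro set_integrable_mult_right set_integrable_power_gauss) (use \<alpha> in auto)
  have bound: "norm (?h t y) \<le> ?w y" if y: "0 < y" "y < t" for y t
  proof -
    define u where "u = 1 - (y / t)\<^sup>2"
    have u: "u \<in> {0<..1}" unfolding u_def using y by (intro unit_interval_square) auto
    have c: "of_real y + b \<in> sector" "Re ((of_real y + b)\<^sup>2) \<ge> Re (b\<^sup>2)"
      using sector_affine[OF sector_of_real[of 1] b y(1)] by auto
    have "Re ((of_real y + b)\<^sup>2) = y\<^sup>2 + 2 * y * Re b + Re (b\<^sup>2)"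
      by (simp add: power2_eq_square algebra_simps)
    hence e: "exp (- Re ((of_real y + b)\<^sup>2) / 4) \<le> exp (0 * y - (1/4) * y\<^sup>2)"
      using mult_pos_pos[OF y(1) sector_Re_pos[OF b]] sector_Re_square_pos[OF b] by simp
    have "norm (of_real y + b) \<le> y + norm b" using norm_triangle_ineq[of "of_real y" b] y by simp
    also have "1 + (y + norm b) \<le> (1 + norm b) * (1 + y)" using y by (simp add: algebra_simps)
    finally have n: "(1 + norm (of_real y + b)) ^ N \<le> ((1 + norm b) * (1 + y)) ^ N"
      by (intro power_mono) auto
    have "norm (pc_g \<kappa> (of_real u) (of_real y + b)) \<le> C * u * (1 + norm (of_real y + b)) ^ N * exp (- Re ((of_real y + b)\<^sup>2) / 4)"
      by (rule C(2)[OF u c])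
    also have "\<dots> \<le> C * 1 * ((1 + norm b) * (1 + y)) ^ N * exp (0 * y - (1/4) * y\<^sup>2)"
      using C(1) y u by (intro mult_mono n e order_refl) auto
    also have "\<dots> = K * ((1 + y) ^ N * exp (0 * y - (1/4) * y\<^sup>2))"
      unfolding power_mult_distrib K_def by simp
    finally have "y powr (Re \<alpha> - 1) * norm (pc_g \<kappa> (of_real u) (of_real y + b)) \<le> y powr (Re \<alpha> - 1) * (K * ((1 + y) ^ N * exp (0 * y - (1/4) * y\<^sup>2)))"
      by (intro mult_left_mono) auto
    thus ?thesis using y by (simp add: norm_mult norm_powr_real_powr mult_ac u_def)
  qed
  have "(\<lambda>n. LINT y|lborel. ?g n y) \<longlonglongrightarrow> (LINT y|lborel. indicator {0<..} y *\<^sub>R (of_real y powr (\<alpha> - 1) * pc_G \<kappa> (of_real y + b)))"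
  proof (rule integral_dominated_convergence)
    show "integrable lborel (\<lambda>y. indicator {0<..} y *\<^sub>R ?w y)"
      using w by (simp add: set_integrable_def)
    have "continuous_on {0<..} (\<lambda>y. complex_of_real y powr (\<alpha> - 1) * pc_G \<kappa> (of_real y + b))"
      by (intro continuous_intros) (auto simp: complex_nonpos_Reals_iff)
    thus "(\<lambda>y. indicator {0<..} y *\<^sub>R (complex_of_real y powr (\<alpha> - 1) * pc_G \<kappa> (of_real y + b))) \<in> borel_measurable lborel"
      by (auto intro!: borel_measurable_continuous_on_indicator)
    show "?g n \<in> borel_measurable lborel" for n
    proof -
      define t where "t = real (Suc n)"
      have t: "t > 0" by (simp add: t_def)
      have np: "complex_of_real (1 - (y / t)\<^sup>2) \<notin> \<real>\<^sub>\<le>\<^sub>0" if "y \<in> {0<..<t}" for y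
        using unit_interval_square[of "y / t"] that t unfolding nonpos_Reals_of_real_iff by auto
      have np': "complex_of_real y \<notin> \<real>\<^sub>\<le>\<^sub>0" if "y \<in> {0<..<t}" for y
        using that unfolding nonpos_Reals_of_real_iff by auto
      have cp: "continuous_on (- \<real>\<^sub>\<le>\<^sub>0) (\<lambda>u::complex. u powr p)" for p
        by (intro continuous_at_imp_continuous_on ballI DERIV_isCont[OF has_field_derivative_powr]) auto
      have cu: "continuous_on {0<..<t} (\<lambda>y. complex_of_real (1 - (y / t)\<^sup>2))"
        by (intro continuous_intros) (use t in auto)
      have pu: "continuous_on {0<..<t} (\<lambda>y. complex_of_real (1 - (y / t)\<^sup>2) powr p)" for p
        by (rule continuous_on_compose2[OF cp cu]) (use np in blast)
      have cy: "continuous_on {0<..<t} complex_of_real" by (intro continuous_intros)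
      have py: "continuous_on {0<..<t} (\<lambda>y. complex_of_real y powr p)" for p
        by (rule continuous_on_compose2[OF cp cy]) (use np' in blast)
      have "continuous_on {0<..<t} (?h t)"
        unfolding pc_g_def by (intro continuous_on_mult continuous_on_pc_G pu py continuous_on_add continuous_on_const cy)
      hence "continuous_on {0<..<real (Suc n)} (?h (real (Suc n)))" unfolding t_def .
      thus ?thesis by (auto intro!: borel_measurable_continuous_on_indicator)
    qed
    show "AE y in lborel. norm (?g n y) \<le> indicator {0<..} y *\<^sub>R ?w y" for n
    proof (intro AE_I2)
      fix y :: real
      show "norm (?g n y) \<le> indicator {0<..} y *\<^sub>R ?w y"
      proof (cases "0 < y \<and> y < real (Suc n)")
        case True
        thus ?thesis using bound[of y "real (Suc n)"] by simp
      next
        case False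
        hence "norm (?g n y) = 0" by auto
        also have "0 \<le> indicator {0<..} y *\<^sub>R ?w y"
          using C(1) by (auto simp: indicator_def K_def)
        finally show ?thesis .
      qed
    qed
    show "AE y in lborel. (\<lambda>n. ?g n y) \<longlonglongrightarrow> indicator {0<..} y *\<^sub>R (of_real y powr (\<alpha> - 1) * pc_G \<kappa> (of_real y + b))"
    proof (intro AE_I2)
      fix y :: real
      show "(\<lambda>n. ?g n y) \<longlonglongrightarrow> indicator {0<..} y *\<^sub>R (of_real y powr (\<alpha> - 1) * pc_G \<kappa> (of_real y + b))"
      proof (cases "y > 0")
        case True
        have "(\<lambda>n. y / real (Suc n)) \<longlonglongrightarrow> 0"
          by (intro tendsto_divide_0[OF tendsto_const] filterlim_compose[OF filterlim_at_top_imp_at_infinity[OF filterlim_real_sequentially] filterlim_Suc])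
        hence "(\<lambda>n. 1 - (y / real (Suc n))\<^sup>2) \<longlonglongrightarrow> 1 - 0\<^sup>2" by (intro tendsto_intros)
        hence l: "(\<lambda>n. ?h (real (Suc n)) y) \<longlonglongrightarrow> of_real y powr (\<alpha> - 1) * pc_G \<kappa> (of_real y + b)"
          by (intro tendsto_intros pc_g_tendsto) simp
        have "\<forall>\<^sub>F n in sequentially. y < real (Suc n)"
          using filterlim_compose[OF filterlim_real_sequentially filterlim_Suc] unfolding filterlim_at_top_dense by blast
        hence "\<forall>\<^sub>F n in sequentially. ?g n y = ?h (real (Suc n)) y"
          by eventually_elim (use True in simp)
        with l show ?thesis using True by (subst tendsto_cong) auto
      qed auto
    qed
  qed
  hence "(\<lambda>n. LINT y|lborel. ?g n y) \<longlonglongrightarrow> (LINT y:{0<..}|lborel. of_real y powr (\<alpha> - 1) * pc_G \<kappa> (of_real y + b))"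
    unfolding set_lebesgue_integral_def .
  thus ?thesis unfolding eq[OF refl] using pc_G_weyl[OF \<alpha>, of b \<kappa>] sector_Re_pos[OF b] by simp
qed

lemma pc_wronskian_zero:
  assumes \<alpha>: "Re \<alpha> > 0" and a: "a \<in> sector" and b: "b \<in> sector"
  shows "pc_R (\<alpha> + 1) (\<kappa> + 1) b a * pc_H \<alpha> a = pc_R \<alpha> \<kappa> b a * pc_H (\<alpha> + 1) a"
proof -
  have \<alpha>1: "Re (\<alpha> + 1) > 0" using \<alpha> by simp
  \<comment> \<open>This is the Wronskian \<open>R * H' - R' * H\<close>, with derivatives expressed
    through the index shifts.\<close>
  define W where "W a = pc_R (\<alpha> + 1) (\<kappa> + 1) b a * pc_H \<alpha> a - pc_R \<alpha> \<kappa> b a * pc_H (\<alpha> + 1) a" for a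
  have W': "((\<lambda>a. W a * exp (- a\<^sup>2 / 2)) has_field_derivative 0) (at a within sector)" if a: "a \<in> sector" for a
  proof -
    have r: "\<alpha> + 1 + 1 = \<alpha> + 2" "\<kappa> + 1 + 1 = \<kappa> + 2" by simp_all
    have "(W has_field_derivative
       ((- pc_R (\<alpha> + 2) (\<kappa> + 2) b a) * pc_H \<alpha> a + (- pc_H (\<alpha> + 1) a) * pc_R (\<alpha> + 1) (\<kappa> + 1) b a)
       - ((- pc_R (\<alpha> + 1) (\<kappa> + 1) b a) * pc_H (\<alpha> + 1) a + (- pc_H (\<alpha> + 2) a) * pc_R \<alpha> \<kappa> b a)) (at a)"
      unfolding W_def
      using has_field_derivative_pc_R[OF \<alpha>1 a b, of "\<kappa> + 1"] has_field_derivative_pc_R[OF \<alpha> a b, of \<kappa>]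
        has_field_derivative_pc_H[OF \<alpha>, of a] has_field_derivative_pc_H[OF \<alpha>1, of a]
      unfolding r by (intro DERIV_diff DERIV_mult)
    moreover have "((- pc_R (\<alpha> + 2) (\<kappa> + 2) b a) * pc_H \<alpha> a + (- pc_H (\<alpha> + 1) a) * pc_R (\<alpha> + 1) (\<kappa> + 1) b a)
       - ((- pc_R (\<alpha> + 1) (\<kappa> + 1) b a) * pc_H (\<alpha> + 1) a + (- pc_H (\<alpha> + 2) a) * pc_R \<alpha> \<kappa> b a) = a * W a"
    \<comment> \<open>The common recurrence replaces the functions of index \<alpha> + 2; the
      products with coefficient \<alpha> cancel, which leaves a multiple of
      \<open>W\<close>.\<close>
    proof -
      have 1: "pc_R (\<alpha> + 2) (\<kappa> + 2) b a = \<alpha> * pc_R \<alpha> \<kappa> b a - a * pc_R (\<alpha> + 1) (\<kappa> + 1) b a"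
        using pc_R_rec[OF \<alpha> a b, of \<kappa>] by (simp add: algebra_simps)
      have 2: "pc_H (\<alpha> + 2) a = \<alpha> * pc_H \<alpha> a - a * pc_H (\<alpha> + 1) a"
        using pc_H_rec[OF \<alpha>, of a] by (simp add: algebra_simps)
      show ?thesis unfolding 1 2 W_def by (simp add: algebra_simps)
    qed
    ultimately have "(W has_field_derivative a * W a) (at a)" by simp
    moreover have "((\<lambda>a. exp (- a\<^sup>2 / 2)) has_field_derivative (exp (- a\<^sup>2 / 2) * (- a))) (at a)"
      by (auto intro!: derivative_eq_intros)
    ultimately have "((\<lambda>a. W a * exp (- a\<^sup>2 / 2)) has_field_derivative
       (a * W a) * exp (- a\<^sup>2 / 2) + (exp (- a\<^sup>2 / 2) * (- a)) * W a) (at a)"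
      by (rule DERIV_mult)
    moreover have "(a * W a) * exp (- a\<^sup>2 / 2) + (exp (- a\<^sup>2 / 2) * (- a)) * W a = 0" by simp
    ultimately show ?thesis by (simp add: has_field_derivative_at_within)
  qed
  then obtain c where c: "\<And>a. a \<in> sector \<Longrightarrow> W a * exp (- a\<^sup>2 / 2) = c"
    using has_field_derivative_zero_constant[OF convex_sector, of "\<lambda>a. W a * exp (- a\<^sup>2 / 2)"] by blast
  \<comment> \<open>Both products in \<open>W\<close> have the total order t^(- 2 \<alpha> - 1), so
    \<open>W\<close> scaled by that power converges along these t. The inverse power times
    \<open>exp (- t^2 / 2)\<close> tends to 0, which forces the constant to be 0.\<close>
  let ?t = "\<lambda>n. complex_of_real (real (Suc n))"
  have "(\<lambda>n. (?t n powr (\<alpha> + 1) * pc_R (\<alpha> + 1) (\<kappa> + 1) b (?t n)) * (?t n powr \<alpha> * pc_H \<alpha> (?t n))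
     - (?t n powr \<alpha> * pc_R \<alpha> \<kappa> b (?t n)) * (?t n powr (\<alpha> + 1) * pc_H (\<alpha> + 1) (?t n))) \<longlonglongrightarrow> 
     Gamma (\<alpha> + 1) * pc_G (\<kappa> + 1 - (\<alpha> + 1)) b * Gamma \<alpha> - Gamma \<alpha> * pc_G (\<kappa> - \<alpha>) b * Gamma (\<alpha> + 1)"
    by (rule tendsto_diff[OF tendsto_mult[OF pc_R_limit[OF \<alpha>1 b] pc_H_limit[OF \<alpha>]]
          tendsto_mult[OF pc_R_limit[OF \<alpha> b] pc_H_limit[OF \<alpha>1]]])
  moreover have "(\<lambda>n. 1 / (?t n powr (\<alpha> + 1) * ?t n powr \<alpha>) * exp (- (?t n)\<^sup>2 / 2)) \<longlonglongrightarrow> 0"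
  proof (rule Lim_null_comparison)
    show "\<forall>\<^sub>F n in sequentially. norm (1 / (?t n powr (\<alpha> + 1) * ?t n powr \<alpha>) * exp (- (?t n)\<^sup>2 / 2)) \<le> exp (- real n / 2)"
    proof (intro always_eventually allI)
      fix n
      define t where "t = real (Suc n)"
      have t: "t \<ge> 1" "t \<ge> real n" by (auto simp: t_def)
      have "1 \<le> t powr (Re \<alpha> + 1)" "1 \<le> t powr Re \<alpha>"
        using t \<alpha> by (auto intro!: ge_one_powr_ge_zero)
      hence "1 * 1 \<le> t powr (Re \<alpha> + 1) * t powr Re \<alpha>" by (intro mult_mono) auto
      hence 1: "1 / (t powr (Re \<alpha> + 1) * t powr Re \<alpha>) \<le> 1" using t by (subst divide_le_eq_1_pos) auto
      have "real n * 1 \<le> t * t" using t by (intro mult_mono) auto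
      hence 2: "exp (- t\<^sup>2 / 2) \<le> exp (- real n / 2)" by (simp add: power2_eq_square)
      have "norm (1 / (?t n powr (\<alpha> + 1) * ?t n powr \<alpha>) * exp (- (?t n)\<^sup>2 / 2)) =
         1 / (t powr (Re \<alpha> + 1) * t powr Re \<alpha>) * exp (- t\<^sup>2 / 2)"
        unfolding t_def[symmetric] using t
        by (simp add: norm_mult norm_divide norm_powr_real_powr flip: of_real_power)
      also have "\<dots> \<le> 1 * exp (- real n / 2)" by (intro mult_mono 1 2) auto
      finally show "norm (1 / (?t n powr (\<alpha> + 1) * ?t n powr \<alpha>) * exp (- (?t n)\<^sup>2 / 2)) \<le> exp (- real n / 2)" by simp
    qed
    show "(\<lambda>n. exp (- real n / 2)) \<longlonglongrightarrow> 0" by real_asymp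
  qed
  ultimately have L: "(\<lambda>n. ((?t n powr (\<alpha> + 1) * pc_R (\<alpha> + 1) (\<kappa> + 1) b (?t n)) * (?t n powr \<alpha> * pc_H \<alpha> (?t n))
     - (?t n powr \<alpha> * pc_R \<alpha> \<kappa> b (?t n)) * (?t n powr (\<alpha> + 1) * pc_H (\<alpha> + 1) (?t n))) *
     (1 / (?t n powr (\<alpha> + 1) * ?t n powr \<alpha>) * exp (- (?t n)\<^sup>2 / 2))) \<longlonglongrightarrow> 
     (Gamma (\<alpha> + 1) * pc_G (\<kappa> + 1 - (\<alpha> + 1)) b * Gamma \<alpha> - Gamma \<alpha> * pc_G (\<kappa> - \<alpha>) b * Gamma (\<alpha> + 1)) * 0"
    by (rule tendsto_mult)
  have X: "((?t n powr (\<alpha> + 1) * pc_R (\<alpha> + 1) (\<kappa> + 1) b (?t n)) * (?t n powr \<alpha> * pc_H \<alpha> (?t n))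
     - (?t n powr \<alpha> * pc_R \<alpha> \<kappa> b (?t n)) * (?t n powr (\<alpha> + 1) * pc_H (\<alpha> + 1) (?t n))) *
     (1 / (?t n powr (\<alpha> + 1) * ?t n powr \<alpha>) * exp (- (?t n)\<^sup>2 / 2)) = c" for n
  proof -
    have alg: "((p * r1) * (q * h0) - (q * r0) * (p * h1)) * (1 / (p * q) * e) = (r1 * h0 - r0 * h1) * e"
      if "p \<noteq> 0" "q \<noteq> 0" for p q r0 r1 h0 h1 e :: complex
      using that by (simp add: field_simps)
    have nz: "?t n powr (\<alpha> + 1) \<noteq> 0" "?t n powr \<alpha> \<noteq> 0"
      unfolding powr_eq_0_iff of_real_eq_0_iff by simp_all
    have "?t n \<in> sector" by (rule sector_of_real) simp
    from c[OF this] show ?thesis unfolding alg[OF nz] W_def .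
  qed
  have "c = 0" using L unfolding X mult_zero_right LIMSEQ_const_iff .
  thus ?thesis using c[OF a] by (simp add: W_def)
qed

text \<open>The vanishing Wronskian makes \<open>R / H\<close> locally constant only where
  \<open>H\<close> has no zero. The limit of \<open>H\<close> supplies one point with H nonzero,
  hence a zero-free ball, and the identity theorem on the connected sector extends R = c H past all
  zeros of \<open>H\<close>.\<close>

lemma pc_R_eq:
  assumes \<alpha>: "Re \<alpha> > 0" and a: "a \<in> sector" and b: "b \<in> sector"
  shows "pc_R \<alpha> \<kappa> b a = pc_G (\<kappa> - \<alpha>) b * pc_H \<alpha> a"
proof -
  let ?t = "\<lambda>n. complex_of_real (real (Suc n))"
  have G: "Gamma \<alpha> \<noteq> 0" using Gamma_neq_0_pos[OF \<alpha>] .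
  have ts: "?t n \<in> sector" for n by (rule sector_of_real) simp
  have holH: "pc_H \<alpha> holomorphic_on S" for S
    using has_field_derivative_pc_H[OF \<alpha>] holomorphic_on_open[of UNIV] holomorphic_on_subset by blast
  have holR: "pc_R \<alpha> \<kappa> b holomorphic_on sector"
    using has_field_derivative_pc_R[OF \<alpha> _ b] holomorphic_on_open[OF open_sector] by blast
  have "\<forall>\<^sub>F n in sequentially. ?t n powr \<alpha> * pc_H \<alpha> (?t n) \<noteq> 0"
    using tendsto_imp_eventually_ne[OF pc_H_limit[OF \<alpha>] G] .
  from eventually_happens'[OF sequentially_bot this]
  obtain n0 where "?t n0 powr \<alpha> * pc_H \<alpha> (?t n0) \<noteq> 0" ..
  hence n0: "pc_H \<alpha> (?t n0) \<noteq> 0" by auto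
  have "open (sector \<inter> pc_H \<alpha> -` (- {0}))"
    by (intro continuous_open_preimage holomorphic_on_imp_continuous_on holH open_sector) auto
  then obtain r where r: "r > 0" "ball (?t n0) r \<subseteq> sector \<inter> pc_H \<alpha> -` (- {0})"
    using n0 ts open_contains_ball by blast
  have "((\<lambda>a. pc_R \<alpha> \<kappa> b a / pc_H \<alpha> a) has_field_derivative 0) (at a within ball (?t n0) r)" if "a \<in> ball (?t n0) r" for a
  proof -
    have a: "a \<in> sector" "pc_H \<alpha> a \<noteq> 0" using that r by auto
    have "((\<lambda>a. pc_R \<alpha> \<kappa> b a / pc_H \<alpha> a) has_field_derivative
       (- pc_R (\<alpha> + 1) (\<kappa> + 1) b a * pc_H \<alpha> a - pc_R \<alpha> \<kappa> b a * (- pc_H (\<alpha> + 1) a)) / (pc_H \<alpha> a * pc_H \<alpha> a)) (at a)"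
      by (intro DERIV_divide has_field_derivative_pc_R has_field_derivative_pc_H \<alpha> a b)
    moreover have "- pc_R (\<alpha> + 1) (\<kappa> + 1) b a * pc_H \<alpha> a - pc_R \<alpha> \<kappa> b a * (- pc_H (\<alpha> + 1) a) = 0"
      using pc_wronskian_zero[OF \<alpha> a(1) b, of \<kappa>] by simp
    ultimately show ?thesis by (simp add: has_field_derivative_at_within)
  qed
  then obtain c where c: "\<And>a. a \<in> ball (?t n0) r \<Longrightarrow> pc_R \<alpha> \<kappa> b a / pc_H \<alpha> a = c"
    using has_field_derivative_zero_constant[OF convex_ball, of "?t n0" r "\<lambda>a. pc_R \<alpha> \<kappa> b a / pc_H \<alpha> a"] by blast
  have eq: "pc_R \<alpha> \<kappa> b a = c * pc_H \<alpha> a" if a: "a \<in> sector" for a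
  proof -
    have "pc_R \<alpha> \<kappa> b a - c * pc_H \<alpha> a = 0"
    proof (rule analytic_continuation[of "\<lambda>a. pc_R \<alpha> \<kappa> b a - c * pc_H \<alpha> a" sector "ball (?t n0) r" "?t n0"])
      show "(\<lambda>a. pc_R \<alpha> \<kappa> b a - c * pc_H \<alpha> a) holomorphic_on sector"
        by (intro holomorphic_intros holH holR)
      show "?t n0 islimpt ball (?t n0) r" using r(1) by (simp add: islimpt_ball)
      show "pc_R \<alpha> \<kappa> b z - c * pc_H \<alpha> z = 0" if "z \<in> ball (?t n0) r" for z
      proof -
        have "pc_H \<alpha> z \<noteq> 0" using that r by blast
        thus ?thesis using c[OF that] by (simp add: field_simps)
      qed
    qed (use open_sector convex_connected[OF convex_sector] r ts a in auto)
    thus ?thesis by simp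
  qed
  have "(\<lambda>n. c * (?t n powr \<alpha> * pc_H \<alpha> (?t n))) \<longlonglongrightarrow> c * Gamma \<alpha>"
    by (rule tendsto_mult_left[OF pc_H_limit[OF \<alpha>]])
  moreover have "(\<lambda>n. c * (?t n powr \<alpha> * pc_H \<alpha> (?t n))) \<longlonglongrightarrow> Gamma \<alpha> * pc_G (\<kappa> - \<alpha>) b"
    using pc_R_limit[OF \<alpha> b, of \<kappa>] unfolding eq[OF ts] by (simp only: mult_ac)
  ultimately have "c * Gamma \<alpha> = Gamma \<alpha> * pc_G (\<kappa> - \<alpha>) b" by (rule LIMSEQ_unique)
  hence "c = pc_G (\<kappa> - \<alpha>) b" using G by simp
  thus ?thesis using eq[OF a] by simp
qed

section \<open>The substitution\<close>

lemma sector_Arg: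
  assumes "z \<noteq> 0" "\<bar>Arg z\<bar> < pi / 4"
  shows "z \<in> sector"
proof -
  define A where "A = \<bar>Arg z\<bar>"
  have A: "0 \<le> A" "A < pi / 4" using assms by (auto simp: A_def)
  have "sin A < sin (pi / 4)" using A pi_gt_zero by (intro sin_monotone_2pi) linarith+
  also have "\<dots> = cos (pi / 4)" by (simp add: sin_45 cos_45)
  also have "\<dots> < cos A" using A pi_gt_zero by (intro cos_monotone_0_pi) linarith+
  finally have sc: "sin A < cos A" .
  have "sin A \<ge> 0" using A pi_gt_zero by (intro sin_ge_zero) linarith+
  hence s: "\<bar>sin (Arg z)\<bar> = sin A" unfolding A_def by (cases "Arg z \<ge> 0") auto
  have c: "cos (Arg z) = cos A" unfolding A_def by (cases "Arg z \<ge> 0") auto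
  have z: "z = of_real (norm z) * exp (\<i> * of_real (Arg z))" using Arg_eq[OF assms(1)] .
  have "Re z = norm z * cos (Arg z)" "Im z = norm z * sin (Arg z)"
    using arg_cong[OF z, of Re] arg_cong[OF z, of Im] by (simp_all add: Re_exp Im_exp)
  thus ?thesis using sc assms(1) by (simp add: sector_def abs_mult s c)
qed

lemma coth_exp:
  assumes "t > 0"
  defines "x \<equiv> exp (- 2 * t)"
  shows "coth t = (1 + x) / (1 - x)" and "1 - x\<^sup>2 = 2 * x * sinh (2 * t)"
proof -
  have e: "exp (- t) = exp t * x" unfolding x_def exp_add[symmetric] by simp
  have "x < 1" using assms by (simp add: x_def)
  have "sinh t = exp t * (1 - x) / 2" "cosh t = exp t * (1 + x) / 2"
    unfolding sinh_field_def cosh_field_def e by (simp_all add: algebra_simps)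
  hence "coth t = (exp t * (1 + x) / 2) / (exp t * (1 - x) / 2)" by (simp only: coth_def)
  also have "\<dots> = (1 + x) / (1 - x)" using \<open>x < 1\<close> by simp
  finally show "coth t = (1 + x) / (1 - x)" .
  have "x * exp (2 * t) = 1" unfolding x_def exp_add[symmetric] by simp
  moreover have "2 * x * sinh (2 * t) = x * exp (2 * t) - x * x"
  proof -
    have "exp (- (2 * t)) = x" by (simp add: x_def)
    thus ?thesis unfolding sinh_field_def by (simp add: field_simps)
  qed
  ultimately show "1 - x\<^sup>2 = 2 * x * sinh (2 * t)" by (simp add: power2_eq_square)
qed

text \<open>With x = exp (- 2 t), u = 1 - x^2 factors as (1 + x)(1 - x), so z (1 + x) / sqrt u = z
  sqrt (coth t), the argument of D in the theorem. The factor 2 x is the absolute Jacobian.\<close>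

lemma pc_integrand_substitution:
  assumes t: "t > 0"
  defines "x \<equiv> exp (- 2 * t)"
  shows "of_real (2 * x) * (of_real x powr (- \<nu> - 1) * pc_g (\<mu> - 1) (of_real (1 - x\<^sup>2)) (z * of_real x + z)) =
    2 powr (1 - \<mu> / 2) * (exp ((2 * \<nu> + \<mu>) * of_real t - z\<^sup>2 / 4 * of_real (coth t))
      * parabolic_cylinder_D (\<mu> - 1) (z * of_real (sqrt (coth t)))
      / of_real (sinh (2 * t)) powr (\<mu> / 2))"
proof -
  define U where "U = 1 - x\<^sup>2"
  have x: "0 < x" "x < 1" using t by (auto simp: x_def)
  have U: "U > 0" using unit_interval_square[of x] x by (simp add: U_def)
  have sh: "sinh (2 * t) > 0" using t by simp
  have lnx: "ln x = - 2 * t" by (simp add: x_def)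
  have "U = 2 * x * sinh (2 * t)" unfolding U_def x_def by (rule coth_exp(2)[OF t])
  hence lnU: "ln U = ln 2 - 2 * t + ln (sinh (2 * t))"
    using x sh by (simp add: ln_mult lnx)
  have "(1 + x) / sqrt U = sqrt (coth t)"
  proof (rule real_sqrt_unique[symmetric])
    have "U = (1 + x) * (1 - x)" by (simp add: U_def power2_eq_square algebra_simps)
    hence "(1 + x)\<^sup>2 / U = (1 + x) / (1 - x)" using x by (simp add: power2_eq_square)
    thus "((1 + x) / sqrt U)\<^sup>2 = coth t"
      using U coth_exp(1)[OF t] by (simp add: power_divide x_def)
  qed (use x U in auto)
  moreover have "complex_of_real U powr (- 1 / 2) = of_real (1 / sqrt U)"
    using powr_of_real[of U "- 1 / 2"] U by (simp add: powr_minus_divide powr_half_sqrt)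
  moreover have "(z * of_real x + z) * of_real (1 / sqrt U) = z * of_real ((1 + x) / sqrt U)"
    by (simp add: field_simps)
  ultimately have w: "(z * of_real x + z) * of_real U powr (- 1 / 2) = z * of_real (sqrt (coth t))"
    by (simp only:)
  have coth0: "coth t \<ge> 0" using coth_exp(1)[OF t] x by (simp add: x_def)
  have w2: "(z * of_real (sqrt (coth t)))\<^sup>2 = z\<^sup>2 * of_real (coth t)"
    using coth0 by (simp add: power_mult_distrib flip: of_real_power)
  have p1: "of_real (2 * x) * complex_of_real x powr (- \<nu> - 1) = 2 * exp (2 * \<nu> * of_real t)"
  proof -
    have "of_real (2 * x) = 2 * exp (complex_of_real (ln x))" using x by (simp add: exp_of_real)
    moreover have "exp (complex_of_real (ln x)) * exp ((- \<nu> - 1) * of_real (ln x)) = exp (2 * \<nu> * of_real t)"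
      unfolding exp_add[symmetric] lnx by (simp add: algebra_simps)
    ultimately show ?thesis unfolding of_real_powr_conv_exp[OF x(1)] by (simp only: mult.assoc)
  qed
  \<comment> \<open>For \<kappa> = \<mu> - 1 the prefactor of \<open>pc_g\<close> is
    \<open>U powr (- \<mu> / 2)\<close>. As U = 2 x sinh (2 t), it splits into a power of 2, the
    factor exp (\<mu> t) coming from x, and the denominator of the integrand.\<close>
  have p2: "of_real U powr (- \<mu> / 2) * of_real (sinh (2 * t)) powr (\<mu> / 2) = exp (- \<mu> / 2 * of_real (ln 2) + \<mu> * of_real t)"
    unfolding of_real_powr_conv_exp[OF U] of_real_powr_conv_exp[OF sh] exp_add[symmetric] lnU
    by (simp add: algebra_simps)
  have p3: "2 * exp (- \<mu> / 2 * of_real (ln 2)) = (2::complex) powr (1 - \<mu> / 2)"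
  proof -
    have "2 powr (1 - \<mu> / 2) = 2 powr (1 + (- \<mu> / 2))" by simp
    also have "\<dots> = 2 * 2 powr (- \<mu> / 2)" by (simp only: powr_add) simp
    also have "2 powr (- \<mu> / 2) = exp (- \<mu> / 2 * of_real (ln 2))"
      using of_real_powr_conv_exp[of 2 "- \<mu> / 2"] by simp
    finally show ?thesis ..
  qed
  have nz: "complex_of_real (sinh (2 * t)) powr (\<mu> / 2) \<noteq> 0" using sh unfolding powr_eq_0_iff of_real_eq_0_iff by linarith
  let ?D = "parabolic_cylinder_D (\<mu> - 1) (z * of_real (sqrt (coth t)))"
  have "of_real (2 * x) * (of_real x powr (- \<nu> - 1) * pc_g (\<mu> - 1) (of_real (1 - x\<^sup>2)) (z * of_real x + z)) *
     of_real (sinh (2 * t)) powr (\<mu> / 2) =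
     (of_real (2 * x) * of_real x powr (- \<nu> - 1)) * (of_real U powr (- \<mu> / 2) * of_real (sinh (2 * t)) powr (\<mu> / 2)) *
     (exp (- (z\<^sup>2 * of_real (coth t)) / 4) * ?D)"
    unfolding pc_g_def U_def[symmetric] w pc_G_def w2 by simp
  also have "\<dots> = (2 * exp (- \<mu> / 2 * of_real (ln 2))) * (exp (2 * \<nu> * of_real t) * exp (\<mu> * of_real t) * exp (- (z\<^sup>2 * of_real (coth t)) / 4)) * ?D"
    unfolding p1 p2 exp_add by (simp only: mult_ac)
  also have "exp (2 * \<nu> * of_real t) * exp (\<mu> * of_real t) * exp (- (z\<^sup>2 * of_real (coth t)) / 4) = 
     exp ((2 * \<nu> + \<mu>) * of_real t - z\<^sup>2 / 4 * of_real (coth t))"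
    unfolding exp_add[symmetric] by (simp add: algebra_simps)
  finally show ?thesis unfolding p3 using nz by (simp add: field_simps)
qed

theorem corollary1:
  fixes \<mu> \<nu> z :: complex
  assumes "Re \<nu> < 0"
    and "z \<noteq> 0"
    and "\<bar>Arg z\<bar> < pi / 4"
  shows "let f = (\<lambda>t::real.
             exp ((2 * \<nu> + \<mu>) * of_real t - z\<^sup>2 / 4 * of_real (coth t))
             * parabolic_cylinder_D (\<mu> - 1) (z * of_real (sqrt (coth t)))
             / of_real (sinh (2 * t)) powr (\<mu> / 2))
         in set_integrable lborel {0<..} f \<and>
            parabolic_cylinder_D \<nu> z * parabolic_cylinder_D (\<nu> + \<mu> - 1) z
              = 2 powr (1 - \<mu> / 2) / Gamma (- \<nu>) * (LINT t:{0<..}|lborel. f t)"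
proof -
  define f where "f = (\<lambda>t::real.
             exp ((2 * \<nu> + \<mu>) * of_real t - z\<^sup>2 / 4 * of_real (coth t))
             * parabolic_cylinder_D (\<mu> - 1) (z * of_real (sqrt (coth t)))
             / of_real (sinh (2 * t)) powr (\<mu> / 2))"
  define F where "F x = of_real x powr (- \<nu> - 1) * pc_g (\<mu> - 1) (of_real (1 - x\<^sup>2)) (z * of_real x + z)" for x
  \<comment> \<open>\<open>g\<close> is decreasing, so the Jacobian enters through
    \<open>abs (h t)\<close>, which is 2 x.\<close>
  define g h :: "real \<Rightarrow> real" where "g t = exp (- 2 * t)" and "h t = - 2 * exp (- 2 * t)" for t
  define c where "c = (2::complex) powr (1 - \<mu> / 2)"
  have c0: "c \<noteq> 0" by (simp add: c_def)
  have \<nu>: "Re (- \<nu>) > 0" using assms(1) by simp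
  have z: "z \<in> sector" using assms(2,3) by (rule sector_Arg)
  have F: "set_integrable lborel {0<..<1} F" "continuous_on {0<..<1} F"
    unfolding F_def using pc_R_integrable[OF \<nu> z z] continuous_on_pc_R_integrand by auto
  have im: "g ` {0<..} = {0<..<1}"
  proof (intro equalityI subsetI)
    fix x :: real assume "x \<in> {0<..<1}"
    hence "x = g (- ln x / 2)" "- ln x / 2 \<in> {0<..}" by (auto simp: g_def)
    thus "x \<in> g ` {0<..}" by (rule image_eqI)
  qed (auto simp: g_def)
  have inj: "inj_on g {0<..}" by (auto simp: inj_on_def g_def)
  have der: "(g has_field_derivative h t) (at t)" for t
    unfolding g_def h_def by (auto intro!: derivative_eq_intros)
  have ch: "continuous_on {0<..} h" unfolding h_def by (intro continuous_intros)
  note cov = set_integral_change_of_variables[of "{0<..}" g h F, unfolded im, OF _ _ der inj ch F(2,1), simplified]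
  have eq: "of_real \<bar>h t\<bar> * F (g t) = c * f t" if "t \<in> {0<..}" for t
    using pc_integrand_substitution[of t \<nu> \<mu> z] that by (simp add: h_def g_def F_def f_def c_def)
  have "set_integrable lborel {0<..} (\<lambda>t. c * f t)"
    using cov(1) by (rule set_integrable_cong[THEN iffD1, rotated -1]) (use eq in auto)
  \<comment> \<open>The substitution yields the integrand only up to the nonzero constant
    \<open>c\<close>; dividing it out gives integrability of \<open>f\<close> itself.\<close>
  hence "set_integrable lborel {0<..} (\<lambda>t. 1 / c * (c * f t))" by (rule set_integrable_mult_right)
  hence 1: "set_integrable lborel {0<..} f" using c0 by simp
  have "(LINT t:{0<..}|lborel. c * f t) = (LINT t:{0<..}|lborel. of_real \<bar>h t\<bar> * F (g t))"
    by (rule set_lebesgue_integral_cong) (use eq in auto)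
  also have "\<dots> = (LINT x:{0<..<1}|lborel. F x)" using cov(2) by simp
  also have "\<dots> = pc_R (- \<nu>) (\<mu> - 1) z z" unfolding pc_R_def F_def ..
  \<comment> \<open>Here \<alpha> = - \<nu> and \<kappa> = \<mu> - 1, so \<kappa> - \<alpha> is the
    index \<nu> + \<mu> - 1 of the second factor. The Gaussian factors of \<open>pc_G\<close> and
    \<open>pc_H\<close> at the same point z then cancel.\<close>
  also have "\<dots> = pc_G (\<mu> - 1 - - \<nu>) z * pc_H (- \<nu>) z" by (rule pc_R_eq[OF \<nu> z z])
  also have "\<dots> = Gamma (- \<nu>) * ((exp (- z\<^sup>2 / 4) * exp (z\<^sup>2 / 4)) * (parabolic_cylinder_D \<nu> z * parabolic_cylinder_D (\<nu> + \<mu> - 1) z))"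
    unfolding pc_G_def pc_H_def pc_h_def by (simp add: algebra_simps)
  also have "exp (- z\<^sup>2 / 4) * exp (z\<^sup>2 / 4) = 1" unfolding exp_add[symmetric] by simp
  finally have "parabolic_cylinder_D \<nu> z * parabolic_cylinder_D (\<nu> + \<mu> - 1) z = c / Gamma (- \<nu>) * (LINT t:{0<..}|lborel. f t)"
    using Gamma_neq_0_pos[OF \<nu>] by (simp add: field_simps)
  with 1 show ?thesis unfolding f_def c_def Let_def by blast
qed

end
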